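(* Let $s\in(0,1)$ and $p\ge 2$, and set $$N_0:=\begin{cases} sp(p+1) & \text{if } 2\le p<\frac{3+\sqrt5}{2},\\ sp(p^2-p+1) & \text{if } p\ge \frac{3+\sqrt5}{2}.\end{cases}$$ Let $N\in\mathbb{N}$ with $N>N_0$, and let $\Omega\subset\mathbb{R}^N$ be a bounded domain with smooth boundary. Then there exist $\mu^*>0$ and $q_0\in(0,p-1)$ such that for all $\mu\in(0,\mu^* )$ and all $q\in(q_0,p-1)$ the problem $$(-\Delta)^s_p u=\mu|u|^{q-1}u+|u|^{p_s^*-2}u\ \text{ in }\Omega,\qquad u=0\ \text{ in }\mathbb{R}^N\setminus\Omega,$$ where $p_s^*=\frac{Np}{N-ps}$, has at least one sign-changing weak solution.
   Context: $X_0$ is the space of measurable $u:\mathbb{R}^N\to\mathbb{R}$ with $u|_\Omega\in L^p(\Omega)$, $u=0$ a.e. in $\mathbb{R}^N\setminus\Omega$ and $$\|u\|_{X_0}^p:=\int_{\mathbb{R}^{2N}}\frac{|u(x)-u(y)|^p}{|x-y|^{N+sp}}\,dx\,dy<\infty .$$ A weak solution of the problem is a function $u\in X_0$ such that for all $\phi\in X_0$ $$\int_{\mathbb{R}^{2N}}\frac{|u(x)-u(y)|^{p-2}(u(x)-u(y))(\phi(x)-\phi(y))}{|x-y|^{N+ps}}\,dx\,dy=\mu\int_\Omega|u|^{q-1}u\,\phi\,dx+\int_\Omega|u|^{p_s^*-2}u\,\phi\,dx .$$ It is sign-changing if both $u^+=\max\{u,0\}$ and $u^-=\max\{-u,0\}$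 are not a.e. equal to $0$. *)

theory Defs
  imports "HOL-Analysis.Analysis"
begin

definition N0 :: "real \<Rightarrow> real \<Rightarrow> real" where
  "N0 s p = (if p < (3 + sqrt 5) / 2 then s * p * (p + 1) else s * p * (p\<^sup>2 - p + 1))"

text \<open>Differentiability of class \<open>C\<^sup>k\<close> on the whole space, by recursion on directional derivatives.\<close>

primrec Ck :: "nat \<Rightarrow> ('a::real_normed_vector \<Rightarrow> real) \<Rightarrow> bool" where
  "Ck 0 f \<longleftrightarrow> continuous_on UNIV f"
| "Ck (Suc k) f \<longleftrightarrow> (\<forall>x. f differentiable (at x)) \<and>
     (\<forall>v. Ck k (\<lambda>x. frechet_derivative f (at x) v))"

text \<open>The boundary is locally a \<open>C\<^sup>\<infinity>\<close> graph with the set on one side, up to relabelling and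
  reorienting the coordinate axes. A function of the remaining \<open>N - 1\<close> coordinates is encoded as a
  function on the whole space that does not depend on the coordinate \<open>i\<close>.\<close>

definition smooth_boundary :: "(real ^ 'n) set \<Rightarrow> bool" where
  "smooth_boundary \<Omega> \<longleftrightarrow>
     (\<forall>x0 \<in> frontier \<Omega>. \<exists>r > 0. \<exists>i. \<exists>\<sigma> \<in> {1, -1::real}. \<exists>\<gamma> :: real ^ 'n \<Rightarrow> real.
        (\<forall>k. Ck k \<gamma>) \<and>
        (\<forall>x y. (\<forall>j. j \<noteq> i \<longrightarrow> x $ j = y $ j) \<longrightarrow> \<gamma> x = \<gamma> y) \<and>
        \<Omega> \<inter> ball x0 r = {x \<in> ball x0 r. \<sigma> * x $ i > \<gamma> x})"

definition bounded_smooth_domain :: "(real ^ 'n) set \<Rightarrow> bool" where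
  "bounded_smooth_domain \<Omega> \<longleftrightarrow>
     open \<Omega> \<and> connected \<Omega> \<and> \<Omega> \<noteq> {} \<and> bounded \<Omega> \<and> smooth_boundary \<Omega>"

definition X0 :: "real \<Rightarrow> real \<Rightarrow> (real ^ 'n) set \<Rightarrow> (real ^ 'n \<Rightarrow> real) set" where
  "X0 s p \<Omega> = {u. u \<in> borel_measurable lebesgue \<and>
     set_integrable lebesgue \<Omega> (\<lambda>x. \<bar>u x\<bar> powr p) \<and>
     (AE x in lebesgue. x \<notin> \<Omega> \<longrightarrow> u x = 0) \<and>
     nn_integral lebesgue (\<lambda>(x, y).
       ennreal (\<bar>u x - u y\<bar> powr p / norm (x - y) powr (real CARD('n) + s * p))) < \<infinity>}"

definition critical_exponent :: "nat \<Rightarrow> real \<Rightarrow> real \<Rightarrow> real" where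
  "critical_exponent N s p = real N * p / (real N - p * s)"

definition energy_integrand ::
    "real \<Rightarrow> real \<Rightarrow> (real ^ 'n \<Rightarrow> real) \<Rightarrow> (real ^ 'n \<Rightarrow> real) \<Rightarrow> (real ^ 'n) \<times> (real ^ 'n) \<Rightarrow> real" where
  "energy_integrand s p u \<phi> = (\<lambda>(x, y).
     \<bar>u x - u y\<bar> powr (p - 2) * (u x - u y) * (\<phi> x - \<phi> y) /
       norm (x - y) powr (real CARD('n) + p * s))"

text \<open>Integrability is required explicitly because a Bochner integral that does not exist has
  the value 0. It is automatic for \<open>u, \<phi> \<in> X0 s p \<Omega>\<close> with \<open>\<Omega>\<close> bounded, \<open>p * s < N\<close> and
  \<open>0 < q < p - 1\<close>, by Hoelder's inequality and the fractional Sobolev embedding.\<close>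

definition weak_solution ::
    "real \<Rightarrow> real \<Rightarrow> real \<Rightarrow> real \<Rightarrow> (real ^ 'n) set \<Rightarrow> (real ^ 'n \<Rightarrow> real) \<Rightarrow> bool" where
  "weak_solution s p \<mu> q \<Omega> u \<longleftrightarrow> u \<in> X0 s p \<Omega> \<and>
     (\<forall>\<phi> \<in> X0 s p \<Omega>.
        integrable lebesgue (energy_integrand s p u \<phi>) \<and>
        set_integrable lebesgue \<Omega> (\<lambda>x. \<bar>u x\<bar> powr (q - 1) * u x * \<phi> x) \<and>
        set_integrable lebesgue \<Omega>
          (\<lambda>x. \<bar>u x\<bar> powr (critical_exponent CARD('n) s p - 2) * u x * \<phi> x) \<and>
        integral\<^sup>L lebesgue (energy_integrand s p u \<phi>) =
          \<mu> * (LINT x:\<Omega>|lebesgue. \<bar>u x\<bar> powr (q - 1) * u x * \<phi> x) +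
          (LINT x:\<Omega>|lebesgue. \<bar>u x\<bar> powr (critical_exponent CARD('n) s p - 2) * u x * \<phi> x))"

definition sign_changing :: "(real ^ 'n \<Rightarrow> real) \<Rightarrow> bool" where
  "sign_changing u \<longleftrightarrow>
     \<not> (AE x in lebesgue. max (u x) 0 = 0) \<and> \<not> (AE x in lebesgue. max (- u x) 0 = 0)"

end

theory Submission
  imports Defs "HOL-Complex_Analysis.Great_Picard"
begin

text \<open>
  Write \<open>E u = \<integral>\<integral> |u x - u y|\<^sup>p K(x, y)\<close> with \<open>K(x, y) = |x - y| powr - (N + s p)\<close>, and \<open>r = p\<^sub>s\<^sup>* - 1\<close>, so that
  the reaction is \<open>\<mu> t powr q + t powr r\<close> for \<open>t \<ge> 0\<close>. The solution is found among small bounded functions,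
  where the critical power is a harmless perturbation.

  \<^bold>\<open>Truncation.\<close> Since \<open>\<Omega>\<close> is bounded, each \<open>x\<close> in \<open>\<Omega>\<close> sees the complement with a weight
  \<open>\<integral>\<^bsub>y \<notin> \<Omega>\<^esub> K(x, y) \<ge> c0 > 0\<close>. Cutting a function at height \<open>\<delta>\<close> therefore saves a definite amount of energy
  (\<open>E_truncation\<close>), and a minimiser of \<open>E u / p - \<integral> h u\<close> with \<open>|h| \<le> M\<close> satisfies \<open>|u| \<le> \<delta>\<close> as soon as
  \<open>M p \<le> c0 \<delta> powr (p - 1)\<close>. So the reaction may be frozen beyond \<open>|t| = \<delta>\<close>: solutions of the frozen
  problem do not exceed the level beyond which it was changed. For \<open>q\<close> close to \<open>p - 1\<close> and \<open>\<mu>\<close> small there is a \<open>\<delta>\<close>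
  that fulfils this bound and makes \<open>f t / t powr (p - 1)\<close> strictly decreasing, where \<open>f\<close> is the frozen
  reaction (\<open>truncation_level_exists\<close>); \<open>f\<close> is then bounded, odd, non-decreasing and sublinear.

  \<^bold>\<open>Descent.\<close> Let \<open>F\<close> be the primitive of \<open>f\<close>, \<open>J u = E u / p - \<integral> F u\<close>, and let \<open>T v\<close> be the minimiser of
  \<open>E u / p - \<integral> f(v) u\<close>. The convexity of \<open>F\<close> and the uniform convexity of \<open>E\<close> for \<open>p \<ge> 2\<close> give
  \<open>J (T v) \<le> J v\<close>, with equality only if \<open>T v = v\<close>, that is, only if \<open>v\<close> solves the equation. The maps \<open>T\<close> and
  \<open>J \<circ> T\<close> are continuous in \<open>L\<^sup>1\<close>, and sublevel sets of \<open>J\<close> are compact in \<open>L\<^sup>1\<close>. Iterating \<open>T\<close> plays the role of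
  a gradient flow.

  \<^bold>\<open>Solutions of one sign.\<close> A non-negative solution \<open>z \<noteq> 0\<close> is positive in \<open>\<Omega>\<close> (\<open>strong_maximum_principle\<close>).
  As \<open>E\<close> is convex along \<open>((1 - t) z powr p + t w powr p) powr (1 / p)\<close> and \<open>F\<close> is strictly concave along it,
  \<open>z\<close> minimises \<open>J\<close>, and it is the only non-negative minimiser (\<open>nonneg_critical_minimal\<close>).

  \<^bold>\<open>Mountain pass.\<close> Suppose that no solution changes sign, and let \<open>w \<ge> 0\<close> minimise \<open>J\<close>. Then \<open>w\<close> and \<open>- w\<close> are
  the only minimisers, every solution of negative energy is one of them, and by compactness the functions
  with \<open>J < c\<close> lie in two disjoint balls around \<open>w\<close> and \<open>- w\<close>, for some \<open>c > J w\<close>. Two bumps with disjoint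
  supports span a path on which \<open>J < 0\<close> and whose end points are opposite. Each iterate \<open>T\<^sup>n\<close> of this path
  has opposite end points too, and hence a point with \<open>J \<ge> c\<close>. Compactness of the parameter interval
  yields one point of the path whose whole trajectory stays above \<open>c\<close>; it accumulates at a solution with
  level in \<open>[c, 0)\<close>, which is a contradiction (\<open>ex_sign_changing_critical\<close>).

  All of this is carried out for a general kernel on a measure space, given compactness
  and three bump functions. For the fractional kernel, compactness comes from averaging over small cubes
  (\<open>fractional_rellich\<close>) and the bumps are distance functions (\<open>lipschitz_in_W\<close>).
\<close>

section \<open>Inequalities for powers of real numbers\<close>

lemma powr_tangent_nonneg:
  fixes x y p :: real
  assumes "1 \<le> p" "0 \<le> x" "0 \<le> y"
  shows "x powr p + p * x powr (p - 1) * (y - x) \<le> y powr p"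
proof (cases "x = 0 \<or> y = 0")
  case True
  have "p * (x * x powr (p - 1)) = p * x powr p"
    using assms by (simp add: powr_mult_base)
  moreover have "x powr p \<le> p * x powr p" using assms by (simp add: mult_right_mono[of 1 p "x powr p", simplified])
  ultimately show ?thesis using True by (auto simp: algebra_simps)
next
  case False
  then have "x > 0" "y > 0" using assms by auto
  then have "y powr p - x powr p \<ge> (p * x powr (p - 1)) * (y - x)"
    by (intro convex_on_imp_above_tangent[where A="{0<..}"] powr_convex assms)
       (auto intro!: derivative_eq_intros simp: interior_open)
  then show ?thesis by simp
qed

text \<open>
  The tangent line of the convex function \<open>|x| powr p\<close>; its slope \<open>p |x| powr (p - 2) x\<close> is the nonlinearity of
  the \<open>p\<close>-Laplacian.
\<close>

lemma abs_powr_tangent: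
  fixes x y p :: real
  assumes "1 \<le> p"
  shows "\<bar>x\<bar> powr p + p * (\<bar>x\<bar> powr (p - 2) * x) * (y - x) \<le> \<bar>y\<bar> powr p"
proof -
  have e: "\<bar>x\<bar> powr (p - 2) * x * x = \<bar>x\<bar> powr p"
  proof (cases "x = 0")
    case False
    then have "\<bar>x\<bar> powr p = \<bar>x\<bar> powr (p - 2) * \<bar>x\<bar> powr 2" by (subst powr_add [symmetric]) simp
    also have "\<bar>x\<bar> powr 2 = x * x" using False by (simp add: power2_eq_square)
    finally show ?thesis by (simp only: mult.assoc)
  qed auto
  have e1: "\<bar>x\<bar> powr (p - 2) * \<bar>x\<bar> = \<bar>x\<bar> powr (p - 1)"
    by (cases "x = 0") (auto simp: powr_mult_base mult.commute)
  have e2: "\<bar>x\<bar> powr (p - 1) * \<bar>x\<bar> = \<bar>x\<bar> powr p"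
    by (cases "x = 0") (auto simp: powr_mult_base mult.commute)
  have "\<bar>x\<bar> powr (p - 2) * x * y \<le> \<bar>x\<bar> powr (p - 2) * \<bar>x\<bar> * \<bar>y\<bar>"
    by (metis abs_ge_self abs_mult abs_of_nonneg mult.assoc mult_left_mono powr_ge_zero)
  then have "p * (\<bar>x\<bar> powr (p - 2) * x * (y - x)) \<le> p * (\<bar>x\<bar> powr (p - 1) * (\<bar>y\<bar> - \<bar>x\<bar>))"
    using assms by (intro mult_left_mono) (auto simp: right_diff_distrib e e1 e2)
  with powr_tangent_nonneg[OF assms, of "\<bar>x\<bar>" "\<bar>y\<bar>"] show ?thesis by (simp add: mult.assoc)
qed

lemma abs_powr_convex:
  fixes a b p t :: real
  assumes "1 \<le> p" "0 \<le> t" "t \<le> 1"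
  shows "\<bar>(1 - t) * a + t * b\<bar> powr p \<le> (1 - t) * \<bar>a\<bar> powr p + t * \<bar>b\<bar> powr p"
proof -
  define c where "c = (1 - t) * a + t * b"
  define d where "d = p * (\<bar>c\<bar> powr (p - 2) * c)"
  have "(1 - t) * (\<bar>c\<bar> powr p + d * (a - c)) \<le> (1 - t) * \<bar>a\<bar> powr p"
    "t * (\<bar>c\<bar> powr p + d * (b - c)) \<le> t * \<bar>b\<bar> powr p"
    unfolding d_def using abs_powr_tangent[OF assms(1)] assms by (auto intro!: mult_left_mono)
  then have "(1 - t) * (\<bar>c\<bar> powr p + d * (a - c)) + t * (\<bar>c\<bar> powr p + d * (b - c))
     \<le> (1 - t) * \<bar>a\<bar> powr p + t * \<bar>b\<bar> powr p" by linarith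
  also have "(1 - t) * (\<bar>c\<bar> powr p + d * (a - c)) + t * (\<bar>c\<bar> powr p + d * (b - c)) = \<bar>c\<bar> powr p"
    unfolding c_def by (simp add: algebra_simps)
  finally show ?thesis by (simp add: c_def)
qed

lemma powr_superadditive:
  fixes x y r :: real
  assumes "0 \<le> x" "0 \<le> y" "1 \<le> r"
  shows "x powr r + y powr r \<le> (x + y) powr r"
proof -
  have *: "z powr r = z * z powr (r - 1)" if "0 \<le> z" for z :: real
    using that assms by (simp add: powr_mult_base)
  have "x powr r \<le> x * (x + y) powr (r - 1)" "y powr r \<le> y * (x + y) powr (r - 1)"
    using assms by (auto simp: * intro!: mult_left_mono powr_mono2)
  then have "x powr r + y powr r \<le> (x + y) * (x + y) powr (r - 1)" by (simp add: algebra_simps)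
  with assms show ?thesis by (simp add: *)
qed

lemma abs_powr_sum_le:
  fixes a b p :: real
  assumes "1 \<le> p"
  shows "\<bar>a + b\<bar> powr p \<le> 2 powr p * (\<bar>a\<bar> powr p + \<bar>b\<bar> powr p)"
proof -
  have "\<bar>a + b\<bar> powr p \<le> (2 * max \<bar>a\<bar> \<bar>b\<bar>) powr p" using assms by (intro powr_mono2) auto
  also have "\<dots> = 2 powr p * max \<bar>a\<bar> \<bar>b\<bar> powr p" by (simp add: powr_mult)
  also have "\<dots> \<le> 2 powr p * (\<bar>a\<bar> powr p + \<bar>b\<bar> powr p)"
    by (intro mult_left_mono) (auto simp: max_def)
  finally show ?thesis .
qed

text \<open>
  By the parallelogram law the squares of the two half-sums have the mean of \<open>a\<^sup>2\<close> and \<open>b\<^sup>2\<close> as their sum.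
  The power \<open>p / 2 \<ge> 1\<close> is superadditive, which bounds the left side, and convex, which gives the right side.
\<close>

lemma clarkson_scalar:
  fixes a b p :: real
  assumes "2 \<le> p"
  shows "\<bar>(a + b) / 2\<bar> powr p + \<bar>(a - b) / 2\<bar> powr p \<le> (\<bar>a\<bar> powr p + \<bar>b\<bar> powr p) / 2"
proof -
  have sq: "\<bar>x\<bar> powr p = (x\<^sup>2) powr (p / 2)" for x :: real
  proof (cases "x = 0")
    case False
    have "\<bar>x\<bar> powr p = \<bar>x\<bar> powr (2 * (p / 2))" by simp
    also have "\<dots> = (\<bar>x\<bar> powr 2) powr (p / 2)" by (simp only: powr_powr)
    finally show ?thesis using False by simp
  qed auto
  have "\<bar>(a + b) / 2\<bar> powr p + \<bar>(a - b) / 2\<bar> powr p \<le> (((a + b) / 2)\<^sup>2 + ((a - b) / 2)\<^sup>2) powr (p / 2)"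
    unfolding sq using assms by (intro powr_superadditive) auto
  also have "((a + b) / 2)\<^sup>2 + ((a - b) / 2)\<^sup>2 = (1 - 1/2) * a\<^sup>2 + 1/2 * b\<^sup>2"
    by (simp add: field_simps power2_eq_square)
  also have "((1 - 1/2) * a\<^sup>2 + 1/2 * b\<^sup>2) powr (p / 2) \<le> (1 - 1/2) * (a\<^sup>2) powr (p / 2) + 1/2 * (b\<^sup>2) powr (p / 2)"
    using abs_powr_convex[of "p/2" "1/2" "a\<^sup>2" "b\<^sup>2"] assms by simp
  finally show ?thesis by (simp add: sq)
qed

text \<open>The points \<open>y\<close> and \<open>w\<close> are convex combinations of \<open>x\<close> and \<open>z\<close> with interchanged weights.\<close>

lemma abs_powr_majorization:
  fixes x y z w p :: real
  assumes "1 \<le> p" "x \<le> y" "y \<le> z" "x + z = y + w"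
  shows "\<bar>y\<bar> powr p + \<bar>w\<bar> powr p \<le> \<bar>x\<bar> powr p + \<bar>z\<bar> powr p"
proof (cases "x = z")
  case False
  then have "x < z" using assms by linarith
  define t where "t = (y - x) / (z - x)"
  have t: "0 \<le> t" "t \<le> 1" using assms \<open>x < z\<close> by (auto simp: t_def)
  have y: "y = (1 - t) * x + t * z" 
  proof -
    have "t * (z - x) = y - x" using \<open>x < z\<close> by (simp add: t_def)
    then show ?thesis by (simp add: algebra_simps)
  qed
  have w: "w = (1 - (1 - t)) * x + (1 - t) * z" using assms(4) unfolding y by (simp add: algebra_simps)
  show ?thesis
    using abs_powr_convex[OF assms(1) t, of x z] abs_powr_convex[OF assms(1), of "1 - t" x z] t
    unfolding y[symmetric] w[symmetric] by (simp add: algebra_simps)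
qed (use assms in auto)

text \<open>
  If \<open>a, c\<close> and \<open>b, d\<close> are ordered alike, both sides agree. Otherwise the two differences on the left lie
  between those on the right and have the same sum.
\<close>

lemma abs_powr_submodular:
  fixes a b c d p :: real
  assumes "1 \<le> p"
  shows "\<bar>max a c - max b d\<bar> powr p + \<bar>min a c - min b d\<bar> powr p \<le> \<bar>a - b\<bar> powr p + \<bar>c - d\<bar> powr p"
proof -
  consider "c \<le> a" "d \<le> b" | "a \<le> c" "b \<le> d" | "c \<le> a" "b \<le> d" | "a \<le> c" "d \<le> b" by linarith
  then show ?thesis
  proof cases
    case 3
    have "\<bar>a - d\<bar> powr p + \<bar>c - b\<bar> powr p \<le> \<bar>a - b\<bar> powr p + \<bar>c - d\<bar> powr p"
      using abs_powr_majorization[OF assms, of "c - d" "a - d" "a - b" "c - b"] 3 by auto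
    then show ?thesis using 3 by simp
  next
    case 4
    have "\<bar>c - b\<bar> powr p + \<bar>a - d\<bar> powr p \<le> \<bar>a - b\<bar> powr p + \<bar>c - d\<bar> powr p"
      using abs_powr_majorization[OF assms, of "a - b" "c - b" "c - d" "a - d"] 4 by auto
    then show ?thesis using 4 by simp
  qed (auto simp: max_def min_def)
qed

text \<open>
  The surplus in the submodular inequality at a pair of points where one function jumps from \<open>0\<close> to a
  value \<open>b \<ge> \<sigma>\<close> and the other one is at most \<open>B\<close>. It is of first order in \<open>c\<close>, whereas the energy of a function
  of size \<open>c\<close> is of order \<open>p > 1\<close>; this comparison drives the strong maximum principle.
\<close>

lemma abs_powr_submodular_gain:
  fixes b c d p \<sigma> B :: real
  assumes p: "2 \<le> p" and "0 \<le> c" "c \<le> B" "0 \<le> d" "d \<le> B" "\<sigma> \<le> b" "0 < \<sigma>" "B \<le> \<sigma>" "p * B powr (p - 1) \<le> \<sigma> powr (p - 1) / 2"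
  shows "\<bar>max 0 c - max b d\<bar> powr p + \<bar>min 0 c - min b d\<bar> powr p + c * (\<sigma> powr (p - 1) / 2)
      \<le> \<bar>0 - b\<bar> powr p + \<bar>c - d\<bar> powr p"
proof -
  have b: "c \<le> b" "d \<le> b" "0 \<le> b" using assms by linarith+
  have *: "z powr p = z * z powr (p - 1)" if "0 \<le> z" for z :: real
    using that assms by (simp add: powr_mult_base)
  have "(b - c) powr p \<le> (b - c) * b powr (p - 1)"
    using b assms by (auto simp: * intro!: mult_left_mono powr_mono2)
  then have 1: "(b - c) powr p \<le> b powr p - c * b powr (p - 1)" using b by (simp add: * algebra_simps)
  have 3: "d powr p - p * d powr (p - 1) * c \<le> \<bar>c - d\<bar> powr p"
  proof -
    have e: "\<bar>d\<bar> powr (p - 2) * d = d powr (p - 1)"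
      using \<open>0 \<le> d\<close> by (cases "d = 0") (auto simp: powr_mult_base mult.commute)
    have E: "p * (\<bar>d\<bar> powr (p - 2) * d) * (d - c - d) = - (p * d powr (p - 1) * c)"
      unfolding e by (simp add: algebra_simps)
    have E': "\<bar>d\<bar> = d" "\<bar>d - c\<bar> = \<bar>c - d\<bar>" using \<open>0 \<le> d\<close> by auto
    have "\<bar>d\<bar> powr p + p * (\<bar>d\<bar> powr (p - 2) * d) * (d - c - d) \<le> \<bar>d - c\<bar> powr p"
      using p by (intro abs_powr_tangent) auto
    then show ?thesis by (simp only: E) (simp only: E' minus_add_distrib diff_conv_add_uminus[of "d powr p"])
  qed
  have "p * d powr (p - 1) * c \<le> (\<sigma> powr (p - 1) / 2) * c"
  proof (intro mult_right_mono)
    have "d powr (p - 1) \<le> B powr (p - 1)" using p \<open>0 \<le> d\<close> \<open>d \<le> B\<close> by (intro powr_mono2) auto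
    then have "p * d powr (p - 1) \<le> p * B powr (p - 1)" using p by (intro mult_left_mono) auto
    then show "p * d powr (p - 1) \<le> \<sigma> powr (p - 1) / 2"
      using \<open>p * B powr (p - 1) \<le> \<sigma> powr (p - 1) / 2\<close> by (rule order_trans)
  qed fact
  moreover have "c * \<sigma> powr (p - 1) \<le> c * b powr (p - 1)"
    using p \<open>0 < \<sigma>\<close> \<open>\<sigma> \<le> b\<close> \<open>0 \<le> c\<close> by (intro mult_left_mono powr_mono2) auto
  ultimately have "(b - c) powr p + d powr p + c * (\<sigma> powr (p - 1) / 2) \<le> b powr p + \<bar>c - d\<bar> powr p"
    using 1 3 by (simp add: algebra_simps)
  moreover have "max 0 c = c" "max b d = b" "min 0 c = 0" "min b d = d"
    using b \<open>0 \<le> c\<close> by auto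
  moreover have "\<bar>c - b\<bar> = b - c" "\<bar>0 - d\<bar> = d" "\<bar>0 - b\<bar> = b" using b \<open>0 \<le> d\<close> by auto
  ultimately show ?thesis by (simp only:)
qed

text \<open>
  The weighted \<open>\<ell>\<^sup>p\<close> mean of two non-negative numbers. For functions \<open>z, w \<ge> 0\<close> the curve \<open>pmean p t z w\<close> joins
  \<open>z\<close> to \<open>w\<close>, and the energy is convex along it.
\<close>

definition pmean :: "real \<Rightarrow> real \<Rightarrow> real \<Rightarrow> real \<Rightarrow> real" where
  "pmean p t a c = ((1 - t) * a powr p + t * c powr p) powr (1 / p)"

lemma pmean_nonneg: "0 \<le> pmean p t a c"
  by (simp add: pmean_def)

lemma pmean_powr:
  assumes "1 \<le> p" "0 \<le> t" "t \<le> 1"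
  shows "pmean p t a c powr p = (1 - t) * a powr p + t * c powr p"
  using assms by (simp add: pmean_def powr_powr)

lemma pmean_mono:
  assumes "1 \<le> p" "0 \<le> t" "t \<le> 1" "0 \<le> a" "a \<le> a'" "0 \<le> c" "c \<le> c'"
  shows "pmean p t a c \<le> pmean p t a' c'"
  unfolding pmean_def using assms
  by (intro powr_mono2 add_mono mult_left_mono) auto

lemma powr_le_cancel: "0 \<le> y \<Longrightarrow> 0 < (p::real) \<Longrightarrow> x powr p \<le> y powr p \<Longrightarrow> x \<le> y" for x y :: real
  by (meson linorder_not_le powr_less_mono2)

text \<open>
  The power mean dominates the arithmetic mean; this gives a lower bound for difference quotients that
  does not depend on \<open>t\<close>.
\<close>

lemma pmean_ge:
  assumes "1 \<le> p" "0 \<le> t" "t \<le> 1" "0 \<le> a" "0 \<le> c"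
  shows "(1 - t) * a + t * c \<le> pmean p t a c"
proof (rule powr_le_cancel[of _ p])
  show "((1 - t) * a + t * c) powr p \<le> pmean p t a c powr p"
    using abs_powr_convex[OF assms(1-3), of a c] assms by (simp add: pmean_powr)
qed (use assms in \<open>auto simp: pmean_nonneg\<close>)

text \<open>
  Minkowski's inequality for a weighted \<open>\<ell>\<^sup>p\<close> norm on the plane: divide both vectors by their norms and use
  the convexity of the power on the resulting unit vectors.
\<close>

lemma pmean_triangle:
  assumes p: "1 \<le> p" "0 \<le> t" "t \<le> 1" and nn: "0 \<le> a" "0 \<le> b" "0 \<le> c" "0 \<le> d"
  shows "pmean p t (a + b) (c + d) \<le> pmean p t a c + pmean p t b d"
proof -
  define k where "k = pmean p t a c"
  define l where "l = pmean p t b d"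
  have kl: "0 \<le> k" "0 \<le> l" by (auto simp: k_def l_def pmean_nonneg)
  have kp: "k powr p = (1 - t) * a powr p + t * c powr p" "l powr p = (1 - t) * b powr p + t * d powr p"
    using p by (auto simp: k_def l_def pmean_powr)
  consider "k = 0" | "l = 0" | "k > 0" "l > 0" using kl by linarith
  then show ?thesis
  proof cases
    case 1
    then have "(1 - t) * a powr p + t * c powr p = 0" using kp by simp
    then have "(1 - t) * a powr p = 0" "t * c powr p = 0"
      using p by (smt (verit) mult_nonneg_nonneg powr_ge_zero)+
    then have "pmean p t (a + b) (c + d) = l" unfolding l_def pmean_def by auto
    then show ?thesis using kl by (simp add: k_def l_def)
  next
    case 2
    then have "(1 - t) * b powr p + t * d powr p = 0" using kp by simp
    then have "(1 - t) * b powr p = 0" "t * d powr p = 0"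
      using p by (smt (verit) mult_nonneg_nonneg powr_ge_zero)+
    then have "pmean p t (a + b) (c + d) = k" unfolding k_def pmean_def by auto
    then show ?thesis using kl by (simp add: k_def l_def)
  next
    case 3
    define s where "s = l / (k + l)"
    have s: "0 \<le> s" "s \<le> 1" and s1: "1 - s = k / (k + l)" using 3 by (auto simp: s_def field_simps)
    have *: "(x + y) powr p \<le> (k + l) powr p * ((1 - s) * (x powr p / k powr p) + s * (y powr p / l powr p))"
      if "0 \<le> x" "0 \<le> y" for x y :: real
    proof -
      have "(1 - s) * (x / k) + s * (y / l) = (x + y) / (k + l)"
        using 3 unfolding s1 by (simp add: s_def add_divide_distrib)
      then have "((x + y) / (k + l)) powr p \<le> (1 - s) * (x / k) powr p + s * (y / l) powr p"
        using abs_powr_convex[OF p(1) s, of "x / k" "y / l"] that 3 by simp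
      then show ?thesis using 3 that by (simp add: powr_divide field_simps)
    qed
    have "pmean p t (a + b) (c + d) powr p = (1 - t) * (a + b) powr p + t * (c + d) powr p"
      using p by (simp add: pmean_powr)
    also have "\<dots> \<le> (1 - t) * ((k + l) powr p * ((1 - s) * (a powr p / k powr p) + s * (b powr p / l powr p)))
        + t * ((k + l) powr p * ((1 - s) * (c powr p / k powr p) + s * (d powr p / l powr p)))"
      using p nn by (intro add_mono mult_left_mono *) auto
    also have "\<dots> = (k + l) powr p * ((1 - s) * (((1 - t) * a powr p + t * c powr p) / k powr p)
        + s * (((1 - t) * b powr p + t * d powr p) / l powr p))"
      by (simp add: algebra_simps add_divide_distrib diff_divide_distrib)
    also have "\<dots> = (k + l) powr p" using 3 by (simp add: kp[symmetric])
    finally have le: "pmean p t (a + b) (c + d) powr p \<le> (k + l) powr p" .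
    have "0 \<le> k + l" "0 < p" using kl p by auto
    from this le have "pmean p t (a + b) (c + d) \<le> k + l" by (rule powr_le_cancel)
    then show ?thesis by (simp add: k_def l_def)
  qed
qed

text \<open>
  The reverse triangle inequality for the weighted \<open>\<ell>\<^sup>p\<close> norm. Integrated against the kernel, it is the hidden
  convexity of the energy.
\<close>

lemma pmean_diff:
  assumes p: "1 \<le> p" "0 \<le> t" "t \<le> 1" and nn: "0 \<le> a" "0 \<le> b" "0 \<le> c" "0 \<le> d"
  shows "\<bar>pmean p t a c - pmean p t b d\<bar> powr p \<le> (1 - t) * \<bar>a - b\<bar> powr p + t * \<bar>c - d\<bar> powr p"
proof -
  have *: "pmean p t a c - pmean p t b d \<le> pmean p t \<bar>a - b\<bar> \<bar>c - d\<bar>"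
    if "0 \<le> a" "0 \<le> b" "0 \<le> c" "0 \<le> d" for a b c d
  proof -
    have "pmean p t a c \<le> pmean p t (b + \<bar>a - b\<bar>) (d + \<bar>c - d\<bar>)" using p that by (intro pmean_mono) auto
    also have "\<dots> \<le> pmean p t b d + pmean p t \<bar>a - b\<bar> \<bar>c - d\<bar>" using p that by (intro pmean_triangle) auto
    finally show ?thesis by simp
  qed
  have "\<bar>pmean p t a c - pmean p t b d\<bar> \<le> pmean p t \<bar>a - b\<bar> \<bar>c - d\<bar>"
    using *[of a b c d] *[of b a d c] nn by (simp add: abs_minus_commute abs_le_iff)
  then have "\<bar>pmean p t a c - pmean p t b d\<bar> powr p \<le> pmean p t \<bar>a - b\<bar> \<bar>c - d\<bar> powr p"
    using p by (intro powr_mono2) auto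
  then show ?thesis using p by (simp add: pmean_powr)
qed

lemma pmean_difference_quotient_ge:
  assumes "1 \<le> p" "0 < t" "t \<le> 1" "0 \<le> a" "0 \<le> c"
  shows "c - a \<le> (pmean p t a c - a) / t"
proof -
  have "t * (c - a) \<le> pmean p t a c - a" using pmean_ge[of p t a c] assms by (simp add: algebra_simps)
  then show ?thesis using assms by (simp add: field_simps)
qed

lemma pmean_difference_quotient_tendsto:
  assumes p: "1 \<le> p" and "0 < a" "0 \<le> c"
  shows "((\<lambda>t. (pmean p t a c - a) / t) \<longlongrightarrow> (c powr p - a powr p) / (p * a powr (p - 1))) (at_right 0)"
proof -
  have a0: "(a powr p) powr (1 / p) = a" using assms by (simp add: powr_powr)
  have "((\<lambda>t. pmean p t a c) has_real_derivative
      (1 / p) * (a powr p) powr (1 / p - 1) * (c powr p - a powr p)) (at 0)"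
    unfolding pmean_def using assms
    by (auto intro!: derivative_eq_intros simp: algebra_simps)
  also have "(1 / p) * (a powr p) powr (1 / p - 1) * (c powr p - a powr p) = (c powr p - a powr p) / (p * a powr (p - 1))"
  proof -
    have "(a powr p) powr (1 / p - 1) = a powr (1 - p)" using p by (simp add: powr_powr right_diff_distrib)
    also have "\<dots> = 1 / a powr (p - 1)" using powr_minus_divide[of a "p - 1"] by simp
    finally show ?thesis using p by simp
  qed
  finally have "((\<lambda>t. (pmean p t a c - pmean p 0 a c) / (t - 0)) \<longlongrightarrow> (c powr p - a powr p) / (p * a powr (p - 1))) (at 0)"
    by (simp only: has_field_derivative_iff)
  then show ?thesis using a0 by (auto simp: pmean_def filterlim_at_split)
qed

text \<open>A substitute for Hoelder's inequality on sets of finite measure.\<close>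

lemma abs_le_eps_powr:
  fixes x p \<epsilon> :: real
  assumes "1 \<le> p" "0 < \<epsilon>"
  shows "\<bar>x\<bar> \<le> \<epsilon> + \<epsilon> powr (1 - p) * \<bar>x\<bar> powr p"
proof (cases "\<bar>x\<bar> \<le> \<epsilon>")
  case True
  then show ?thesis by (simp add: add_increasing2)
next
  case False
  then have x: "\<epsilon> < \<bar>x\<bar>" by simp
  have "\<bar>x\<bar> = \<bar>x\<bar> powr (1 - p) * \<bar>x\<bar> powr p" using x assms by (simp flip: powr_add)
  also have "\<dots> \<le> \<epsilon> powr (1 - p) * \<bar>x\<bar> powr p"
    using x assms by (intro mult_right_mono powr_mono2') auto
  finally show ?thesis using assms by simp
qed

lemma abs_powr_mult_le:
  fixes a b p :: real
  assumes "1 \<le> p"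
  shows "\<bar>\<bar>a\<bar> powr (p - 2) * a * b\<bar> \<le> \<bar>a\<bar> powr p + \<bar>b\<bar> powr p"
proof -
  have *: "z * z powr (p - 1) = z powr p" if "0 \<le> z" for z :: real
    using that assms by (simp add: powr_mult_base)
  have e: "\<bar>\<bar>a\<bar> powr (p - 2) * a * b\<bar> = \<bar>a\<bar> powr (p - 1) * \<bar>b\<bar>"
    by (cases "a = 0") (auto simp: abs_mult powr_mult_base mult.commute)
  show ?thesis
  proof (cases "\<bar>b\<bar> \<le> \<bar>a\<bar>")
    case True
    then have "\<bar>a\<bar> powr (p - 1) * \<bar>b\<bar> \<le> \<bar>a\<bar> powr p" using *[of "\<bar>a\<bar>"] by (metis abs_ge_zero mult.commute mult_left_mono powr_ge_zero)
    then show ?thesis unfolding e by (simp add: add_increasing2)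
  next
    case False
    then have "\<bar>a\<bar> powr (p - 1) \<le> \<bar>b\<bar> powr (p - 1)" using assms by (intro powr_mono2) auto
    then have "\<bar>a\<bar> powr (p - 1) * \<bar>b\<bar> \<le> \<bar>b\<bar> powr p" using *[of "\<bar>b\<bar>"] by (metis abs_ge_zero mult.commute mult_left_mono)
    then show ?thesis unfolding e by (simp add: add_increasing)
  qed
qed

section \<open>The nonlocal energy\<close>

lemma AE_pair_fst:
  assumes "sigma_finite_measure M" "AE x in N. P x"
  shows "AE z in N \<Otimes>\<^sub>M M. P (fst z)"
proof -
  interpret sigma_finite_measure M by fact
  obtain A where A: "{x \<in> space N. \<not> P x} \<subseteq> A" "A \<in> sets N" "emeasure N A = 0"
    using assms(2) by (auto elim: AE_E)
  have "A \<times> space M \<in> null_sets (N \<Otimes>\<^sub>M M)"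
    using A by (auto simp: null_sets_def emeasure_pair_measure_Times)
  then show ?thesis
    by (rule AE_I') (use A in \<open>auto simp: space_pair_measure\<close>)
qed

lemma AE_pair_snd:
  assumes "sigma_finite_measure M" "sigma_finite_measure N" "AE x in M. P x"
  shows "AE z in N \<Otimes>\<^sub>M M. P (snd z)"
proof -
  interpret sigma_finite_measure M by fact
  obtain A where A: "{x \<in> space M. \<not> P x} \<subseteq> A" "A \<in> sets M" "emeasure M A = 0"
    using assms(3) by (auto elim: AE_E)
  have "space N \<times> A \<in> null_sets (N \<Otimes>\<^sub>M M)"
    using A by (auto simp: null_sets_def emeasure_pair_measure_Times)
  then show ?thesis
    by (rule AE_I') (use A in \<open>auto simp: space_pair_measure\<close>)
qed

text \<open>
  The assumption \<open>killing\<close> says that every point of \<open>\<Omega>\<close> interacts with the complement of \<open>\<Omega>\<close> at a rate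
  bounded below. It replaces Poincare and Sobolev inequalities throughout.
\<close>

locale nonlocal_form = sigma_finite_measure m for m :: "'a measure" +
  fixes K :: "'a \<times> 'a \<Rightarrow> real" and \<Omega> :: "'a set" and p c0 :: real
  assumes space_m [simp]: "space m = UNIV"
    and p_ge_2: "2 \<le> p"
    and Omega_sets [measurable]: "\<Omega> \<in> sets m"
    and Omega_finite: "emeasure m \<Omega> < \<infinity>"
    and K_measurable [measurable]: "K \<in> borel_measurable (m \<Otimes>\<^sub>M m)"
    and K_nonneg: "0 \<le> K z"
    and K_pos: "x \<noteq> y \<Longrightarrow> 0 < K (x, y)"
    and c0_pos: "0 < c0"
    and killing: "x \<in> \<Omega> \<Longrightarrow> ennreal c0 \<le> (\<integral>\<^sup>+ y. ennreal (K (x, y)) * indicator (- \<Omega>) y \<partial>m)"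
begin

lemma p_pos: "0 < p" and p_ge_1: "1 \<le> p" and p_gt_1: "1 < p"
  using p_ge_2 by auto

text \<open>The integrand of the Gagliardo seminorm, as a function on pairs of points.\<close>

definition gag :: "('a \<Rightarrow> real) \<Rightarrow> 'a \<times> 'a \<Rightarrow> real" where
  "gag u z = \<bar>u (fst z) - u (snd z)\<bar> powr p * K z"

definition W :: "('a \<Rightarrow> real) set" where
  "W = {u \<in> borel_measurable m. (\<forall>x. x \<notin> \<Omega> \<longrightarrow> u x = 0) \<and> integrable (m \<Otimes>\<^sub>M m) (gag u)}"

definition E :: "('a \<Rightarrow> real) \<Rightarrow> real" where
  "E u = integral\<^sup>L (m \<Otimes>\<^sub>M m) (gag u)"

lemma gag_measurable [measurable]:
  assumes [measurable]: "u \<in> borel_measurable m"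
  shows "gag u \<in> borel_measurable (m \<Otimes>\<^sub>M m)"
  unfolding gag_def by measurable

lemma gag_nonneg: "0 \<le> gag u z"
  by (simp add: gag_def K_nonneg)

lemma W_measurable: "u \<in> W \<Longrightarrow> u \<in> borel_measurable m"
  and W_zero: "u \<in> W \<Longrightarrow> x \<notin> \<Omega> \<Longrightarrow> u x = 0"
  and W_integrable_gag: "u \<in> W \<Longrightarrow> integrable (m \<Otimes>\<^sub>M m) (gag u)"
  by (auto simp: W_def)

lemma E_nonneg: "0 \<le> E u"
  by (simp add: E_def gag_nonneg)

text \<open>Every closure property of the energy space is a pointwise inequality between increments.\<close>

lemma W_dominated:
  assumes v: "v \<in> borel_measurable m" "\<And>x. x \<notin> \<Omega> \<Longrightarrow> v x = 0" and u: "u1 \<in> W" "u2 \<in> W"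
    and le: "\<And>x y. \<bar>v x - v y\<bar> powr p \<le> C1 * \<bar>u1 x - u1 y\<bar> powr p + C2 * \<bar>u2 x - u2 y\<bar> powr p"
  shows "v \<in> W" "E v \<le> C1 * E u1 + C2 * E u2"
proof -
  have *: "gag v z \<le> C1 * gag u1 z + C2 * gag u2 z" for z
  proof -
    have "\<bar>v (fst z) - v (snd z)\<bar> powr p * K z \<le>
      (C1 * \<bar>u1 (fst z) - u1 (snd z)\<bar> powr p + C2 * \<bar>u2 (fst z) - u2 (snd z)\<bar> powr p) * K z"
      by (intro mult_right_mono le K_nonneg)
    then show ?thesis by (simp add: gag_def algebra_simps)
  qed
  have i: "integrable (m \<Otimes>\<^sub>M m) (\<lambda>z. C1 * gag u1 z + C2 * gag u2 z)"
    using u[THEN W_integrable_gag] by auto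
  have iv: "integrable (m \<Otimes>\<^sub>M m) (gag v)"
  proof (rule Bochner_Integration.integrable_bound[OF i])
    show "AE z in m \<Otimes>\<^sub>M m. norm (gag v z) \<le> norm (C1 * gag u1 z + C2 * gag u2 z)"
      using order_trans[OF * abs_ge_self] by (intro AE_I2) (simp add: abs_of_nonneg[OF gag_nonneg])
  qed (use v in auto)
  with v show "v \<in> W" by (simp add: W_def)
  have "E v \<le> (\<integral>z. C1 * gag u1 z + C2 * gag u2 z \<partial>(m \<Otimes>\<^sub>M m))"
    unfolding E_def by (intro integral_mono iv i *)
  also have "\<dots> = C1 * E u1 + C2 * E u2"
    using u[THEN W_integrable_gag] by (simp add: E_def)
  finally show "E v \<le> C1 * E u1 + C2 * E u2" .
qed

lemma W_dominated1:
  assumes v: "v \<in> borel_measurable m" "\<And>x. x \<notin> \<Omega> \<Longrightarrow> v x = 0" and u: "u \<in> W"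
    and le: "\<And>x y. \<bar>v x - v y\<bar> \<le> \<bar>u x - u y\<bar>"
  shows "v \<in> W" "E v \<le> E u"
proof -
  have "\<bar>v x - v y\<bar> powr p \<le> 1 * \<bar>u x - u y\<bar> powr p + 0 * \<bar>u x - u y\<bar> powr p" for x y
    using le p_pos by (auto intro!: powr_mono2)
  from W_dominated[OF v u u this] show "v \<in> W" "E v \<le> E u" by auto
qed

lemma gag_scale: "gag (\<lambda>x. c * u x) z = \<bar>c\<bar> powr p * gag u z"
  by (simp add: gag_def abs_mult powr_mult flip: right_diff_distrib)

lemma W_scale: "u \<in> W \<Longrightarrow> (\<lambda>x. c * u x) \<in> W"
  and E_scale: "E (\<lambda>x. c * u x) = \<bar>c\<bar> powr p * E u"
  by (auto simp: W_def E_def gag_scale[abs_def])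

lemma W_minus: "u \<in> W \<Longrightarrow> (\<lambda>x. - u x) \<in> W" and E_minus: "E (\<lambda>x. - u x) = E u"
  using W_scale[of u "-1"] E_scale[of "-1" u] by auto

lemma
  assumes u: "u \<in> W" "v \<in> W"
  shows W_add: "(\<lambda>x. u x + v x) \<in> W"
    and E_add_le: "E (\<lambda>x. u x + v x) \<le> 2 powr p * (E u + E v)"
proof -
  have "\<bar>(u x + v x) - (u y + v y)\<bar> powr p \<le> 2 powr p * \<bar>u x - u y\<bar> powr p + 2 powr p * \<bar>v x - v y\<bar> powr p" for x y
    using abs_powr_sum_le[OF p_ge_1, of "u x - u y" "v x - v y"] by (simp add: algebra_simps)
  note * = W_dominated[OF _ _ u this]
  show "(\<lambda>x. u x + v x) \<in> W" "E (\<lambda>x. u x + v x) \<le> 2 powr p * (E u + E v)"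
    using u[THEN W_measurable] u[THEN W_zero] by (auto intro!: * simp: distrib_left)
qed

lemma W_diff: "u \<in> W \<Longrightarrow> v \<in> W \<Longrightarrow> (\<lambda>x. u x - v x) \<in> W"
  using W_add[OF _ W_minus] by simp

lemma W_lincomb: "u \<in> W \<Longrightarrow> v \<in> W \<Longrightarrow> (\<lambda>x. a * u x + b * v x) \<in> W"
  by (intro W_add W_scale)

lemma W_zero_fun: "(\<lambda>x. 0) \<in> W" and E_zero: "E (\<lambda>x. 0) = 0"
  by (auto simp: W_def E_def gag_def[abs_def])

lemma W_min_const:
  assumes "u \<in> W" "0 \<le> k"
  shows "(\<lambda>x. min (u x) k) \<in> W"
  using assms W_measurable[OF assms(1)] W_zero[OF assms(1)]
  by (intro W_dominated1[OF _ _ assms(1)]) auto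

lemma W_abs:
  assumes "u \<in> W"
  shows "(\<lambda>x. \<bar>u x\<bar>) \<in> W" "E (\<lambda>x. \<bar>u x\<bar>) \<le> E u"
  using W_measurable[OF assms(1)] W_zero[OF assms(1)]
  by (auto intro!: W_dominated1[OF _ _ assms(1)])

lemma clarkson_E:
  assumes u: "u \<in> W" "v \<in> W"
  shows "E (\<lambda>x. (u x + v x) / 2) + E (\<lambda>x. (u x - v x) / 2) \<le> (E u + E v) / 2"
proof -
  let ?a = "\<lambda>x. (u x + v x) / 2" and ?b = "\<lambda>x. (u x - v x) / 2"
  have W: "?a \<in> W" "?b \<in> W"
    using W_scale[OF W_add[OF u], of "1/2"] W_scale[OF W_diff[OF u], of "1/2"] by auto
  have *: "gag ?a z + gag ?b z \<le> (gag u z + gag v z) / 2" for z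
  proof -
    have e: "(x + y) / 2 - (x' + y') / 2 = ((x - x') + (y - y')) / 2"
      "(x - y) / 2 - (x' - y') / 2 = ((x - x') - (y - y')) / 2" for x y x' y' :: real
      by (auto simp: field_simps)
    show ?thesis
      using mult_right_mono[OF clarkson_scalar[OF p_ge_2, of "u (fst z) - u (snd z)" "v (fst z) - v (snd z)"] K_nonneg[of z]]
      unfolding gag_def e by (simp add: algebra_simps)
  qed
  note i = W[THEN W_integrable_gag] u[THEN W_integrable_gag]
  have "E ?a + E ?b = (\<integral>z. gag ?a z + gag ?b z \<partial>(m \<Otimes>\<^sub>M m))" using i by (simp add: E_def)
  also have "\<dots> \<le> (\<integral>z. (gag u z + gag v z) / 2 \<partial>(m \<Otimes>\<^sub>M m))"
    using i by (intro integral_mono *) auto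
  also have "\<dots> = (E u + E v) / 2" using i by (simp add: E_def)
  finally show ?thesis .
qed

text \<open>
  Only the interactions between \<open>\<Omega>\<close> and its complement are kept, and the variable outside \<open>\<Omega>\<close> is integrated
  out.
\<close>

lemma killing_bound:
  assumes G: "integrable (m \<Otimes>\<^sub>M m) G" "\<And>z. 0 \<le> G z"
    and g [measurable]: "g \<in> borel_measurable m" and g0: "\<And>x. 0 \<le> g x" "\<And>x. x \<notin> \<Omega> \<Longrightarrow> g x = 0"
    and le: "\<And>x y. x \<in> \<Omega> \<Longrightarrow> y \<notin> \<Omega> \<Longrightarrow> g x * K (x, y) \<le> G (x, y)"
  shows "integrable m g" "c0 * (\<integral>x. g x \<partial>m) \<le> (\<integral>z. G z \<partial>(m \<Otimes>\<^sub>M m))"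
proof -
  have [measurable]: "G \<in> borel_measurable (m \<Otimes>\<^sub>M m)" using G by auto
  have "ennreal c0 * (\<integral>\<^sup>+ x. ennreal (g x) \<partial>m) = (\<integral>\<^sup>+ x. ennreal (g x) * ennreal c0 \<partial>m)"
    by (simp add: nn_integral_cmult mult.commute)
  also have "\<dots> \<le> (\<integral>\<^sup>+ x. ennreal (g x) * (\<integral>\<^sup>+ y. ennreal (K (x, y)) * indicator (- \<Omega>) y \<partial>m) \<partial>m)"
  proof (intro nn_integral_mono)
    fix x show "ennreal (g x) * ennreal c0 \<le> ennreal (g x) * (\<integral>\<^sup>+ y. ennreal (K (x, y)) * indicator (- \<Omega>) y \<partial>m)"
      using killing[of x] g0(2)[of x] by (cases "x \<in> \<Omega>") (auto intro!: mult_left_mono)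
  qed
  also have "\<dots> = (\<integral>\<^sup>+ x. (\<integral>\<^sup>+ y. ennreal (g x) * (ennreal (K (x, y)) * indicator (- \<Omega>) y) \<partial>m) \<partial>m)"
    by (intro nn_integral_cong nn_integral_cmult[symmetric]) measurable
  also have "\<dots> \<le> (\<integral>\<^sup>+ x. (\<integral>\<^sup>+ y. ennreal (G (x, y)) \<partial>m) \<partial>m)"
  proof (intro nn_integral_mono)
    fix x y
    show "ennreal (g x) * (ennreal (K (x, y)) * indicator (- \<Omega>) y) \<le> ennreal (G (x, y))"
      using le[of x y] g0(2)[of x] g0(1)[of x] K_nonneg[of "(x, y)"]
      by (cases "x \<in> \<Omega>"; cases "y \<in> \<Omega>") (auto simp: ennreal_mult[symmetric] intro!: ennreal_leI)
  qed
  also have "\<dots> = (\<integral>\<^sup>+ z. ennreal (G z) \<partial>(m \<Otimes>\<^sub>M m))"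
    by (rule nn_integral_fst) measurable
  also have "\<dots> = ennreal (\<integral>z. G z \<partial>(m \<Otimes>\<^sub>M m))"
    using G by (intro nn_integral_eq_integral) auto
  finally have *: "ennreal c0 * (\<integral>\<^sup>+ x. ennreal (g x) \<partial>m) \<le> ennreal (\<integral>z. G z \<partial>(m \<Otimes>\<^sub>M m))" .
  have "(\<integral>\<^sup>+ x. ennreal (g x) \<partial>m) \<noteq> \<infinity>"
  proof
    assume "(\<integral>\<^sup>+ x. ennreal (g x) \<partial>m) = \<infinity>"
    with * c0_pos show False by (simp add: ennreal_mult_top top_unique)
  qed
  then show ig: "integrable m g"
    using g0 by (intro integrableI_nonneg) (auto simp: less_top)
  then have "ennreal c0 * ennreal (\<integral>x. g x \<partial>m) \<le> ennreal (\<integral>z. G z \<partial>(m \<Otimes>\<^sub>M m))"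
    using * g0 by (simp add: nn_integral_eq_integral)
  then have "ennreal (c0 * (\<integral>x. g x \<partial>m)) \<le> ennreal (\<integral>z. G z \<partial>(m \<Otimes>\<^sub>M m))"
    using c0_pos g0 by (simp add: ennreal_mult)
  then show "c0 * (\<integral>x. g x \<partial>m) \<le> (\<integral>z. G z \<partial>(m \<Otimes>\<^sub>M m))"
    using G by (subst (asm) ennreal_le_iff) auto
qed

lemma
  assumes u: "u \<in> W"
  shows W_integrable_powr: "integrable m (\<lambda>x. \<bar>u x\<bar> powr p)"
    and poincare: "c0 * (\<integral>x. \<bar>u x\<bar> powr p \<partial>m) \<le> E u"
proof -
  have [measurable]: "u \<in> borel_measurable m" by (rule W_measurable[OF u])
  note * = killing_bound[OF W_integrable_gag[OF u] gag_nonneg, of "\<lambda>x. \<bar>u x\<bar> powr p"]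
  show "integrable m (\<lambda>x. \<bar>u x\<bar> powr p)" "c0 * (\<integral>x. \<bar>u x\<bar> powr p \<partial>m) \<le> E u"
    unfolding E_def by (auto intro!: * simp: gag_def W_zero[OF u])
qed

text \<open>
  Truncation at height \<open>k\<close> lowers the interaction of \<open>x\<close> in \<open>\<Omega>\<close> with the zero values outside from
  \<open>u x powr p\<close> to \<open>k powr p\<close>, and raises no other interaction.
\<close>

lemma
  assumes u: "u \<in> W" and k: "0 < k"
  shows W_integrable_excess: "integrable m (\<lambda>x. max 0 (u x - k))"
    and E_truncation: "c0 * k powr (p - 1) * (\<integral>x. max 0 (u x - k) \<partial>m) \<le> E u - E (\<lambda>x. min (u x) k)"
proof -
  let ?v = "\<lambda>x. min (u x) k"
  have v: "?v \<in> W" using u k by (intro W_min_const) auto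
  have [measurable]: "u \<in> borel_measurable m" by (rule W_measurable[OF u])
  note i = W_integrable_gag[OF u] W_integrable_gag[OF v]
  have nn: "gag ?v z \<le> gag u z" for z
    unfolding gag_def using p_pos by (intro mult_right_mono K_nonneg powr_mono2) auto
  have le: "k powr (p - 1) * max 0 (u x - k) * K (x, y) \<le> gag u (x, y) - gag ?v (x, y)"
    if "x \<in> \<Omega>" "y \<notin> \<Omega>" for x y
  proof -
    have uy: "u y = 0" using that W_zero[OF u] by simp
    have "k powr (p - 1) * max 0 (u x - k) \<le> \<bar>u x\<bar> powr p - \<bar>min (u x) k\<bar> powr p"
    proof (cases "u x \<le> k")
      case False
      have *: "z * z powr (p - 1) = z powr p" if "0 \<le> z" for z :: real
        using that p_pos by (simp add: powr_mult_base)
      have "k powr (p - 1) \<le> u x powr (p - 1)" using False k p_ge_1 by (intro powr_mono2) auto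
      then have "u x * k powr (p - 1) \<le> u x * u x powr (p - 1)" using False k by (intro mult_left_mono) auto
      then show ?thesis using False k *[of k] *[of "u x"] by (simp add: algebra_simps max_def)
    qed simp
    then have "k powr (p - 1) * max 0 (u x - k) * K (x, y) \<le> (\<bar>u x\<bar> powr p - \<bar>min (u x) k\<bar> powr p) * K (x, y)"
      by (intro mult_right_mono K_nonneg)
    then show ?thesis using uy k by (simp add: gag_def algebra_simps)
  qed
  have zero: "max 0 (u x - k) = 0" if "x \<notin> \<Omega>" for x using W_zero[OF u that] k by simp
  note * = killing_bound[of "\<lambda>z. gag u z - gag ?v z" "\<lambda>x. k powr (p - 1) * max 0 (u x - k)"]
  have "integrable m (\<lambda>x. k powr (p - 1) * max 0 (u x - k))"
    using nn i le zero by (intro *) auto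
  then show "integrable m (\<lambda>x. max 0 (u x - k))" using k by simp
  have "c0 * (\<integral>x. k powr (p - 1) * max 0 (u x - k) \<partial>m) \<le> (\<integral>z. gag u z - gag ?v z \<partial>(m \<Otimes>\<^sub>M m))"
    using nn i le zero by (intro *) auto
  then show "c0 * k powr (p - 1) * (\<integral>x. max 0 (u x - k) \<partial>m) \<le> E u - E ?v"
    using i by (simp add: E_def mult.assoc)
qed

lemma integrable_dominated_on_Omega:
  fixes g G :: "'a \<Rightarrow> real"
  assumes g: "g \<in> borel_measurable m" "\<And>x. x \<notin> \<Omega> \<Longrightarrow> g x = 0" and le: "\<And>x. x \<in> \<Omega> \<Longrightarrow> \<bar>g x\<bar> \<le> C + G x" and G: "integrable m G" "\<And>x. 0 \<le> G x"
  shows "integrable m g"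
proof (rule Bochner_Integration.integrable_bound[where f="\<lambda>x. \<bar>C\<bar> * indicator \<Omega> x + G x"])
  show "integrable m (\<lambda>x. \<bar>C\<bar> * indicator \<Omega> x + G x)" using Omega_finite G by auto
  show "AE x in m. norm (g x) \<le> norm (\<bar>C\<bar> * indicator \<Omega> x + G x)"
  proof (rule AE_I2)
    fix x show "norm (g x) \<le> norm (\<bar>C\<bar> * indicator \<Omega> x + G x)"
      using le[of x] g(2)[of x] G(2)[of x] by (cases "x \<in> \<Omega>") auto
  qed
qed (use g in auto)

lemma integrable_bounded_on_Omega:
  fixes g :: "'a \<Rightarrow> real"
  assumes g: "g \<in> borel_measurable m" "\<And>x. x \<notin> \<Omega> \<Longrightarrow> g x = 0" and le: "\<And>x. x \<in> \<Omega> \<Longrightarrow> \<bar>g x\<bar> \<le> (C::real)"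
  shows "integrable m g"
  by (rule integrable_dominated_on_Omega[OF g, where C=C and G="\<lambda>x. 0"]) (use le in auto)

lemma W_integrable:
  assumes u: "u \<in> W"
  shows "integrable m u"
proof (rule integrable_dominated_on_Omega[where C=1 and G="\<lambda>x. \<bar>u x\<bar> powr p"])
  show "\<bar>u x\<bar> \<le> 1 + \<bar>u x\<bar> powr p" for x
    using abs_le_eps_powr[OF p_ge_1, of 1 "u x"] by simp
qed (use W_integrable_powr[OF u] W_measurable[OF u] W_zero[OF u] in auto)

text \<open>
  The free parameter \<open>\<epsilon>\<close> makes the bound useful in both directions: a large \<open>\<epsilon>\<close> absorbs linear terms into the
  energy, a small one shows that functions of small energy are small in \<open>L\<^sup>1\<close>.
\<close>

lemma L1_le_E:
  assumes u: "u \<in> W" and e: "0 < \<epsilon>"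
  shows "(\<integral>x. \<bar>u x\<bar> \<partial>m) \<le> \<epsilon> * measure m \<Omega> + \<epsilon> powr (1 - p) / c0 * E u"
proof -
  have fin: "integrable m (\<lambda>x. \<epsilon> * indicator \<Omega> x)" using Omega_finite by auto
  have "(\<integral>x. \<bar>u x\<bar> \<partial>m) \<le> (\<integral>x. \<epsilon> * indicator \<Omega> x + \<epsilon> powr (1 - p) * \<bar>u x\<bar> powr p \<partial>m)"
  proof (intro integral_mono)
    fix x show "\<bar>u x\<bar> \<le> \<epsilon> * indicator \<Omega> x + \<epsilon> powr (1 - p) * \<bar>u x\<bar> powr p"
      using abs_le_eps_powr[OF p_ge_1 e, of "u x"] W_zero[OF u, of x] by (cases "x \<in> \<Omega>") auto
  qed (use fin W_integrable[OF u] W_integrable_powr[OF u] in auto)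
  also have "\<dots> = \<epsilon> * measure m \<Omega> + \<epsilon> powr (1 - p) * (\<integral>x. \<bar>u x\<bar> powr p \<partial>m)"
    using fin W_integrable_powr[OF u] Omega_finite by (subst Bochner_Integration.integral_add) auto
  also have "(\<integral>x. \<bar>u x\<bar> powr p \<partial>m) \<le> E u / c0"
    using poincare[OF u] c0_pos by (simp add: field_simps)
  finally show ?thesis using e by (simp add: mult_left_mono)
qed

lemma E_eq_0_AE:
  assumes u: "u \<in> W" and "E u \<le> 0"
  shows "AE x in m. u x = 0"
proof -
  have "c0 * (\<integral>x. \<bar>u x\<bar> powr p \<partial>m) \<le> 0" using poincare[OF u] assms(2) by (rule order_trans)
  then have "(\<integral>x. \<bar>u x\<bar> powr p \<partial>m) \<le> 0" using c0_pos by (simp add: mult_le_0_iff)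
  moreover have "0 \<le> (\<integral>x. \<bar>u x\<bar> powr p \<partial>m)" by (rule integral_nonneg_AE) simp
  ultimately have "(\<integral>x. \<bar>u x\<bar> powr p \<partial>m) = 0" by (rule antisym)
  then have "AE x in m. \<bar>u x\<bar> powr p = 0"
    using W_integrable_powr[OF u] by (subst (asm) integral_nonneg_eq_0_iff_AE) auto
  then show ?thesis by simp
qed

lemma W_fatou:
  assumes u: "\<And>n. u n \<in> W" and v [measurable]: "v \<in> borel_measurable m" and v0: "\<And>x. x \<notin> \<Omega> \<Longrightarrow> v x = 0"
    and ae: "AE x in m. (\<lambda>n. u n x) \<longlonglongrightarrow> v x"
    and C: "\<And>n. E (u n) \<le> C n" "C \<longlonglongrightarrow> l"
  shows "v \<in> W" "E v \<le> l"
proof -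
  have [measurable]: "u n \<in> borel_measurable m" for n by (rule W_measurable[OF u])
  have sf: "sigma_finite_measure m" ..
  have ae2: "AE z in m \<Otimes>\<^sub>M m. (\<lambda>n. gag (u n) z) \<longlonglongrightarrow> gag v z"
    using AE_pair_fst[OF sf ae] AE_pair_snd[OF sf sf ae]
  proof eventually_elim
    case (elim z)
    have "((\<lambda>n. \<bar>u n (fst z) - u n (snd z)\<bar> powr p) \<longlonglongrightarrow> \<bar>v (fst z) - v (snd z)\<bar> powr p)"
      using elim p_pos by (intro tendsto_powr2 tendsto_rabs tendsto_diff) auto
    then show ?case unfolding gag_def by (intro tendsto_mult) auto
  qed
  have l0: "0 \<le> l" using C E_nonneg by (intro LIMSEQ_le_const[OF C(2)]) (metis order_trans)
  have "(\<integral>\<^sup>+ z. ennreal (gag v z) \<partial>(m \<Otimes>\<^sub>M m)) \<le> (\<integral>\<^sup>+ z. liminf (\<lambda>n. ennreal (gag (u n) z)) \<partial>(m \<Otimes>\<^sub>M m))"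
  proof (rule nn_integral_mono_AE)
    show "AE z in m \<Otimes>\<^sub>M m. ennreal (gag v z) \<le> liminf (\<lambda>n. ennreal (gag (u n) z))"
      using ae2
    proof eventually_elim
      case (elim z)
      then have "liminf (\<lambda>n. ennreal (gag (u n) z)) = ennreal (gag v z)"
        by (intro lim_imp_Liminf tendsto_ennrealI) auto
      then show ?case by simp
    qed
  qed
  also have "\<dots> \<le> liminf (\<lambda>n. (\<integral>\<^sup>+ z. ennreal (gag (u n) z) \<partial>(m \<Otimes>\<^sub>M m)))"
    by (rule nn_integral_liminf) measurable
  also have "\<dots> = liminf (\<lambda>n. ennreal (E (u n)))"
    unfolding E_def using u by (subst nn_integral_eq_integral) (auto simp: gag_nonneg W_integrable_gag)
  also have "\<dots> \<le> liminf (\<lambda>n. ennreal (C n))"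
    using C by (intro Liminf_mono always_eventually allI ennreal_leI) auto
  also have "\<dots> = ennreal l" using C by (intro lim_imp_Liminf tendsto_ennrealI) auto
  finally have *: "(\<integral>\<^sup>+ z. ennreal (gag v z) \<partial>(m \<Otimes>\<^sub>M m)) \<le> ennreal l" .
  then have i: "integrable (m \<Otimes>\<^sub>M m) (gag v)"
    by (intro integrableI_nonneg) (auto simp: gag_nonneg intro: le_less_trans)
  then show "v \<in> W" using v v0 by (simp add: W_def)
  from * have "ennreal (E v) \<le> ennreal l"
    unfolding E_def using i by (subst (asm) nn_integral_eq_integral) (auto simp: gag_nonneg)
  then show "E v \<le> l" using l0 by simp
qed

end

section \<open>Minimisers for a bounded right-hand side\<close>

locale compact_nonlocal_form = nonlocal_form +
  assumes rellich: "(\<And>n. u n \<in> W) \<Longrightarrow> (\<And>n. E (u n) \<le> C) \<Longrightarrow>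
    \<exists>r v. strict_mono (r :: nat \<Rightarrow> nat) \<and> integrable m v \<and> (\<forall>x. x \<notin> \<Omega> \<longrightarrow> v x = 0) \<and>
      (AE x in m. (\<lambda>n. u (r n) x) \<longlonglongrightarrow> v x) \<and> (\<lambda>n. \<integral>x. \<bar>u (r n) x - v x\<bar> \<partial>m) \<longlonglongrightarrow> 0"

context compact_nonlocal_form
begin

lemma rellich_subsequence:
  assumes "\<And>n. u n \<in> W" "\<And>n. E (u n) \<le> C"
  obtains r :: "nat \<Rightarrow> nat" and v where "strict_mono r" "integrable m v" "\<And>x. x \<notin> \<Omega> \<Longrightarrow> v x = 0"
    "AE x in m. (\<lambda>n. u (r n) x) \<longlonglongrightarrow> v x" "(\<lambda>n. \<integral>x. \<bar>u (r n) x - v x\<bar> \<partial>m) \<longlonglongrightarrow> 0"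
proof -
  obtain r :: "nat \<Rightarrow> nat" and v where *: "strict_mono r \<and> integrable m v \<and> (\<forall>x. x \<notin> \<Omega> \<longrightarrow> v x = 0) \<and>
      (AE x in m. (\<lambda>n. u (r n) x) \<longlonglongrightarrow> v x) \<and> (\<lambda>n. \<integral>x. \<bar>u (r n) x - v x\<bar> \<partial>m) \<longlonglongrightarrow> 0"
    using rellich[of u C, OF assms] by (elim exE) (rule that)
  show thesis by (rule that[of r v]) (use * in simp_all)
qed

end

text \<open>
  The reaction \<open>f\<close> is bounded by \<open>M\<close>. The assumption \<open>f_almost_lipschitz\<close> is uniform continuity, in a form that
  can be integrated, and \<open>delta_bound\<close> keeps minimisers below the level \<open>\<delta>\<close>.
\<close>

locale reaction = compact_nonlocal_form +
  fixes f F :: "real \<Rightarrow> real" and M \<delta> :: real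
  assumes f_borel [measurable]: "f \<in> borel_measurable borel"
    and f_odd: "f (- t) = - f t"
    and f_mono: "s \<le> t \<Longrightarrow> f s \<le> f t"
    and f_bound: "\<bar>f t\<bar> \<le> M"
    and f_almost_lipschitz: "0 < \<epsilon> \<Longrightarrow> \<exists>C\<ge>0. \<forall>a b. \<bar>f a - f b\<bar> \<le> \<epsilon> + C * \<bar>a - b\<bar>"
    and F_deriv: "(F has_real_derivative f t) (at t)"
    and F_0: "F 0 = 0"
    and delta_pos: "0 < \<delta>"
    and delta_bound: "M * p \<le> c0 * \<delta> powr (p - 1)"
begin

definition Q :: "('a \<Rightarrow> real) \<Rightarrow> ('a \<Rightarrow> real) \<Rightarrow> real" where
  "Q h u = E u / p - (\<integral>x. h x * u x \<partial>m)"

definition source :: "('a \<Rightarrow> real) \<Rightarrow> bool" where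
  "source h \<longleftrightarrow> h \<in> borel_measurable m \<and> (\<forall>x. \<bar>h x\<bar> \<le> M)"

lemma sourceD: "source h \<Longrightarrow> h \<in> borel_measurable m" "source h \<Longrightarrow> \<bar>h x\<bar> \<le> M"
  by (auto simp: source_def)

lemma M_nonneg: "0 \<le> M"
  using f_bound[of 0] by linarith

lemma source_minus: "source h \<Longrightarrow> source (\<lambda>x. - h x)"
  by (auto simp: source_def)

lemma source_comp: "v \<in> borel_measurable m \<Longrightarrow> source (\<lambda>x. f (v x))"
  using f_bound by (auto simp: source_def)

lemma integrable_bounded_mult:
  assumes "h \<in> borel_measurable m" "\<And>x. \<bar>h x\<bar> \<le> (B::real)" "integrable m u"
  shows "integrable m (\<lambda>x. h x * u x :: real)"
proof (rule Bochner_Integration.integrable_bound[of _ "\<lambda>x. B * u x"])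
  show "AE x in m. norm (h x * u x) \<le> norm (B * u x)"
    using assms(2) by (intro AE_I2) (simp add: abs_mult mult_right_mono order_trans[OF _ abs_ge_self])
qed (use assms in auto)

lemma integral_bounded_mult_le:
  assumes "h \<in> borel_measurable m" "\<And>x. \<bar>h x\<bar> \<le> (B::real)" "integrable m u"
  shows "\<bar>\<integral>x. h x * u x \<partial>m\<bar> \<le> B * (\<integral>x. \<bar>u x :: real\<bar> \<partial>m)"
proof -
  have "\<bar>\<integral>x. h x * u x \<partial>m\<bar> \<le> (\<integral>x. \<bar>h x * u x\<bar> \<partial>m)" by (rule integral_abs_bound)
  also have "\<dots> \<le> (\<integral>x. B * \<bar>u x\<bar> \<partial>m)"
  proof (rule integral_mono)
    show "integrable m (\<lambda>x. \<bar>h x * u x\<bar>)" by (intro integrable_abs integrable_bounded_mult[OF assms])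
    show "\<bar>h x * u x\<bar> \<le> B * \<bar>u x\<bar>" for x using assms(2) by (simp add: abs_mult mult_right_mono)
  qed (use assms(3) in auto)
  finally show ?thesis by simp
qed

lemma source_integrable: "source h \<Longrightarrow> integrable m u \<Longrightarrow> integrable m (\<lambda>x. h x * u x)"
  using integrable_bounded_mult[of h M u] by (auto simp: source_def)

lemma source_integral_le: "source h \<Longrightarrow> integrable m u \<Longrightarrow> \<bar>\<integral>x. h x * u x \<partial>m\<bar> \<le> M * (\<integral>x. \<bar>u x\<bar> \<partial>m)"
  using integral_bounded_mult_le[of h M u] by (auto simp: source_def)

text \<open>The parameter \<open>\<epsilon>\<close> of \<open>L1_le_E\<close> is chosen so that the coefficient of the energy becomes \<open>1 / (2 p)\<close> at most.\<close>

lemma L1_absorbed: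
  obtains C where "0 \<le> C" "\<And>u. u \<in> W \<Longrightarrow> M * (\<integral>x. \<bar>u x\<bar> \<partial>m) \<le> E u / (2 * p) + C"
proof -
  define y where "y = 2 * p * (M + 1) / c0"
  define \<epsilon> where "\<epsilon> = y powr (1 / (p - 1))"
  have y: "0 < y" using M_nonneg p_pos c0_pos by (simp add: y_def)
  then have e: "0 < \<epsilon>" by (simp add: \<epsilon>_def)
  have "1 / (p - 1) * (1 - p) = - 1" using p_gt_1 by (simp add: field_simps)
  then have "\<epsilon> powr (1 - p) = inverse y" using y by (simp add: \<epsilon>_def powr_powr powr_minus del: mult_minus_right)
  then have "\<epsilon> powr (1 - p) / c0 = 1 / (2 * p) * (1 / (M + 1))"
    using c0_pos by (simp add: y_def divide_simps)
  then have "M * (\<epsilon> powr (1 - p) / c0) = 1 / (2 * p) * (M / (M + 1))" by simp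
  also have "\<dots> \<le> 1 / (2 * p) * 1"
    using M_nonneg p_pos by (intro mult_left_mono) (auto simp: divide_le_eq)
  finally have small: "M * (\<epsilon> powr (1 - p) / c0) \<le> 1 / (2 * p)" by simp
  show thesis
  proof
    show "0 \<le> M * (\<epsilon> * measure m \<Omega>)" using M_nonneg e by simp
    fix u assume u: "u \<in> W"
    have "M * (\<integral>x. \<bar>u x\<bar> \<partial>m) \<le> M * (\<epsilon> * measure m \<Omega> + \<epsilon> powr (1 - p) / c0 * E u)"
      using M_nonneg by (intro mult_left_mono L1_le_E u e)
    also have "\<dots> = M * (\<epsilon> * measure m \<Omega>) + (M * (\<epsilon> powr (1 - p) / c0)) * E u" by (simp add: algebra_simps)
    also have "(M * (\<epsilon> powr (1 - p) / c0)) * E u \<le> 1 / (2 * p) * E u"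
      by (intro mult_right_mono small E_nonneg)
    finally show "M * (\<integral>x. \<bar>u x\<bar> \<partial>m) \<le> E u / (2 * p) + M * (\<epsilon> * measure m \<Omega>)" by simp
  qed
qed

lemma L1_tendsto_pairing:
  assumes "source h" and u: "\<And>n. integrable m (u n)" "integrable m v"
    and lim: "(\<lambda>n. \<integral>x. \<bar>u n x - v x\<bar> \<partial>m) \<longlonglongrightarrow> 0"
  shows "(\<lambda>n. \<integral>x. h x * u n x \<partial>m) \<longlonglongrightarrow> (\<integral>x. h x * v x \<partial>m)"
proof -
  have "(\<lambda>n. (\<integral>x. h x * u n x \<partial>m) - (\<integral>x. h x * v x \<partial>m)) \<longlonglongrightarrow> 0"
  proof (rule tendsto_rabs_zero_cancel, rule tendsto_sandwich[OF _ _ tendsto_const])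
    show "(\<lambda>n. M * (\<integral>x. \<bar>u n x - v x\<bar> \<partial>m)) \<longlonglongrightarrow> 0"
      using tendsto_mult_left[OF lim, of M] by simp
    show "\<forall>\<^sub>F n in sequentially. \<bar>(\<integral>x. h x * u n x \<partial>m) - (\<integral>x. h x * v x \<partial>m)\<bar> \<le> M * (\<integral>x. \<bar>u n x - v x\<bar> \<partial>m)"
    proof (rule always_eventually, rule allI)
      fix n
      have "(\<integral>x. h x * u n x \<partial>m) - (\<integral>x. h x * v x \<partial>m) = (\<integral>x. h x * (u n x - v x) \<partial>m)"
        using source_integrable[OF assms(1)] u
        by (simp add: right_diff_distrib flip: Bochner_Integration.integral_diff)
      then show "\<bar>(\<integral>x. h x * u n x \<partial>m) - (\<integral>x. h x * v x \<partial>m)\<bar> \<le> M * (\<integral>x. \<bar>u n x - v x\<bar> \<partial>m)"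
        using source_integral_le[OF assms(1), of "\<lambda>x. u n x - v x"] u by simp
    qed
  qed (simp add: always_eventually)
  then show ?thesis by (simp add: LIM_zero_iff)
qed

text \<open>
  The direct method: a minimising sequence is bounded in energy, the linear term passes to the \<open>L\<^sup>1\<close> limit of
  a subsequence, and the energy is lower semicontinuous.
\<close>

lemma ex_minimizer:
  assumes h: "source h"
  shows "\<exists>v\<in>W. \<forall>u\<in>W. Q h v \<le> Q h u"
proof -
  obtain C where C: "0 \<le> C" "\<And>u. u \<in> W \<Longrightarrow> M * (\<integral>x. \<bar>u x\<bar> \<partial>m) \<le> E u / (2 * p) + C"
    by (rule L1_absorbed) blast
  have low: "E u / (2 * p) - C \<le> Q h u" if u: "u \<in> W" for u
  proof -
    have "2 * (E u / (2 * p)) = E u / p" by simp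
    then show ?thesis using C(2)[OF u] source_integral_le[OF h W_integrable[OF u]] by (simp add: Q_def abs_le_iff)
  qed
  have bdd: "bdd_below (Q h ` W)"
  proof (rule bdd_belowI2[where m="-C"])
    fix u assume "u \<in> W"
    then show "- C \<le> Q h u" using low[of u] E_nonneg[of u] p_pos by (smt (verit) divide_nonneg_pos)
  qed
  define I where "I = (INF u\<in>W. Q h u)"
  have "\<exists>u\<in>W. Q h u < I + 1 / real (Suc n)" for n
  proof -
    have "I < I + 1 / real (Suc n)" by simp
    then show ?thesis unfolding I_def using W_zero_fun bdd by (subst (asm) cINF_less_iff) auto
  qed
  then obtain u where u: "\<And>n. u n \<in> W" "\<And>n. Q h (u n) < I + 1 / real (Suc n)" by metis
  have Eb: "E (u n) \<le> 2 * p * (I + 1 + C)" for n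
  proof -
    have "1 / real (Suc n) \<le> 1" by simp
    then have "E (u n) / (2 * p) \<le> I + 1 + C" using low[OF u(1), of n] u(2)[of n] by linarith
    then show ?thesis using p_pos by (simp add: field_simps)
  qed
  obtain r v where r: "strict_mono r" and v: "integrable m v" "\<And>x. x \<notin> \<Omega> \<Longrightarrow> v x = 0"
    and ae: "AE x in m. (\<lambda>n. u (r n) x) \<longlonglongrightarrow> v x" and L1: "(\<lambda>n. \<integral>x. \<bar>u (r n) x - v x\<bar> \<partial>m) \<longlonglongrightarrow> 0"
    by (rule rellich_subsequence[of u, OF u(1) Eb]) (rule that)
  define c where "c n = p * (I + 1 / real (Suc (r n)) + (\<integral>x. h x * u (r n) x \<partial>m))" for n
  have "(\<lambda>n. 1 / real (Suc (r n))) \<longlonglongrightarrow> 0"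
    using LIMSEQ_subseq_LIMSEQ[OF LIMSEQ_Suc[OF lim_1_over_n] r] by (simp add: o_def)
  moreover have "(\<lambda>n. \<integral>x. h x * u (r n) x \<partial>m) \<longlonglongrightarrow> (\<integral>x. h x * v x \<partial>m)"
    by (intro L1_tendsto_pairing h v L1 W_integrable u)
  ultimately have cl: "c \<longlonglongrightarrow> p * (I + 0 + (\<integral>x. h x * v x \<partial>m))"
    unfolding c_def by (intro tendsto_intros)
  have Ec: "E (u (r n)) \<le> c n" for n
  proof -
    have "E (u (r n)) / p \<le> I + 1 / real (Suc (r n)) + (\<integral>x. h x * u (r n) x \<partial>m)"
      using u(2)[of "r n"] by (simp add: Q_def)
    then show ?thesis using p_pos by (simp add: c_def field_simps)
  qed
  have vW: "v \<in> W" "E v \<le> p * (I + 0 + (\<integral>x. h x * v x \<partial>m))"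
    using W_fatou[OF u(1) _ v(2) ae Ec cl] v(1) by auto
  have "Q h v \<le> I" using vW(2) p_pos by (simp add: Q_def field_simps)
  moreover have "I \<le> Q h u" if "u \<in> W" for u unfolding I_def using bdd that by (rule cINF_lower)
  ultimately show ?thesis using vW(1) by (meson order_trans)
qed

definition sol :: "('a \<Rightarrow> real) \<Rightarrow> 'a \<Rightarrow> real" where
  "sol h = (SOME v. v \<in> W \<and> (\<forall>u\<in>W. Q h v \<le> Q h u))"

lemma assumes "source h"
  shows sol_W: "sol h \<in> W" and sol_minimal: "u \<in> W \<Longrightarrow> Q h (sol h) \<le> Q h u"
  using someI_ex[of "\<lambda>v. v \<in> W \<and> (\<forall>u\<in>W. Q h v \<le> Q h u)"] ex_minimizer[OF assms]
  unfolding sol_def by blast+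

definition \<kappa> :: real where "\<kappa> = 2 / (p * 2 powr p)"

lemma kappa_pos: "0 < \<kappa>"
  using p_pos by (simp add: \<kappa>_def)

text \<open>
  Uniform convexity: compare the minimal value with the value at the midpoint and apply Clarkson's
  inequality. Uniqueness, stability and strict descent all follow from this gap.
\<close>

lemma minimizer_gap:
  assumes h: "source h" and u: "u \<in> W" "\<And>v. v \<in> W \<Longrightarrow> Q h u \<le> Q h v" and v: "v \<in> W"
  shows "\<kappa> * E (\<lambda>x. v x - u x) \<le> Q h v - Q h u"
proof -
  let ?a = "\<lambda>x. (v x + u x) / 2"
  have a: "?a \<in> W" using W_scale[OF W_add[OF v u(1)], of "1/2"] by simp
  have e: "E (\<lambda>x. (v x - u x) / 2) = E (\<lambda>x. v x - u x) / 2 powr p"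
    using E_scale[of "1/2" "\<lambda>x. v x - u x"] by (simp add: powr_divide)
  have i: "integrable m (\<lambda>x. h x * v x)" "integrable m (\<lambda>x. h x * u x)"
    using source_integrable[OF h] W_integrable u v by auto
  have "(\<integral>x. h x * ?a x \<partial>m) = ((\<integral>x. h x * v x \<partial>m) + (\<integral>x. h x * u x \<partial>m)) / 2"
    using i by (simp add: distrib_left)
  moreover have "Q h u \<le> Q h ?a" using u(2) a by simp
  moreover have "(E ?a + E (\<lambda>x. v x - u x) / 2 powr p) / p \<le> (E v + E u) / 2 / p"
    using clarkson_E[OF v u(1)] p_pos unfolding e by (intro divide_right_mono) auto
  then have "E ?a / p + E (\<lambda>x. v x - u x) / 2 powr p / p \<le> (E v + E u) / 2 / p"
    by (simp only: add_divide_distrib)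
  moreover have "\<kappa> * E (\<lambda>x. v x - u x) = 2 * (E (\<lambda>x. v x - u x) / 2 powr p / p)"
    by (simp add: \<kappa>_def)
  ultimately show ?thesis
    unfolding Q_def by (simp add: add_divide_distrib)
qed

lemma minimizer_unique:
  assumes h: "source h" and u: "u \<in> W" "\<And>v. v \<in> W \<Longrightarrow> Q h u \<le> Q h v" and v: "v \<in> W" "Q h v \<le> Q h u"
  shows "AE x in m. v x = u x"
proof -
  have "\<kappa> * E (\<lambda>x. v x - u x) \<le> 0" using minimizer_gap[OF h u v(1)] v(2) by simp
  then have "E (\<lambda>x. v x - u x) \<le> 0" using kappa_pos by (simp add: mult_le_0_iff)
  from E_eq_0_AE[OF W_diff[OF v(1) u(1)] this] show ?thesis by simp
qed

text \<open>
  Replacing \<open>u\<close> by \<open>min u \<delta>\<close> saves at least \<open>c0 \<delta> powr (p - 1)\<close> times the integral of the excess in \<open>E\<close>, and costs at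
  most \<open>M\<close> times that integral in the linear term. By \<open>delta_bound\<close> the truncated function is a minimiser too.
\<close>

lemma minimizer_le:
  assumes h: "source h" and u: "u \<in> W" "\<And>v. v \<in> W \<Longrightarrow> Q h u \<le> Q h v"
  shows "AE x in m. u x \<le> \<delta>"
proof -
  let ?v = "\<lambda>x. min (u x) \<delta>" and ?w = "\<lambda>x. max 0 (u x - \<delta>)"
  have v: "?v \<in> W" using u(1) delta_pos by (intro W_min_const) auto
  have iw: "integrable m ?w" using u(1) delta_pos by (rule W_integrable_excess)
  have "M * p * (\<integral>x. ?w x \<partial>m) \<le> c0 * \<delta> powr (p - 1) * (\<integral>x. ?w x \<partial>m)"
    by (intro mult_right_mono delta_bound) auto
  also have "\<dots> \<le> E u - E ?v" using u(1) delta_pos by (rule E_truncation)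
  finally have "(M * p * (\<integral>x. ?w x \<partial>m)) / p \<le> (E u - E ?v) / p"
    using p_pos by (intro divide_right_mono) auto
  then have 1: "M * (\<integral>x. ?w x \<partial>m) \<le> E u / p - E ?v / p" using p_pos by (simp add: diff_divide_distrib)
  have "(\<integral>x. h x * u x \<partial>m) - (\<integral>x. h x * ?v x \<partial>m) = (\<integral>x. h x * ?w x \<partial>m)"
  proof (subst Bochner_Integration.integral_diff[symmetric], goal_cases)
    case 3
    have "h x * u x - h x * ?v x = h x * ?w x" for x
      by (simp add: min_def max_def flip: right_diff_distrib)
    then show ?case by presburger
  qed (use source_integrable[OF h W_integrable[OF u(1)]] source_integrable[OF h W_integrable[OF v]] in auto)
  also have "\<dots> \<le> M * (\<integral>x. \<bar>?w x\<bar> \<partial>m)" using source_integral_le[OF h iw] by (simp add: abs_le_iff)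
  finally have "Q h ?v \<le> Q h u" using 1 by (simp add: Q_def)
  then have "AE x in m. min (u x) \<delta> = u x" by (intro minimizer_unique[OF h] u v)
  then show ?thesis by eventually_elim (simp add: min_def split: if_splits)
qed

lemma Q_minus: "Q (\<lambda>x. - h x) (\<lambda>x. - u x) = Q h u"
  by (simp add: Q_def E_minus)

lemma minimizer_bound:
  assumes h: "source h" and u: "u \<in> W" "\<And>v. v \<in> W \<Longrightarrow> Q h u \<le> Q h v"
  shows "AE x in m. \<bar>u x\<bar> \<le> \<delta>"
proof -
  have "AE x in m. - u x \<le> \<delta>"
  proof (rule minimizer_le[OF source_minus[OF h] W_minus[OF u(1)]])
    fix v assume "v \<in> W"
    then show "Q (\<lambda>x. - h x) (\<lambda>x. - u x) \<le> Q (\<lambda>x. - h x) v"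
      using u(2)[OF W_minus] Q_minus[of h "\<lambda>x. - v x"] Q_minus[of h u] by simp
  qed
  moreover have "AE x in m. u x \<le> \<delta>" by (rule minimizer_le[OF h u])
  ultimately show ?thesis by eventually_elim auto
qed

lemma sol_bound: "source h \<Longrightarrow> AE x in m. \<bar>sol h x\<bar> \<le> \<delta>"
  by (rule minimizer_bound) (auto intro: sol_W sol_minimal)

text \<open>
  Each minimiser is a competitor for the other one. Adding the two gap inequalities leaves only the
  difference of the sources, tested with functions bounded by \<open>\<delta>\<close>.
\<close>

lemma E_sol_diff_le:
  assumes h: "source h" "source h'"
  shows "2 * \<kappa> * E (\<lambda>x. sol h x - sol h' x) \<le> 2 * \<delta> * (\<integral>x. indicator \<Omega> x * \<bar>h x - h' x\<bar> \<partial>m)"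
proof -
  let ?u = "sol h" and ?v = "sol h'"
  have W: "?u \<in> W" "?v \<in> W" using h sol_W by auto
  have [measurable]: "h \<in> borel_measurable m" "h' \<in> borel_measurable m" using h sourceD by auto
  have hb: "\<bar>h x - h' x\<bar> \<le> 2 * M" for x using sourceD(2)[OF h(1), of x] sourceD(2)[OF h(2), of x] by linarith
  have 1: "\<kappa> * E (\<lambda>x. ?u x - ?v x) \<le> Q h' ?u - Q h' ?v"
    by (rule minimizer_gap) (use h W sol_minimal in auto)
  have "\<kappa> * E (\<lambda>x. ?v x - ?u x) \<le> Q h ?v - Q h ?u"
    by (rule minimizer_gap) (use h W sol_minimal in auto)
  moreover have "E (\<lambda>x. ?v x - ?u x) = E (\<lambda>x. ?u x - ?v x)" using E_minus[of "\<lambda>x. ?u x - ?v x"] by simp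
  ultimately have "2 * \<kappa> * E (\<lambda>x. ?u x - ?v x) \<le> (Q h' ?u - Q h' ?v) + (Q h ?v - Q h ?u)" using 1 by simp
  also have "\<dots> = (\<integral>x. (h x * ?u x - h x * ?v x) - (h' x * ?u x - h' x * ?v x) \<partial>m)"
    using source_integrable[OF h(1)] source_integrable[OF h(2)] W_integrable W
    by (simp add: Q_def)
  also have "\<dots> \<le> (\<integral>x. 2 * \<delta> * (indicator \<Omega> x * \<bar>h x - h' x\<bar>) \<partial>m)"
  proof (rule integral_mono_AE)
    show "integrable m (\<lambda>x. (h x * ?u x - h x * ?v x) - (h' x * ?u x - h' x * ?v x))"
      using source_integrable[OF h(1)] source_integrable[OF h(2)] W_integrable W by auto
    show "integrable m (\<lambda>x. 2 * \<delta> * (indicator \<Omega> x * \<bar>h x - h' x\<bar>))"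
      using hb delta_pos by (intro integrable_bounded_on_Omega[where C="2 * \<delta> * (2 * M)"]) auto
    show "AE x in m. (h x * ?u x - h x * ?v x) - (h' x * ?u x - h' x * ?v x) \<le> 2 * \<delta> * (indicator \<Omega> x * \<bar>h x - h' x\<bar>)"
      using sol_bound[OF h(1)] sol_bound[OF h(2)]
    proof eventually_elim
      case (elim x)
      show ?case
      proof (cases "x \<in> \<Omega>")
        case True
        have "(h x * ?u x - h x * ?v x) - (h' x * ?u x - h' x * ?v x) = (h x - h' x) * (?u x - ?v x)" by (simp add: algebra_simps)
        also have "\<dots> \<le> \<bar>h x - h' x\<bar> * \<bar>?u x - ?v x\<bar>" by (metis abs_ge_self abs_mult)
        also have "\<dots> \<le> \<bar>h x - h' x\<bar> * (2 * \<delta>)" using elim by (intro mult_left_mono) auto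
        finally show ?thesis using True by (simp add: mult.commute)
      qed (use W_zero[OF W(1)] W_zero[OF W(2)] in simp)
    qed
  qed
  finally show ?thesis by simp
qed

text \<open>
  One step of an implicit descent scheme for \<open>J\<close>: the reaction is evaluated at the old state. Its fixed
  points are the solutions of the equation with reaction \<open>f\<close>.
\<close>

definition T :: "('a \<Rightarrow> real) \<Rightarrow> 'a \<Rightarrow> real" where
  "T v = sol (\<lambda>x. f (v x))"

lemma T_W: "v \<in> borel_measurable m \<Longrightarrow> T v \<in> W"
  by (simp add: T_def sol_W source_comp)

lemma T_minimal: "v \<in> borel_measurable m \<Longrightarrow> u \<in> W \<Longrightarrow> Q (\<lambda>x. f (v x)) (T v) \<le> Q (\<lambda>x. f (v x)) u"
  by (simp add: T_def sol_minimal source_comp)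

text \<open>The two functionals agree on the whole energy space, so even the chosen minimisers are the same function.\<close>

lemma T_cong:
  assumes [measurable]: "v \<in> borel_measurable m" "v' \<in> borel_measurable m" and "AE x in m. v x = v' x"
  shows "T v = T v'"
proof -
  have "Q (\<lambda>x. f (v x)) u = Q (\<lambda>x. f (v' x)) u" if "u \<in> W" for u
  proof -
    have [measurable]: "u \<in> borel_measurable m" using that by (rule W_measurable)
    have "(\<integral>x. f (v x) * u x \<partial>m) = (\<integral>x. f (v' x) * u x \<partial>m)"
      by (rule integral_cong_AE) (use assms(3) in \<open>auto elim: eventually_mono\<close>)
    then show ?thesis by (simp add: Q_def)
  qed
  then have "(\<lambda>w. w \<in> W \<and> (\<forall>u\<in>W. Q (\<lambda>x. f (v x)) w \<le> Q (\<lambda>x. f (v x)) u)) =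
    (\<lambda>w. w \<in> W \<and> (\<forall>u\<in>W. Q (\<lambda>x. f (v' x)) w \<le> Q (\<lambda>x. f (v' x)) u))" by (intro ext) auto
  then show ?thesis unfolding T_def sol_def by simp
qed

lemma T_unique:
  assumes "v \<in> borel_measurable m" "u \<in> W" "\<And>w. w \<in> W \<Longrightarrow> Q (\<lambda>x. f (v x)) u \<le> Q (\<lambda>x. f (v x)) w"
  shows "AE x in m. T v x = u x"
  by (rule minimizer_unique[OF source_comp[OF assms(1)] assms(2,3) T_W T_minimal]) (use assms in auto)

lemma T_odd:
  assumes v: "v \<in> borel_measurable m"
  shows "AE x in m. T (\<lambda>x. - v x) x = - T v x"
proof (rule T_unique)
  show "(\<lambda>x. - T v x) \<in> W" by (intro W_minus T_W v)
  fix w assume w: "w \<in> W"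
  have "Q (\<lambda>x. f (v x)) (T v) \<le> Q (\<lambda>x. f (v x)) (\<lambda>x. - w x)" by (intro T_minimal v W_minus w)
  then show "Q (\<lambda>x. f (- v x)) (\<lambda>x. - T v x) \<le> Q (\<lambda>x. f (- v x)) w"
    using Q_minus[of "\<lambda>x. f (v x)" "T v"] Q_minus[of "\<lambda>x. f (v x)" "\<lambda>x. - w x"] by (simp add: f_odd)
qed (use v in auto)

text \<open>
  The estimate \<open>f_almost_lipschitz\<close> turns \<open>L\<^sup>1\<close> convergence of the arguments into \<open>L\<^sup>1\<close> convergence of the values,
  without passing to subsequences.
\<close>

lemma L1_continuous_f:
  assumes v: "\<And>n. integrable m (v n)" "integrable m w"
    and lim: "(\<lambda>n. \<integral>x. \<bar>v n x - w x\<bar> \<partial>m) \<longlonglongrightarrow> 0"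
  shows "(\<lambda>n. \<integral>x. indicator \<Omega> x * \<bar>f (v n x) - f (w x)\<bar> \<partial>m) \<longlonglongrightarrow> 0"
proof (rule LIMSEQ_I)
  fix r :: real assume r: "0 < r"
  have [measurable]: "v n \<in> borel_measurable m" "w \<in> borel_measurable m" for n using v by auto
  define \<epsilon> where "\<epsilon> = r / (2 * (measure m \<Omega> + 1))"
  have mpos: "0 < measure m \<Omega> + 1" by (simp add: add_nonneg_pos)
  have e: "0 < \<epsilon>" using r mpos by (simp add: \<epsilon>_def)
  have e2: "\<epsilon> * measure m \<Omega> < r / 2" using r mpos by (simp add: \<epsilon>_def field_simps)
  obtain C where C: "0 \<le> C" "\<And>a b. \<bar>f a - f b\<bar> \<le> \<epsilon> + C * \<bar>a - b\<bar>" using f_almost_lipschitz[OF e] by blast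
  have "(\<lambda>n. C * (\<integral>x. \<bar>v n x - w x\<bar> \<partial>m)) \<longlonglongrightarrow> 0" using tendsto_mult_left[OF lim, of C] by simp
  then obtain n0 where n0: "\<And>n. n \<ge> n0 \<Longrightarrow> C * (\<integral>x. \<bar>v n x - w x\<bar> \<partial>m) < r / 2"
    using r by (fastforce dest!: order_tendstoD(2)[where a="r/2"] simp: eventually_sequentially)
  show "\<exists>n0. \<forall>n\<ge>n0. norm ((\<integral>x. indicator \<Omega> x * \<bar>f (v n x) - f (w x)\<bar> \<partial>m) - 0) < r"
  proof (intro exI allI impI)
    fix n assume n: "n0 \<le> n"
    have fin: "integrable m (\<lambda>x. \<epsilon> * indicator \<Omega> x)" using Omega_finite by auto
    have id: "integrable m (\<lambda>x. C * \<bar>v n x - w x\<bar>)" using v by auto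
    have "(\<integral>x. indicator \<Omega> x * \<bar>f (v n x) - f (w x)\<bar> \<partial>m) \<le> (\<integral>x. \<epsilon> * indicator \<Omega> x + C * \<bar>v n x - w x\<bar> \<partial>m)"
    proof (rule integral_mono)
      have "\<bar>f a - f b\<bar> \<le> 2 * M" for a b using f_bound[of a] f_bound[of b] by linarith
      then show "integrable m (\<lambda>x. indicator \<Omega> x * \<bar>f (v n x) - f (w x)\<bar>)"
        by (intro integrable_bounded_on_Omega[where C="2 * M"]) auto
      show "integrable m (\<lambda>x. \<epsilon> * indicator \<Omega> x + C * \<bar>v n x - w x\<bar>)" using fin id by auto
      fix x show "indicator \<Omega> x * \<bar>f (v n x) - f (w x)\<bar> \<le> \<epsilon> * indicator \<Omega> x + C * \<bar>v n x - w x\<bar>"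
        using C e by (cases "x \<in> \<Omega>") auto
    qed
    also have "\<dots> = \<epsilon> * measure m \<Omega> + C * (\<integral>x. \<bar>v n x - w x\<bar> \<partial>m)"
      using fin id Omega_finite by (subst Bochner_Integration.integral_add) auto
    also have "\<dots> < r" using n0[OF n] e2 by linarith
    finally have "(\<integral>x. indicator \<Omega> x * \<bar>f (v n x) - f (w x)\<bar> \<partial>m) < r" .
    moreover have "0 \<le> (\<integral>x. indicator \<Omega> x * \<bar>f (v n x) - f (w x)\<bar> \<partial>m)" by (rule integral_nonneg_AE) auto
    ultimately show "norm ((\<integral>x. indicator \<Omega> x * \<bar>f (v n x) - f (w x)\<bar> \<partial>m) - 0) < r" by simp
  qed
qed

lemma E_tendsto_0_imp_L1:
  assumes u: "\<And>n. u n \<in> W" and lim: "(\<lambda>n. E (u n)) \<longlonglongrightarrow> 0"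
  shows "(\<lambda>n. \<integral>x. \<bar>u n x\<bar> \<partial>m) \<longlonglongrightarrow> 0"
proof (rule LIMSEQ_I)
  fix r :: real assume r: "0 < r"
  define \<epsilon> where "\<epsilon> = r / (2 * (measure m \<Omega> + 1))"
  have mpos: "0 < measure m \<Omega> + 1" by (simp add: add_nonneg_pos)
  have e: "0 < \<epsilon>" using r mpos by (simp add: \<epsilon>_def)
  have e2: "\<epsilon> * measure m \<Omega> < r / 2" using r mpos by (simp add: \<epsilon>_def field_simps)
  have "(\<lambda>n. \<epsilon> powr (1 - p) / c0 * E (u n)) \<longlonglongrightarrow> 0" using tendsto_mult_left[OF lim, of "\<epsilon> powr (1 - p) / c0"] by simp
  then obtain n0 where n0: "\<And>n. n \<ge> n0 \<Longrightarrow> \<epsilon> powr (1 - p) / c0 * E (u n) < r / 2"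
    using r by (fastforce dest!: order_tendstoD(2)[where a="r/2"] simp: eventually_sequentially)
  show "\<exists>n0. \<forall>n\<ge>n0. norm ((\<integral>x. \<bar>u n x\<bar> \<partial>m) - 0) < r"
  proof (intro exI allI impI)
    fix n assume n: "n0 \<le> n"
    have "(\<integral>x. \<bar>u n x\<bar> \<partial>m) < r" using L1_le_E[OF u e, of n] n0[OF n] e2 by linarith
    moreover have "0 \<le> (\<integral>x. \<bar>u n x\<bar> \<partial>m)" by (rule integral_nonneg_AE) auto
    ultimately show "norm ((\<integral>x. \<bar>u n x\<bar> \<partial>m) - 0) < r" by simp
  qed
qed

lemma T_continuous:
  assumes v: "\<And>n. integrable m (v n)" "integrable m w"
    and lim: "(\<lambda>n. \<integral>x. \<bar>v n x - w x\<bar> \<partial>m) \<longlonglongrightarrow> 0"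
  shows "(\<lambda>n. \<integral>x. \<bar>T (v n) x - T w x\<bar> \<partial>m) \<longlonglongrightarrow> 0"
proof (rule E_tendsto_0_imp_L1)
  have vm: "v n \<in> borel_measurable m" "w \<in> borel_measurable m" for n using v by auto
  show "(\<lambda>x. T (v n) x - T w x) \<in> W" for n by (intro W_diff T_W vm)
  show "(\<lambda>n. E (\<lambda>x. T (v n) x - T w x)) \<longlonglongrightarrow> 0"
  proof (rule tendsto_sandwich[OF _ _ tendsto_const])
    show "(\<lambda>n. \<delta> / \<kappa> * (\<integral>x. indicator \<Omega> x * \<bar>f (v n x) - f (w x)\<bar> \<partial>m)) \<longlonglongrightarrow> 0"
      using tendsto_mult_left[OF L1_continuous_f[OF v lim], of "\<delta> / \<kappa>"] by simp
    show "\<forall>\<^sub>F n in sequentially. E (\<lambda>x. T (v n) x - T w x) \<le> \<delta> / \<kappa> * (\<integral>x. indicator \<Omega> x * \<bar>f (v n x) - f (w x)\<bar> \<partial>m)"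
    proof (rule always_eventually, rule allI)
      fix n show "E (\<lambda>x. T (v n) x - T w x) \<le> \<delta> / \<kappa> * (\<integral>x. indicator \<Omega> x * \<bar>f (v n x) - f (w x)\<bar> \<partial>m)"
        using E_sol_diff_le[OF source_comp[OF vm(1)[of n]] source_comp[OF vm(2)]] kappa_pos
        by (simp add: T_def field_simps)
    qed
  qed (simp add: always_eventually E_nonneg)
qed

end

section \<open>The energy functional and its critical points\<close>

context reaction
begin

lemma E_cong_AE:
  assumes [measurable]: "u \<in> borel_measurable m" "v \<in> borel_measurable m" and ae: "AE x in m. u x = v x"
  shows "AE z in m \<Otimes>\<^sub>M m. gag u z = gag v z" "E u = E v"
proof -
  have sf: "sigma_finite_measure m" ..
  show *: "AE z in m \<Otimes>\<^sub>M m. gag u z = gag v z"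
    using AE_pair_fst[OF sf ae] AE_pair_snd[OF sf sf ae] by eventually_elim (simp add: gag_def)
  show "E u = E v" unfolding E_def by (rule integral_cong_AE) (use * in auto)
qed

lemma Q_cong_AE:
  assumes h: "source h" "source h'" and [measurable]: "u \<in> borel_measurable m" "v \<in> borel_measurable m"
    and ae: "AE x in m. u x = v x" "AE x in m. h x = h' x"
  shows "Q h u = Q h' v"
proof -
  have [measurable]: "h \<in> borel_measurable m" "h' \<in> borel_measurable m" using h sourceD by auto
  have "(\<integral>x. h x * u x \<partial>m) = (\<integral>x. h' x * v x \<partial>m)"
  proof (rule integral_cong_AE)
    show "AE x in m. h x * u x = h' x * v x" using ae by eventually_elim simp
  qed auto
  with E_cong_AE(2)[of u v] ae show ?thesis by (simp add: Q_def)
qed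

lemma F_tangent: "f a * (b - a) \<le> F b - F a"
proof -
  consider "a < b" | "b < a" | "a = b" by linarith
  then show ?thesis
  proof cases
    case 1
    from MVT2[OF 1, of F f] F_deriv obtain z where "a < z" "F b - F a = (b - a) * f z" by blast
    then show ?thesis using 1 f_mono[of a z] by (simp add: mult.commute)
  next
    case 2
    from MVT2[OF 2, of F f] F_deriv obtain z where z: "z < a" "F a - F b = (a - b) * f z" by blast
    then have "(a - b) * f z \<le> (a - b) * f a" using 2 f_mono[of z a] by (intro mult_left_mono) auto
    then show ?thesis using z by (simp add: algebra_simps)
  qed simp
qed

lemma F_lipschitz: "\<bar>F a - F b\<bar> \<le> M * \<bar>a - b\<bar>"
proof -
  have "\<bar>f c * (a - b)\<bar> \<le> M * \<bar>a - b\<bar>" for c unfolding abs_mult by (intro mult_right_mono f_bound) auto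
  from this[of a] this[of b] show ?thesis
    using F_tangent[of a b] F_tangent[of b a] by (simp add: abs_le_iff algebra_simps)
qed

lemma F_even: "F (- t) = F t"
proof -
  have "((\<lambda>t. F (- t) - F t) has_real_derivative 0) (at t)" for t
  proof -
    have "((\<lambda>t. - t :: real) has_real_derivative - 1) (at t)" by (auto intro!: derivative_eq_intros)
    from DERIV_diff[OF DERIV_chain2[OF F_deriv this] F_deriv[of t]] show ?thesis by (simp add: f_odd)
  qed
  then have "F (- t) - F t = F (- 0) - F 0" by (intro DERIV_isconst_all) blast
  then show ?thesis by simp
qed

lemma F_abs: "F \<bar>t\<bar> = F t"
  using F_even[of t] by (simp add: abs_if)

lemma F_measurable [measurable]: "F \<in> borel_measurable borel"
  by (intro borel_measurable_continuous_onI continuous_at_imp_continuous_on ballI DERIV_isCont[OF F_deriv])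

lemma F_comp_integrable:
  assumes "integrable m u"
  shows "integrable m (\<lambda>x. F (u x))"
proof (rule Bochner_Integration.integrable_bound[of _ "\<lambda>x. M * u x"])
  show "AE x in m. norm (F (u x)) \<le> norm (M * u x)"
    using F_lipschitz[of _ 0] M_nonneg by (intro AE_I2) (simp add: F_0 abs_mult)
qed (use assms in auto)

definition J :: "('a \<Rightarrow> real) \<Rightarrow> real" where
  "J u = E u / p - (\<integral>x. F (u x) \<partial>m)"

lemma J_cong_AE:
  assumes [measurable]: "u \<in> borel_measurable m" "v \<in> borel_measurable m" and ae: "AE x in m. u x = v x"
  shows "J u = J v"
proof -
  have "(\<integral>x. F (u x) \<partial>m) = (\<integral>x. F (v x) \<partial>m)"
    by (rule integral_cong_AE) (use ae in \<open>auto elim: eventually_mono\<close>)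
  then show ?thesis using E_cong_AE(2)[OF assms] by (simp add: J_def)
qed

lemma J_minus: "J (\<lambda>x. - u x) = J u"
  by (simp add: J_def E_minus F_even)

lemma J_zero: "J (\<lambda>x. 0) = 0"
  by (simp add: J_def E_zero F_0)

lemma J_abs: "u \<in> W \<Longrightarrow> J (\<lambda>x. \<bar>u x\<bar>) \<le> J u"
  using W_abs(2)[of u] p_pos by (simp add: J_def F_abs divide_right_mono)

lemma F_integral_diff_le:
  assumes "integrable m u" "integrable m v"
  shows "\<bar>(\<integral>x. F (u x) \<partial>m) - (\<integral>x. F (v x) \<partial>m)\<bar> \<le> M * (\<integral>x. \<bar>u x - v x\<bar> \<partial>m)"
proof -
  have "(\<integral>x. F (u x) \<partial>m) - (\<integral>x. F (v x) \<partial>m) = (\<integral>x. F (u x) - F (v x) \<partial>m)"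
    using assms by (simp add: F_comp_integrable)
  also have "\<bar>\<dots>\<bar> \<le> (\<integral>x. \<bar>F (u x) - F (v x)\<bar> \<partial>m)" by (rule integral_abs_bound)
  also have "\<dots> \<le> (\<integral>x. M * \<bar>u x - v x\<bar> \<partial>m)"
    by (intro integral_mono F_lipschitz integrable_mult_right integrable_abs Bochner_Integration.integrable_diff F_comp_integrable assms)
  finally show ?thesis by simp
qed

lemma J_coercive:
  obtains C where "0 \<le> C" "\<And>u. u \<in> W \<Longrightarrow> E u \<le> 2 * p * (J u + C)"
proof -
  obtain C where C: "0 \<le> C" "\<And>u. u \<in> W \<Longrightarrow> M * (\<integral>x. \<bar>u x\<bar> \<partial>m) \<le> E u / (2 * p) + C"
    by (rule L1_absorbed) blast
  show thesis
  proof (rule that[OF C(1)])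
    fix u assume u: "u \<in> W"
    have "(\<integral>x. F (u x) \<partial>m) \<le> E u / (2 * p) + C"
      using F_integral_diff_le[OF W_integrable[OF u], of "\<lambda>x. 0"] C(2)[OF u] by (simp add: F_0 abs_le_iff)
    then have "E u / p - E u / (2 * p) \<le> J u + C" by (simp add: J_def)
    moreover have "E u / p - E u / (2 * p) = E u / (2 * p)" by simp
    ultimately have "E u / (2 * p) \<le> J u + C" by simp
    then show "E u \<le> 2 * p * (J u + C)" using p_pos by (simp add: pos_divide_le_eq mult.commute)
  qed
qed

text \<open>
  The minimality of \<open>T v\<close> gives the gap for the functional with frozen reaction, and the tangent inequality
  of the convex function \<open>F\<close> shows that unfreezing the reaction lowers the value at \<open>T v\<close> further.
\<close>

lemma J_descent:
  assumes v: "v \<in> W"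
  shows "\<kappa> * E (\<lambda>x. v x - T v x) \<le> J v - J (T v)"
proof -
  have vm: "v \<in> borel_measurable m" by (rule W_measurable[OF v])
  let ?h = "\<lambda>x. f (v x)"
  have h: "source ?h" by (rule source_comp[OF vm])
  have W: "T v \<in> W" by (rule T_W[OF vm])
  note i = W_integrable[OF v] W_integrable[OF W]
  have "\<kappa> * E (\<lambda>x. v x - T v x) \<le> Q ?h v - Q ?h (T v)"
    by (rule minimizer_gap[OF h W _ v]) (rule T_minimal[OF vm])
  also have "\<dots> = E v / p - E (T v) / p + (\<integral>x. ?h x * (T v x - v x) \<partial>m)"
    using source_integrable[OF h i(1)] source_integrable[OF h i(2)] by (simp add: Q_def right_diff_distrib)
  also have "(\<integral>x. ?h x * (T v x - v x) \<partial>m) \<le> (\<integral>x. F (T v x) - F (v x) \<partial>m)"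
    using i by (intro integral_mono F_tangent source_integrable[OF h] F_comp_integrable Bochner_Integration.integrable_diff) auto
  also have "\<dots> = (\<integral>x. F (T v x) \<partial>m) - (\<integral>x. F (v x) \<partial>m)" using i by (simp add: F_comp_integrable)
  finally show ?thesis by (simp add: J_def)
qed

lemma J_T_le: "v \<in> W \<Longrightarrow> J (T v) \<le> J v"
  using J_descent[of v] kappa_pos E_nonneg[of "\<lambda>x. v x - T v x"] by (smt (verit) mult_nonneg_nonneg)

text \<open>
  Since \<open>T v\<close> minimises its own functional, \<open>T w\<close> is a competitor, and conversely; so the energies differ at
  most by the linear terms. In general \<open>E\<close> is only lower semicontinuous in \<open>L\<^sup>1\<close>, but on the range of \<open>T\<close> it is
  continuous.
\<close>

lemma E_T_diff_le:
  assumes v: "v \<in> borel_measurable m" "w \<in> borel_measurable m"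
  shows "\<bar>E (T v) - E (T w)\<bar> \<le> p * (M * (\<integral>x. \<bar>T v x - T w x\<bar> \<partial>m))"
proof -
  have *: "E (T v) - E (T w) \<le> p * (M * (\<integral>x. \<bar>T v x - T w x\<bar> \<partial>m))"
    if v: "v \<in> borel_measurable m" and w: "w \<in> borel_measurable m" for v w
  proof -
    let ?h = "\<lambda>x. f (v x)"
    have h: "source ?h" by (rule source_comp[OF v])
    note i = W_integrable[OF T_W[OF v]] W_integrable[OF T_W[OF w]]
    have "Q ?h (T v) \<le> Q ?h (T w)" by (rule T_minimal[OF v T_W[OF w]])
    then have "E (T v) / p - E (T w) / p \<le> (\<integral>x. ?h x * (T v x - T w x) \<partial>m)"
      using source_integrable[OF h i(1)] source_integrable[OF h i(2)] by (simp add: Q_def right_diff_distrib)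
    also have "\<dots> \<le> M * (\<integral>x. \<bar>T v x - T w x\<bar> \<partial>m)"
      using source_integral_le[OF h, of "\<lambda>x. T v x - T w x"] i by simp
    finally have "(E (T v) - E (T w)) / p \<le> M * (\<integral>x. \<bar>T v x - T w x\<bar> \<partial>m)" by (simp add: diff_divide_distrib)
    then show ?thesis using p_pos by (simp add: pos_divide_le_eq mult.commute)
  qed
  show ?thesis using *[OF v] *[OF v(2,1)] by (simp add: abs_le_iff abs_minus_commute)
qed

lemma J_T_continuous:
  assumes v: "\<And>n. integrable m (v n)" "integrable m w"
    and lim: "(\<lambda>n. \<integral>x. \<bar>v n x - w x\<bar> \<partial>m) \<longlonglongrightarrow> 0"
  shows "(\<lambda>n. J (T (v n))) \<longlonglongrightarrow> J (T w)"
proof -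
  have vm: "v n \<in> borel_measurable m" "w \<in> borel_measurable m" for n using v by auto
  note i = W_integrable[OF T_W[OF vm(1)]] W_integrable[OF T_W[OF vm(2)]]
  have "(\<lambda>n. J (T (v n)) - J (T w)) \<longlonglongrightarrow> 0"
  proof (rule tendsto_rabs_zero_cancel, rule tendsto_sandwich[OF _ _ tendsto_const])
    show "(\<lambda>n. 2 * M * (\<integral>x. \<bar>T (v n) x - T w x\<bar> \<partial>m)) \<longlonglongrightarrow> 0"
      using tendsto_mult_left[OF T_continuous[OF v lim], of "2 * M"] by simp
    show "\<forall>\<^sub>F n in sequentially. \<bar>J (T (v n)) - J (T w)\<bar> \<le> 2 * M * (\<integral>x. \<bar>T (v n) x - T w x\<bar> \<partial>m)"
    proof (rule always_eventually, rule allI)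
      fix n
      have "\<bar>E (T (v n)) - E (T w)\<bar> / p \<le> M * (\<integral>x. \<bar>T (v n) x - T w x\<bar> \<partial>m)"
        using E_T_diff_le[OF vm(1)[of n] vm(2)] p_pos by (simp add: pos_divide_le_eq mult.commute)
      then have "\<bar>E (T (v n)) / p - E (T w) / p\<bar> \<le> M * (\<integral>x. \<bar>T (v n) x - T w x\<bar> \<partial>m)"
        using p_pos by (simp add: abs_divide flip: diff_divide_distrib)
      then show "\<bar>J (T (v n)) - J (T w)\<bar> \<le> 2 * M * (\<integral>x. \<bar>T (v n) x - T w x\<bar> \<partial>m)"
        using F_integral_diff_le[OF i(1)[of n] i(2)] unfolding J_def by linarith
    qed
  qed (simp add: always_eventually)
  then show ?thesis by (simp add: LIM_zero_iff)
qed

text \<open>Energy bounds give a convergent subsequence, \<open>F\<close> is Lipschitz, and \<open>E\<close> is lower semicontinuous.\<close>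

lemma J_sublevel_compact:
  assumes u: "\<And>n. u n \<in> W" and c: "\<And>n. J (u n) \<le> c n" "c \<longlonglongrightarrow> l"
  obtains r :: "nat \<Rightarrow> nat" and v where "strict_mono r" "v \<in> W" "J v \<le> l" "(\<lambda>n. \<integral>x. \<bar>u (r n) x - v x\<bar> \<partial>m) \<longlonglongrightarrow> 0"
proof -
  obtain C where C: "0 \<le> C" "\<And>u. u \<in> W \<Longrightarrow> E u \<le> 2 * p * (J u + C)" by (rule J_coercive) blast
  obtain B where B: "\<And>n. c n \<le> B"
    using convergent_imp_Bseq[OF convergentI[OF c(2)]] by (auto simp: Bseq_def abs_le_iff)
  have Eb: "E (u n) \<le> 2 * p * (B + C)" for n
  proof -
    have "J (u n) \<le> B" using c(1) B order_trans by blast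
    then have "2 * p * (J (u n) + C) \<le> 2 * p * (B + C)" using p_pos by (intro mult_left_mono) auto
    then show ?thesis using C(2)[OF u[of n]] by linarith
  qed
  obtain r v where r: "strict_mono r" and v: "integrable m v" "\<And>x. x \<notin> \<Omega> \<Longrightarrow> v x = 0"
    and ae: "AE x in m. (\<lambda>n. u (r n) x) \<longlonglongrightarrow> v x" and L1: "(\<lambda>n. \<integral>x. \<bar>u (r n) x - v x\<bar> \<partial>m) \<longlonglongrightarrow> 0"
    by (rule rellich_subsequence[of u, OF u Eb]) (rule that)
  have "(\<lambda>n. (\<integral>x. F (u (r n) x) \<partial>m) - (\<integral>x. F (v x) \<partial>m)) \<longlonglongrightarrow> 0"
  proof (rule tendsto_rabs_zero_cancel, rule tendsto_sandwich[OF _ _ tendsto_const])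
    show "(\<lambda>n. M * (\<integral>x. \<bar>u (r n) x - v x\<bar> \<partial>m)) \<longlonglongrightarrow> 0"
      using tendsto_mult_left[OF L1, of M] by simp
  qed (use F_integral_diff_le[OF W_integrable[OF u] v(1)] in \<open>auto intro: always_eventually\<close>)
  then have F: "(\<lambda>n. \<integral>x. F (u (r n) x) \<partial>m) \<longlonglongrightarrow> (\<integral>x. F (v x) \<partial>m)" by (simp add: LIM_zero_iff)
  have cl: "(\<lambda>n. p * (c (r n) + (\<integral>x. F (u (r n) x) \<partial>m))) \<longlonglongrightarrow> p * (l + (\<integral>x. F (v x) \<partial>m))"
    using LIMSEQ_subseq_LIMSEQ[OF c(2) r] F by (intro tendsto_intros) (auto simp: o_def)
  have Ec: "E (u (r n)) \<le> p * (c (r n) + (\<integral>x. F (u (r n) x) \<partial>m))" for n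
  proof -
    have "E (u (r n)) / p \<le> c (r n) + (\<integral>x. F (u (r n) x) \<partial>m)" using c(1)[of "r n"] by (simp add: J_def)
    then show ?thesis using p_pos by (simp add: pos_divide_le_eq mult.commute)
  qed
  have vW: "v \<in> W" "E v \<le> p * (l + (\<integral>x. F (v x) \<partial>m))"
    using W_fatou[OF u _ v(2) ae Ec cl] v(1) by auto
  then have "E v / p \<le> l + (\<integral>x. F (v x) \<partial>m)" using p_pos by (simp add: pos_divide_le_eq mult.commute)
  then have "J v \<le> l" by (simp add: J_def)
  then show thesis using that r vW(1) L1 by blast
qed

lemma ex_J_minimizer: "\<exists>w\<in>W. \<forall>u\<in>W. J w \<le> J u"
proof -
  obtain C where C: "0 \<le> C" "\<And>u. u \<in> W \<Longrightarrow> E u \<le> 2 * p * (J u + C)" by (rule J_coercive) blast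
  have bdd: "bdd_below (J ` W)"
  proof (rule bdd_belowI2[where m="-C"])
    fix u assume "u \<in> W"
    then have "0 \<le> 2 * p * (J u + C)" using C(2) E_nonneg order_trans by blast
    then show "- C \<le> J u" using p_pos by (simp add: zero_le_mult_iff)
  qed
  define I where "I = (INF u\<in>W. J u)"
  have "\<exists>u\<in>W. J u < I + 1 / real (Suc n)" for n
  proof -
    have "I < I + 1 / real (Suc n)" by simp
    then show ?thesis unfolding I_def using W_zero_fun bdd by (subst (asm) cINF_less_iff) auto
  qed
  then obtain u where u: "\<And>n. u n \<in> W" "\<And>n. J (u n) < I + 1 / real (Suc n)" by metis
  have "(\<lambda>n. I + 1 / real (Suc n)) \<longlonglongrightarrow> I + 0"
    by (intro tendsto_intros LIMSEQ_Suc[OF lim_1_over_n])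
  then have cl: "(\<lambda>n. I + 1 / real (Suc n)) \<longlonglongrightarrow> I" by simp
  have le: "J (u n) \<le> I + 1 / real (Suc n)" for n using u(2) by (rule less_imp_le)
  obtain r :: "nat \<Rightarrow> nat" and v where v: "v \<in> W" "J v \<le> I"
    by (rule J_sublevel_compact[of u, OF u(1) le cl]) (rule that)
  moreover have "I \<le> J u" if "u \<in> W" for u unfolding I_def using bdd that by (rule cINF_lower)
  ultimately show ?thesis by (meson order_trans)
qed

text \<open>
  The functional with reaction frozen at \<open>z\<close> is convex, so its minimality at \<open>z\<close> is equivalent to the weak
  equation. In this form the equation is tested with competitors instead of derivatives of \<open>E\<close>.
\<close>

definition critical :: "('a \<Rightarrow> real) \<Rightarrow> bool" where
  "critical z \<longleftrightarrow> z \<in> W \<and> (\<forall>u\<in>W. Q (\<lambda>x. f (z x)) z \<le> Q (\<lambda>x. f (z x)) u)"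

lemma criticalD:
  assumes "critical z"
  shows "z \<in> W" "u \<in> W \<Longrightarrow> Q (\<lambda>x. f (z x)) z \<le> Q (\<lambda>x. f (z x)) u" "z \<in> borel_measurable m" "source (\<lambda>x. f (z x))"
  using assms W_measurable source_comp by (auto simp: critical_def)

lemma critical_bound: "critical z \<Longrightarrow> AE x in m. \<bar>z x\<bar> \<le> \<delta>"
  by (rule minimizer_bound) (auto dest: criticalD)

lemma critical_minus:
  assumes "critical z"
  shows "critical (\<lambda>x. - z x)"
  unfolding critical_def
proof (intro conjI ballI)
  show "(\<lambda>x. - z x) \<in> W" using assms by (intro W_minus criticalD)
  fix u assume "u \<in> W"
  then show "Q (\<lambda>x. f (- z x)) (\<lambda>x. - z x) \<le> Q (\<lambda>x. f (- z x)) u"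
    using criticalD(2)[OF assms W_minus, of u] Q_minus[of "\<lambda>x. f (z x)" z] Q_minus[of "\<lambda>x. f (z x)" "\<lambda>x. - u x"]
    by (simp add: f_odd)
qed

lemma critical_cong_AE:
  assumes z: "critical z" and v: "v \<in> W" and ae: "AE x in m. v x = z x"
  shows "critical v"
  unfolding critical_def
proof (intro conjI ballI v)
  note vm = W_measurable[OF v] and zm = criticalD(3)[OF z]
  note s = source_comp[OF vm] source_comp[OF zm]
  have aef: "AE x in m. f (v x) = f (z x)" using ae by eventually_elim simp
  fix u assume u: "u \<in> W"
  have "Q (\<lambda>x. f (v x)) v = Q (\<lambda>x. f (z x)) z" by (rule Q_cong_AE[OF s vm zm ae aef])
  also have "\<dots> \<le> Q (\<lambda>x. f (z x)) u" by (rule criticalD(2)[OF z u])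
  also have "\<dots> = Q (\<lambda>x. f (v x)) u"
    by (rule Q_cong_AE[OF s(2,1) W_measurable[OF u] W_measurable[OF u]]) (use aef in \<open>auto elim: eventually_mono\<close>)
  finally show "Q (\<lambda>x. f (v x)) v \<le> Q (\<lambda>x. f (v x)) u" .
qed

lemma critical_of_no_descent:
  assumes v: "v \<in> W" and "J v \<le> J (T v)"
  shows "critical v"
proof -
  have vm: "v \<in> borel_measurable m" by (rule W_measurable[OF v])
  have "\<kappa> * E (\<lambda>x. v x - T v x) \<le> 0" using J_descent[OF v] assms(2) by simp
  then have "E (\<lambda>x. v x - T v x) \<le> 0" using kappa_pos by (simp add: mult_le_0_iff)
  from E_eq_0_AE[OF W_diff[OF v T_W[OF vm]] this] have ae: "AE x in m. v x = T v x" by eventually_elim simp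
  have "Q (\<lambda>x. f (v x)) v = Q (\<lambda>x. f (v x)) (T v)"
    by (rule Q_cong_AE[OF _ _ vm W_measurable[OF T_W[OF vm]] ae]) (use source_comp[OF vm] in auto)
  then show ?thesis using v T_minimal[OF vm] by (simp add: critical_def)
qed

lemma critical_of_minimizer: "v \<in> W \<Longrightarrow> (\<And>u. u \<in> W \<Longrightarrow> J v \<le> J u) \<Longrightarrow> critical v"
  by (rule critical_of_no_descent) (auto intro: T_W W_measurable)

text \<open>
  Compare \<open>z\<close> with \<open>z + t \<psi>\<close>. The tangent inequality at the moved point bounds the increase of the energy by
  \<open>t\<close> times the weak form evaluated there; dividing by \<open>t\<close> and letting \<open>t \<rightarrow> 0\<close> gives one inequality, and
  the test functions \<open>\<phi>\<close> and \<open>- \<phi>\<close> together give the equation.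
\<close>

lemma critical_euler_lagrange:
  assumes z: "critical z" and \<phi>: "\<phi> \<in> W"
  defines "G \<equiv> \<lambda>w. \<bar>z (fst w) - z (snd w)\<bar> powr (p - 2) * (z (fst w) - z (snd w)) * (\<phi> (fst w) - \<phi> (snd w)) * K w"
  shows "integrable (m \<Otimes>\<^sub>M m) G" "(\<integral>w. G w \<partial>(m \<Otimes>\<^sub>M m)) = (\<integral>x. f (z x) * \<phi> x \<partial>m)"
proof -
  have zW: "z \<in> W" by (rule criticalD(1)[OF z])
  have [measurable]: "z \<in> borel_measurable m" "\<phi> \<in> borel_measurable m" using zW \<phi> W_measurable by auto
  define H where "H t \<psi> w = \<bar>z (fst w) - z (snd w) + t * (\<psi> (fst w) - \<psi> (snd w))\<bar> powr (p - 2) *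
     (z (fst w) - z (snd w) + t * (\<psi> (fst w) - \<psi> (snd w))) * (\<psi> (fst w) - \<psi> (snd w)) * K w" for t \<psi> w
  have Hm: "H t \<psi> \<in> borel_measurable (m \<Otimes>\<^sub>M m)" if [measurable]: "\<psi> \<in> borel_measurable m" for t \<psi>
    unfolding H_def by measurable
  have Hb: "\<bar>H t \<psi> w\<bar> \<le> 2 powr p * (gag z w + gag \<psi> w) + gag \<psi> w" if t: "0 \<le> t" "t \<le> 1" for t \<psi> w
  proof -
    let ?a = "z (fst w) - z (snd w)" and ?b = "\<psi> (fst w) - \<psi> (snd w)"
    have "\<bar>\<bar>?a + t * ?b\<bar> powr (p - 2) * (?a + t * ?b) * ?b\<bar> \<le> \<bar>?a + t * ?b\<bar> powr p + \<bar>?b\<bar> powr p"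
      by (rule abs_powr_mult_le[OF p_ge_1])
    also have "\<bar>?a + t * ?b\<bar> powr p \<le> 2 powr p * (\<bar>?a\<bar> powr p + \<bar>t * ?b\<bar> powr p)"
      by (rule abs_powr_sum_le[OF p_ge_1])
    also have "\<bar>t * ?b\<bar> powr p \<le> \<bar>?b\<bar> powr p"
      using t p_pos by (intro powr_mono2) (auto simp: abs_mult mult_left_le_one_le)
    finally have "\<bar>\<bar>?a + t * ?b\<bar> powr (p - 2) * (?a + t * ?b) * ?b\<bar> \<le> 2 powr p * (\<bar>?a\<bar> powr p + \<bar>?b\<bar> powr p) + \<bar>?b\<bar> powr p"
      by simp
    then have "\<bar>\<bar>?a + t * ?b\<bar> powr (p - 2) * (?a + t * ?b) * ?b\<bar> * K w \<le> (2 powr p * (\<bar>?a\<bar> powr p + \<bar>?b\<bar> powr p) + \<bar>?b\<bar> powr p) * K w"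
      by (intro mult_right_mono K_nonneg)
    then show ?thesis unfolding H_def gag_def abs_mult using K_nonneg[of w] by (simp add: algebra_simps)
  qed
  have dom: "integrable (m \<Otimes>\<^sub>M m) (\<lambda>w. 2 powr p * (gag z w + gag \<psi> w) + gag \<psi> w)" if "\<psi> \<in> W" for \<psi>
    using W_integrable_gag[OF zW] W_integrable_gag[OF that] by auto
  have Hi: "integrable (m \<Otimes>\<^sub>M m) (H t \<psi>)" if t: "0 \<le> t" "t \<le> 1" and \<psi>: "\<psi> \<in> W" for t \<psi>
    using Hb[OF t, of \<psi>] Hm[OF W_measurable[OF \<psi>], of t]
    by (intro Bochner_Integration.integrable_bound[OF dom[OF \<psi>]] AE_I2) (auto intro: order_trans[OF _ abs_ge_self])
  have H0: "H 0 \<phi> = G" by (rule ext) (simp add: H_def G_def)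
  show "integrable (m \<Otimes>\<^sub>M m) G" using Hi[of 0 \<phi>] \<phi> H0 by simp
  have key: "(\<integral>x. f (z x) * \<psi> x \<partial>m) \<le> (\<integral>w. H 0 \<psi> w \<partial>(m \<Otimes>\<^sub>M m))" if \<psi>: "\<psi> \<in> W" for \<psi>
  proof -
    have [measurable]: "\<psi> \<in> borel_measurable m" using \<psi> by (rule W_measurable)
    define t where "t n = 1 / real (Suc n)" for n
    have t: "0 < t n" "t n \<le> 1" for n by (auto simp: t_def)
    have t0: "t \<longlonglongrightarrow> 0" unfolding t_def by (rule LIMSEQ_Suc[OF lim_1_over_n])
    have le: "(\<integral>x. f (z x) * \<psi> x \<partial>m) \<le> (\<integral>w. H (t n) \<psi> w \<partial>(m \<Otimes>\<^sub>M m))" for n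
    proof -
      let ?u = "\<lambda>x. z x + t n * \<psi> x"
      have u: "?u \<in> W" by (intro W_add W_scale zW \<psi>)
      have pt: "gag ?u w - gag z w \<le> p * t n * H (t n) \<psi> w" for w
      proof -
        let ?a = "z (fst w) - z (snd w)" and ?b = "\<psi> (fst w) - \<psi> (snd w)"
        have "\<bar>?a + t n * ?b\<bar> powr p + p * (\<bar>?a + t n * ?b\<bar> powr (p - 2) * (?a + t n * ?b)) * (?a - (?a + t n * ?b)) \<le> \<bar>?a\<bar> powr p"
          by (rule abs_powr_tangent[OF p_ge_1])
        then have "\<bar>?a + t n * ?b\<bar> powr p - \<bar>?a\<bar> powr p \<le> p * t n * (\<bar>?a + t n * ?b\<bar> powr (p - 2) * (?a + t n * ?b) * ?b)"
          by (simp add: mult_ac)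
        then have "(\<bar>?a + t n * ?b\<bar> powr p - \<bar>?a\<bar> powr p) * K w \<le> p * t n * (\<bar>?a + t n * ?b\<bar> powr (p - 2) * (?a + t n * ?b) * ?b) * K w"
          by (intro mult_right_mono K_nonneg)
        then have *: "\<bar>?a + t n * ?b\<bar> powr p * K w - \<bar>?a\<bar> powr p * K w \<le> p * t n * (\<bar>?a + t n * ?b\<bar> powr (p - 2) * (?a + t n * ?b) * ?b * K w)"
          by (simp only: left_diff_distrib mult.assoc)
        have e: "?u (fst w) - ?u (snd w) = ?a + t n * ?b" by (simp add: algebra_simps)
        show ?thesis unfolding gag_def H_def e by (rule *)
      qed
      have "E ?u - E z = (\<integral>w. gag ?u w - gag z w \<partial>(m \<Otimes>\<^sub>M m))"
        using W_integrable_gag[OF u] W_integrable_gag[OF zW] by (simp add: E_def)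
      also have "\<dots> \<le> (\<integral>w. p * t n * H (t n) \<psi> w \<partial>(m \<Otimes>\<^sub>M m))"
        using W_integrable_gag[OF u] W_integrable_gag[OF zW] Hi[of "t n", OF _ _ \<psi>] t[of n]
        by (intro integral_mono pt) auto
      finally have 1: "E ?u - E z \<le> p * (t n * (\<integral>w. H (t n) \<psi> w \<partial>(m \<Otimes>\<^sub>M m)))" by (simp add: mult.assoc)
      have "Q (\<lambda>x. f (z x)) z \<le> Q (\<lambda>x. f (z x)) ?u" by (rule criticalD(2)[OF z u])
      moreover have "(\<integral>x. f (z x) * ?u x \<partial>m) = (\<integral>x. f (z x) * z x \<partial>m) + t n * (\<integral>x. f (z x) * \<psi> x \<partial>m)"
      proof -
        have "(\<integral>x. f (z x) * ?u x \<partial>m) = (\<integral>x. f (z x) * z x + t n * (f (z x) * \<psi> x) \<partial>m)"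
          by (rule Bochner_Integration.integral_cong) (auto simp: algebra_simps)
        then show ?thesis using source_integrable[OF criticalD(4)[OF z]] W_integrable[OF zW] W_integrable[OF \<psi>] by simp
      qed
      ultimately have "t n * (\<integral>x. f (z x) * \<psi> x \<partial>m) \<le> (E ?u - E z) / p" by (simp add: Q_def diff_divide_distrib)
      also have "\<dots> \<le> t n * (\<integral>w. H (t n) \<psi> w \<partial>(m \<Otimes>\<^sub>M m))"
        using 1 p_pos by (simp add: pos_divide_le_eq mult_ac)
      finally show ?thesis using t[of n] by simp
    qed
    have "(\<lambda>n. \<integral>w. H (t n) \<psi> w \<partial>(m \<Otimes>\<^sub>M m)) \<longlonglongrightarrow> (\<integral>w. H 0 \<psi> w \<partial>(m \<Otimes>\<^sub>M m))"
    proof (rule integral_dominated_convergence[OF Hm Hm dom[OF \<psi>]])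
      show "AE w in m \<Otimes>\<^sub>M m. (\<lambda>n. H (t n) \<psi> w) \<longlonglongrightarrow> H 0 \<psi> w"
      proof (rule AE_I2)
        fix w
        let ?a = "z (fst w) - z (snd w)" and ?b = "\<psi> (fst w) - \<psi> (snd w)"
        have l: "(\<lambda>n. ?a + t n * ?b) \<longlonglongrightarrow> ?a + 0 * ?b" using t0 by (intro tendsto_intros)
        have "(\<lambda>n. \<bar>?a + t n * ?b\<bar> powr (p - 2) * (?a + t n * ?b)) \<longlonglongrightarrow> \<bar>?a + 0 * ?b\<bar> powr (p - 2) * (?a + 0 * ?b)"
        proof (cases "?a = 0")
          case False
          then show ?thesis using l by (intro tendsto_mult tendsto_powr tendsto_rabs tendsto_const) auto
        next
          case True
          have e: "\<bar>\<bar>y\<bar> powr (p - 2) * y\<bar> = \<bar>y\<bar> powr (p - 1)" for y :: real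
            by (cases "y = 0") (auto simp: abs_mult powr_mult_base mult.commute)
          have z: "?a + 0 * ?b = 0" "\<bar>0 :: real\<bar> powr (p - 1) = 0" using True by auto
          have "(\<lambda>n. \<bar>?a + t n * ?b\<bar> powr (p - 1)) \<longlonglongrightarrow> \<bar>0\<bar> powr (p - 1)"
            using p_gt_1 by (intro tendsto_powr2 tendsto_rabs l[unfolded z] tendsto_const always_eventually) auto
          then have "(\<lambda>n. \<bar>\<bar>?a + t n * ?b\<bar> powr (p - 2) * (?a + t n * ?b)\<bar>) \<longlonglongrightarrow> 0"
            unfolding e z(2) .
          then have "(\<lambda>n. \<bar>?a + t n * ?b\<bar> powr (p - 2) * (?a + t n * ?b)) \<longlonglongrightarrow> 0"
            by (rule tendsto_rabs_zero_cancel)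
          then show ?thesis unfolding z(1) by simp
        qed
        then show "(\<lambda>n. H (t n) \<psi> w) \<longlonglongrightarrow> H 0 \<psi> w" unfolding H_def by (rule tendsto_mult[OF tendsto_mult[OF _ tendsto_const] tendsto_const])
      qed
      show "AE w in m \<Otimes>\<^sub>M m. norm (H (t n) \<psi> w) \<le> 2 powr p * (gag z w + gag \<psi> w) + gag \<psi> w" for n
        using Hb[of "t n" \<psi>] t[of n] by (intro AE_I2) auto
    qed auto
    then show ?thesis by (rule LIMSEQ_le_const) (use le in auto)
  qed
  have "(\<integral>x. f (z x) * \<phi> x \<partial>m) \<le> (\<integral>w. G w \<partial>(m \<Otimes>\<^sub>M m))" using key[OF \<phi>] H0 by simp
  moreover have "H 0 (\<lambda>x. - \<phi> x) w = - G w" for w by (simp add: H_def G_def algebra_simps)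
  then have "(\<integral>w. G w \<partial>(m \<Otimes>\<^sub>M m)) \<le> (\<integral>x. f (z x) * \<phi> x \<partial>m)" using key[OF W_minus[OF \<phi>]] by simp
  ultimately show "(\<integral>w. G w \<partial>(m \<Otimes>\<^sub>M m)) = (\<integral>x. f (z x) * \<phi> x \<partial>m)" by simp
qed

end

section \<open>Non-negative critical points\<close>

text \<open>
  The assumption \<open>f_decr\<close> expresses sublinearity with respect to the energy, and \<open>F_lower\<close> makes \<open>J\<close> negative
  near zero. The bump \<open>\<eta>\<close> tests positivity in \<open>\<Omega>\<close>; the disjoint bumps \<open>\<phi>1\<close> and \<open>\<phi>2\<close> span a path of negative energy.
\<close>

locale sublinear_reaction = reaction +
  fixes \<eta> \<phi>1 \<phi>2 :: "'a \<Rightarrow> real" and \<rho> a B :: real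
  assumes f_pos: "0 < t \<Longrightarrow> 0 < f t"
    and f_decr: "0 < s \<Longrightarrow> s < t \<Longrightarrow> f t / t powr (p - 1) < f s / s powr (p - 1)"
    and F_lower: "\<bar>t\<bar> \<le> \<delta> \<Longrightarrow> a * \<bar>t\<bar> powr \<rho> \<le> F t"
    and a_pos: "0 < a" and rho: "0 < \<rho>" "\<rho> < p" and B_pos: "0 < B"
    and eta_W: "\<eta> \<in> W" and eta: "0 \<le> \<eta> x" "\<eta> x \<le> B" "x \<in> \<Omega> \<Longrightarrow> 0 < \<eta> x"
    and phi_W: "\<phi>1 \<in> W" "\<phi>2 \<in> W"
    and phi: "0 \<le> \<phi>1 x" "\<phi>1 x \<le> B" "0 \<le> \<phi>2 x" "\<phi>2 x \<le> B" "\<phi>1 x * \<phi>2 x = 0"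
    and phi_nz: "\<not> (AE x in m. \<phi>1 x = 0)" "\<not> (AE x in m. \<phi>2 x = 0)"
begin

lemma f_nonneg: "0 \<le> t \<Longrightarrow> 0 \<le> f t"
  using f_pos[of t] f_odd[of 0] by (cases "t = 0") (auto intro: less_imp_le)

lemma W_max_min:
  assumes u: "u \<in> W" "v \<in> W"
  shows "(\<lambda>x. max (u x) (v x)) \<in> W" "(\<lambda>x. min (u x) (v x)) \<in> W"
proof -
  have [measurable]: "u \<in> borel_measurable m" "v \<in> borel_measurable m" using u W_measurable by auto
  have *: "\<bar>max (u x) (v x) - max (u y) (v y)\<bar> powr p \<le> 1 * \<bar>u x - u y\<bar> powr p + 1 * \<bar>v x - v y\<bar> powr p"
     "\<bar>min (u x) (v x) - min (u y) (v y)\<bar> powr p \<le> 1 * \<bar>u x - u y\<bar> powr p + 1 * \<bar>v x - v y\<bar> powr p" for x y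
    using abs_powr_submodular[OF p_ge_1, of "u x" "v x" "u y" "v y"] powr_ge_zero by (smt (verit))+
  show "(\<lambda>x. max (u x) (v x)) \<in> W" by (rule W_dominated(1)[OF _ _ u *(1)]) (use u[THEN W_zero] in auto)
  show "(\<lambda>x. min (u x) (v x)) \<in> W" by (rule W_dominated(1)[OF _ _ u *(2)]) (use u[THEN W_zero] in auto)
qed

text \<open>
  Suppose that \<open>z\<close> vanishes on a set \<open>A\<close> of positive measure in \<open>\<Omega>\<close> and exceeds \<open>\<sigma>\<close> on a set \<open>S\<close> of positive measure.
  The competitor \<open>max z (t \<eta>)\<close> raises the function only where this pays in the linear term. By submodularity
  its energy is at most \<open>E z + t powr p * E \<eta>\<close> minus a first-order gain from the pairs in \<open>A \<times> S\<close>, which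
  contradicts minimality for small \<open>t\<close>.
\<close>

lemma strong_maximum_principle:
  assumes z: "critical z" and nn: "\<And>x. 0 \<le> z x" and nz: "\<not> (AE x in m. z x = 0)"
  shows "AE x in m. x \<in> \<Omega> \<longrightarrow> 0 < z x"
proof (rule ccontr)
  assume not: "\<not> (AE x in m. x \<in> \<Omega> \<longrightarrow> 0 < z x)"
  have zW: "z \<in> W" by (rule criticalD(1)[OF z])
  have [measurable]: "z \<in> borel_measurable m" "\<eta> \<in> borel_measurable m" using zW eta_W W_measurable by auto
  define A where "A = {x. x \<in> \<Omega> \<and> z x = 0}"
  have [measurable]: "A \<in> sets m"
  proof -
    have "{x \<in> space m. x \<in> \<Omega> \<and> z x = 0} \<in> sets m" by measurable
    then show ?thesis by (simp add: A_def)
  qed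
  have A: "emeasure m A \<noteq> 0"
  proof
    assume "emeasure m A = 0"
    then have "AE x in m. x \<notin> A" by (intro AE_not_in) (auto simp: null_sets_def)
    then have "AE x in m. x \<in> \<Omega> \<longrightarrow> 0 < z x"
      by eventually_elim (use nn in \<open>force simp: A_def less_le\<close>)
    with not show False by simp
  qed
  have "\<exists>n. \<not> (AE x in m. z x < 1 / real (Suc n))"
  proof (rule ccontr)
    assume "\<not> ?thesis"
    then have "AE x in m. \<forall>n. z x < 1 / real (Suc n)" by (simp add: AE_all_countable)
    then have "AE x in m. z x = 0"
    proof eventually_elim
      case (elim x)
      have "z x \<le> 0" by (rule LIMSEQ_le_const[OF LIMSEQ_Suc[OF lim_1_over_n]]) (use elim in \<open>auto intro!: exI[of _ 0] less_imp_le\<close>)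
      with nn[of x] show ?case by simp
    qed
    with nz show False by simp
  qed
  then obtain n where n: "\<not> (AE x in m. z x < 1 / real (Suc n))" by blast
  define \<sigma> where "\<sigma> = 1 / real (Suc n)"
  have \<sigma>: "0 < \<sigma>" by (simp add: \<sigma>_def)
  define S where "S = {x. \<sigma> \<le> z x}"
  have [measurable]: "S \<in> sets m"
  proof -
    have "{x \<in> space m. \<sigma> \<le> z x} \<in> sets m" by measurable
    then show ?thesis by (simp add: S_def)
  qed
  have S: "emeasure m S \<noteq> 0"
  proof
    assume "emeasure m S = 0"
    then have "AE x in m. x \<notin> S" by (intro AE_not_in) (auto simp: null_sets_def)
    then have "AE x in m. z x < \<sigma>" by eventually_elim (auto simp: S_def)
    with n show False by (simp add: \<sigma>_def)
  qed
  define s' where "s' = \<sigma> powr (p - 1) / 2"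
  have s': "0 < s'" using \<sigma> by (simp add: s'_def)
  \<comment> \<open>The largest bound for \<open>t \<eta>\<close> that \<open>abs_powr_submodular_gain\<close> admits.\<close>
  define \<tau> where "\<tau> = min \<sigma> ((s' / p) powr (1 / (p - 1)))"
  have \<tau>: "0 < \<tau>" "\<tau> \<le> \<sigma>" using \<sigma> s' p_pos by (auto simp: \<tau>_def)
  have \<tau>2: "p * \<tau> powr (p - 1) \<le> s'"
  proof -
    have "\<tau> powr (p - 1) \<le> ((s' / p) powr (1 / (p - 1))) powr (p - 1)"
      using \<tau> p_gt_1 by (intro powr_mono2) (auto simp: \<tau>_def)
    also have "\<dots> = s' / p" using p_gt_1 s' by (simp add: powr_powr)
    finally show ?thesis using p_pos by (simp add: field_simps)
  qed
  define G where "G w = indicator (A \<times> S) w * (\<eta> (fst w) * K w)" for w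
  have Gm: "G \<in> borel_measurable (m \<Otimes>\<^sub>M m)" unfolding G_def by measurable
  have Gnn: "0 \<le> G w" for w by (simp add: G_def eta K_nonneg)
  let ?U = "\<lambda>t x. max (z x) (t * \<eta> x)" and ?V = "\<lambda>t x. min (z x) (t * \<eta> x)"
  have key: "gag (?U t) w + gag (?V t) w + t * s' * G w \<le> gag z w + gag (\<lambda>x. t * \<eta> x) w"
    if t: "0 < t" "t * B \<le> \<tau>" for t w
  proof -
    let ?x = "fst w" and ?y = "snd w"
    have *: "\<bar>max (z ?x) (t * \<eta> ?x) - max (z ?y) (t * \<eta> ?y)\<bar> powr p + \<bar>min (z ?x) (t * \<eta> ?x) - min (z ?y) (t * \<eta> ?y)\<bar> powr p
        + t * \<eta> ?x * s' * indicator (A \<times> S) w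
        \<le> \<bar>z ?x - z ?y\<bar> powr p + \<bar>t * \<eta> ?x - t * \<eta> ?y\<bar> powr p"
    proof (cases "w \<in> A \<times> S")
      case True
      then have "z ?x = 0" "\<sigma> \<le> z ?y" by (auto simp: A_def S_def)
      moreover have "0 \<le> t * \<eta> x" "t * \<eta> x \<le> t * B" for x using t eta by (auto intro!: mult_left_mono)
      then have "0 \<le> t * \<eta> x" "t * \<eta> x \<le> \<tau>" for x using t(2) by (auto intro: order_trans)
      ultimately have "\<bar>max 0 (t * \<eta> ?x) - max (z ?y) (t * \<eta> ?y)\<bar> powr p + \<bar>min 0 (t * \<eta> ?x) - min (z ?y) (t * \<eta> ?y)\<bar> powr p
        + t * \<eta> ?x * (\<sigma> powr (p - 1) / 2) \<le> \<bar>0 - z ?y\<bar> powr p + \<bar>t * \<eta> ?x - t * \<eta> ?y\<bar> powr p"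
        using \<sigma> \<tau> \<tau>2 p_ge_2 by (intro abs_powr_submodular_gain[where B=\<tau>]) (auto simp: s'_def)
      then show ?thesis using True \<open>z ?x = 0\<close> by (simp add: s'_def)
    next
      case False
      then have "indicator (A \<times> S) w = (0 :: real)" by simp
      with abs_powr_submodular[OF p_ge_1, of "z ?x" "t * \<eta> ?x" "z ?y" "t * \<eta> ?y"] show ?thesis
        by (simp only: mult_zero_right add_0_right)
    qed
    show ?thesis using mult_right_mono[OF * K_nonneg[of w]] unfolding gag_def G_def by (simp only: distrib_left distrib_right mult_ac)
  qed
  have Gi: "integrable (m \<Otimes>\<^sub>M m) G"
  proof -
    define t where "t = \<tau> / B"
    have t: "0 < t" "t * B \<le> \<tau>" using \<tau> B_pos by (auto simp: t_def)
    have te: "(\<lambda>x. t * \<eta> x) \<in> W" by (intro W_scale eta_W)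
    have i: "integrable (m \<Otimes>\<^sub>M m) (\<lambda>w. (gag z w + gag (\<lambda>x. t * \<eta> x) w) / (t * s'))"
      using W_integrable_gag[OF zW] W_integrable_gag[OF te] by simp
    show ?thesis
    proof (rule Bochner_Integration.integrable_bound[OF i Gm], rule AE_I2)
      fix w
      have "t * s' * G w \<le> gag z w + gag (\<lambda>x. t * \<eta> x) w"
        using key[OF t, of w] gag_nonneg[of "?U t" w] gag_nonneg[of "?V t" w] by linarith
      then have "G w \<le> (gag z w + gag (\<lambda>x. t * \<eta> x) w) / (t * s')"
        using t s' by (simp add: pos_le_divide_eq mult_ac)
      then have "\<bar>G w\<bar> \<le> (gag z w + gag (\<lambda>x. t * \<eta> x) w) / (t * s')" using Gnn[of w] by linarith
      then show "norm (G w) \<le> norm ((gag z w + gag (\<lambda>x. t * \<eta> x) w) / (t * s'))"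
        unfolding real_norm_def by (rule order_trans[OF _ abs_ge_self])
    qed
  qed
  define I where "I = (\<integral>w. G w \<partial>(m \<Otimes>\<^sub>M m))"
  have le: "s' * I \<le> t powr (p - 1) * E \<eta>" if t: "0 < t" "t * B \<le> \<tau>" for t
  proof -
    have te: "(\<lambda>x. t * \<eta> x) \<in> W" by (intro W_scale eta_W)
    note UV = W_max_min[OF zW te]
    note i = W_integrable_gag[OF UV(1)] W_integrable_gag[OF UV(2)] W_integrable_gag[OF zW] W_integrable_gag[OF te]
    have "E (?U t) + E (?V t) + t * s' * I = (\<integral>w. gag (?U t) w + gag (?V t) w + t * s' * G w \<partial>(m \<Otimes>\<^sub>M m))"
      using i Gi by (simp add: E_def I_def)
    also have "\<dots> \<le> (\<integral>w. gag z w + gag (\<lambda>x. t * \<eta> x) w \<partial>(m \<Otimes>\<^sub>M m))"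
      using i Gi by (intro integral_mono key t) auto
    also have "\<dots> = E z + t powr p * E \<eta>" using i t E_scale[of t \<eta>] by (simp add: E_def)
    finally have 1: "E (?U t) + E (?V t) + t * s' * I \<le> E z + t powr p * E \<eta>" .
    note s = source_integrable[OF criticalD(4)[OF z]]
    have "(\<integral>x. f (z x) * z x \<partial>m) \<le> (\<integral>x. f (z x) * ?U t x \<partial>m)"
      using s W_integrable UV zW nn f_nonneg by (intro integral_mono mult_left_mono) auto
    moreover have "Q (\<lambda>x. f (z x)) z \<le> Q (\<lambda>x. f (z x)) (?U t)" by (rule criticalD(2)[OF z UV(1)])
    ultimately have "E z / p \<le> E (?U t) / p" unfolding Q_def by linarith
    then have "E z \<le> E (?U t)" using p_pos by (simp add: divide_le_cancel)
    then have "t * s' * I \<le> t powr p * E \<eta>" using 1 E_nonneg[of "?V t"] by linarith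
    moreover have "t powr p = t * t powr (p - 1)" using t by (simp add: powr_mult_base)
    ultimately have "t * (s' * I) \<le> t * (t powr (p - 1) * E \<eta>)" by (simp only: mult.assoc)
    then show ?thesis using t by simp
  qed
  have "(\<lambda>n. (\<tau> / B * (1 / real (Suc n))) powr (p - 1) * E \<eta>) \<longlonglongrightarrow> (\<tau> / B * 0) powr (p - 1) * E \<eta>"
    using p_gt_1 \<tau> B_pos by (intro tendsto_mult tendsto_const tendsto_powr2 LIMSEQ_Suc[OF lim_1_over_n]) (auto intro!: always_eventually)
  then have "s' * I \<le> (\<tau> / B * 0) powr (p - 1) * E \<eta>"
  proof (rule LIMSEQ_le_const, intro exI allI impI)
    fix n
    have "1 / real (Suc n) \<le> 1" by simp
    then have "\<tau> * (1 / real (Suc n)) \<le> \<tau> * 1" using \<tau> by (intro mult_left_mono) auto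
    then show "s' * I \<le> (\<tau> / B * (1 / real (Suc n))) powr (p - 1) * E \<eta>"
      using \<tau> B_pos by (intro le) auto
  qed
  then have "I \<le> 0" using s' by (simp add: mult_le_0_iff)
  then have "I = 0" using Gnn by (auto simp: I_def intro!: antisym integral_nonneg_AE)
  then have "AE w in m \<Otimes>\<^sub>M m. G w = 0"
    unfolding I_def using Gi Gnn by (subst (asm) integral_nonneg_eq_0_iff_AE) auto
  then have "AE w in m \<Otimes>\<^sub>M m. w \<notin> A \<times> S"
  proof eventually_elim
    case (elim w)
    show ?case
    proof
      assume w: "w \<in> A \<times> S"
      then have "fst w \<noteq> snd w" "fst w \<in> \<Omega>" using \<sigma> by (auto simp: A_def S_def)
      then have "0 < \<eta> (fst w) * K w" using eta(3)[of "fst w"] K_pos[of "fst w" "snd w"] by simp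
      moreover have "\<eta> (fst w) * K w = 0" using w elim by (simp add: G_def)
      ultimately show False by simp
    qed
  qed
  then have "emeasure (m \<Otimes>\<^sub>M m) (A \<times> S) = 0"
    by (subst (asm) AE_iff_measurable[OF _ refl]) (auto simp: space_pair_measure)
  then have "emeasure m A * emeasure m S = 0" by (simp add: emeasure_pair_measure_Times)
  with A S show False by simp
qed

text \<open>Equivalently, \<open>F\<close> is strictly concave as a function of the \<open>p\<close>-th power of its argument.\<close>

lemma F_picone:
  assumes z: "0 < z" and w: "0 \<le> w" "w \<noteq> z"
  shows "F w - F z < f z * ((w powr p - z powr p) / (p * z powr (p - 1)))"
proof -
  define H where "H s = f z * ((s powr p - z powr p) / (p * z powr (p - 1))) - F s" for s
  have H': "(H has_real_derivative (f z / z powr (p - 1) * s powr (p - 1) - f s)) (at s)" if "0 < s" for s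
    unfolding H_def using that z p_pos by (auto intro!: derivative_eq_intros F_deriv)
  have F_cont: "continuous_on A F" for A
    by (intro continuous_at_imp_continuous_on ballI DERIV_isCont[OF F_deriv])
  have Hc: "continuous_on {x..y} H" if "0 \<le> x" for x y
    unfolding H_def using that p_pos z by (intro continuous_intros continuous_on_powr' F_cont) auto
  have "H z < H w"
  proof (cases "z < w")
    case True
    show ?thesis
    proof (rule DERIV_pos_imp_increasing_open[OF True])
      fix s assume s: "z < s" "s < w"
      have "f s < f z / z powr (p - 1) * s powr (p - 1)" using f_decr[OF z s(1)] z s by (simp add: pos_divide_less_eq)
      then show "\<exists>y. DERIV H s :> y \<and> 0 < y" using H'[of s] z s by (intro exI[of _ "f z / z powr (p - 1) * s powr (p - 1) - f s"] conjI) auto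
    qed (use Hc z in auto)
  next
    case False
    then have wz: "w < z" using w by simp
    show ?thesis
    proof (rule DERIV_neg_imp_decreasing_open[OF wz])
      fix s assume s: "w < s" "s < z"
      then have "f z / z powr (p - 1) * s powr (p - 1) < f s" using f_decr[of s z] w by (simp add: pos_less_divide_eq)
      then show "\<exists>y. DERIV H s :> y \<and> y < 0" using H'[of s] w s by (intro exI[of _ "f z / z powr (p - 1) * s powr (p - 1) - f s"] conjI) auto
    qed (use Hc w in auto)
  qed
  then show ?thesis by (simp add: H_def)
qed

text \<open>
  Use \<open>pmean p t z w\<close> as competitor for \<open>z\<close>, divide by \<open>t\<close> and let \<open>t \<rightarrow> 0\<close>. The energies contribute at most
  \<open>(E w - E z) / p\<close> by hidden convexity. The linear terms converge pointwise to the right-hand side of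
  \<open>F_picone\<close>, because \<open>z > 0\<close> in \<open>\<Omega>\<close>; they are bounded below by the integrable function \<open>f z * (w - z)\<close>, so that
  Fatou's lemma applies.
\<close>

lemma nonneg_critical_minimal:
  assumes z: "critical z" and znn: "\<And>x. 0 \<le> z x" and nz: "\<not> (AE x in m. z x = 0)"
    and w: "w \<in> W" and wnn: "\<And>x. 0 \<le> w x"
  shows "J z \<le> J w" "J w \<le> J z \<Longrightarrow> AE x in m. w x = z x"
proof -
  have zW: "z \<in> W" by (rule criticalD(1)[OF z])
  have [measurable]: "z \<in> borel_measurable m" "w \<in> borel_measurable m" using zW w W_measurable by auto
  note s = source_integrable[OF criticalD(4)[OF z]]
  define t where "t n = 1 / real (Suc n)" for n
  have t: "0 < t n" "t n \<le> 1" for n by (auto simp: t_def)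
  have t0: "t \<longlonglongrightarrow> 0" unfolding t_def by (rule LIMSEQ_Suc[OF lim_1_over_n])
  define g where "g n x = f (z x) * ((pmean p (t n) (z x) (w x) - z x) / t n)" for n x
  define gl where "gl x = (if 0 < z x then f (z x) * ((w x powr p - z x powr p) / (p * z x powr (p - 1))) else 0)" for x
  define b where "b x = f (z x) * (w x - z x)" for x
  define c where "c = (E w - E z) / p"
  have bi: "integrable m b" unfolding b_def using s W_integrable[OF w] W_integrable[OF zW] by simp
  have [measurable]: "g n \<in> borel_measurable m" for n unfolding g_def pmean_def by measurable
  have [measurable]: "b \<in> borel_measurable m" using bi by auto
  have [measurable]: "gl \<in> borel_measurable m" unfolding gl_def by measurable
  have gi: "integrable m (g n)" "(\<integral>x. g n x \<partial>m) \<le> c" for n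
  proof -
    let ?u = "\<lambda>x. pmean p (t n) (z x) (w x)"
    have d: "\<bar>?u x - ?u y\<bar> powr p \<le> (1 - t n) * \<bar>z x - z y\<bar> powr p + t n * \<bar>w x - w y\<bar> powr p" for x y
      using t[of n] p_ge_1 znn wnn by (intro pmean_diff) auto
    have um: "?u \<in> borel_measurable m" unfolding pmean_def by measurable
    have u0: "?u x = 0" if "x \<notin> \<Omega>" for x using W_zero[OF zW that] W_zero[OF w that] by (simp add: pmean_def)
    note u = W_dominated[OF um u0 zW w d]
    have ui: "integrable m (\<lambda>x. f (z x) * (?u x - z x))" using s W_integrable[OF u(1)] W_integrable[OF zW] by simp
    have geq: "g n = (\<lambda>x. 1 / t n * (f (z x) * (?u x - z x)))" by (simp add: g_def fun_eq_iff)
    show "integrable m (g n)" unfolding geq using ui by (rule integrable_mult_right)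
    have "Q (\<lambda>x. f (z x)) z \<le> Q (\<lambda>x. f (z x)) ?u" by (rule criticalD(2)[OF z u(1)])
    moreover have "(\<integral>x. f (z x) * (?u x - z x) \<partial>m) = (\<integral>x. f (z x) * ?u x \<partial>m) - (\<integral>x. f (z x) * z x \<partial>m)"
      using s W_integrable[OF u(1)] W_integrable[OF zW] by (simp add: right_diff_distrib)
    ultimately have "(\<integral>x. f (z x) * (?u x - z x) \<partial>m) \<le> (E ?u - E z) / p" by (simp add: Q_def diff_divide_distrib)
    also have "\<dots> \<le> (t n * (E w - E z)) / p" using u(2) p_pos by (intro divide_right_mono) (auto simp: algebra_simps)
    finally have "(\<integral>x. f (z x) * (?u x - z x) \<partial>m) \<le> t n * c" by (simp add: c_def)
    then have "1 / t n * (\<integral>x. f (z x) * (?u x - z x) \<partial>m) \<le> c" using t[of n] by (simp add: field_simps)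
    then show "(\<integral>x. g n x \<partial>m) \<le> c" unfolding geq by simp
  qed
  have gb: "b x \<le> g n x" for n x
    unfolding b_def g_def using t[of n] p_ge_1 znn wnn f_nonneg by (intro mult_left_mono pmean_difference_quotient_ge) auto
  have lim: "AE x in m. (\<lambda>n. g n x) \<longlonglongrightarrow> gl x"
    using strong_maximum_principle[OF z znn nz]
  proof eventually_elim
    case (elim x)
    show ?case
    proof (cases "0 < z x")
      case True
      have ft: "filterlim t (at_right 0) sequentially"
        unfolding filterlim_at using t t0 by (auto intro!: always_eventually simp: less_imp_neq[symmetric])
      show ?thesis unfolding g_def gl_def if_P[OF True]
        by (intro tendsto_mult tendsto_const filterlim_compose[OF pmean_difference_quotient_tendsto ft] True wnn p_ge_1)
    next
      case False
      then have "z x = 0" using znn[of x] by simp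
      then show ?thesis using f_odd[of 0] by (simp add: g_def gl_def)
    qed
  qed
  have glb: "AE x in m. b x \<le> gl x"
    using lim by eventually_elim (rule LIMSEQ_le_const, use gb in auto)
  have cb: "0 \<le> c - (\<integral>x. b x \<partial>m)"
    using integral_mono[OF bi gi(1)[of 0] gb] gi(2)[of 0] by simp
  have "(\<integral>\<^sup>+ x. ennreal (gl x - b x) \<partial>m) \<le> (\<integral>\<^sup>+ x. liminf (\<lambda>n. ennreal (g n x - b x)) \<partial>m)"
  proof (rule nn_integral_mono_AE)
    show "AE x in m. ennreal (gl x - b x) \<le> liminf (\<lambda>n. ennreal (g n x - b x))"
      using lim
    proof eventually_elim
      case (elim x)
      then have "liminf (\<lambda>n. ennreal (g n x - b x)) = ennreal (gl x - b x)"
        by (intro lim_imp_Liminf tendsto_ennrealI tendsto_diff) auto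
      then show ?case by simp
    qed
  qed
  also have "\<dots> \<le> liminf (\<lambda>n. (\<integral>\<^sup>+ x. ennreal (g n x - b x) \<partial>m))"
    using bi by (intro nn_integral_liminf) measurable
  also have "\<dots> \<le> liminf (\<lambda>n. ennreal (c - (\<integral>x. b x \<partial>m)))"
  proof (intro Liminf_mono always_eventually allI)
    fix n
    have "(\<integral>\<^sup>+ x. ennreal (g n x - b x) \<partial>m) = ennreal (\<integral>x. g n x - b x \<partial>m)"
      using gi(1)[of n] bi gb by (intro nn_integral_eq_integral) auto
    also have "\<dots> \<le> ennreal (c - (\<integral>x. b x \<partial>m))" using gi[of n] bi by (intro ennreal_leI) simp
    finally show "(\<integral>\<^sup>+ x. ennreal (g n x - b x) \<partial>m) \<le> ennreal (c - (\<integral>x. b x \<partial>m))" .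
  qed
  also have "\<dots> = ennreal (c - (\<integral>x. b x \<partial>m))" by (intro lim_imp_Liminf tendsto_const) auto
  finally have fat: "(\<integral>\<^sup>+ x. ennreal (gl x - b x) \<partial>m) \<le> ennreal (c - (\<integral>x. b x \<partial>m))" .
  have di: "integrable m (\<lambda>x. gl x - b x)"
    using bi glb fat by (intro integrableI_nonneg) (auto elim: eventually_mono intro: le_less_trans)
  have "ennreal (\<integral>x. gl x - b x \<partial>m) \<le> ennreal (c - (\<integral>x. b x \<partial>m))"
    using fat di glb by (subst (asm) nn_integral_eq_integral) (auto elim: eventually_mono)
  then have dle: "(\<integral>x. gl x - b x \<partial>m) \<le> c - (\<integral>x. b x \<partial>m)" using cb by (simp add: ennreal_le_iff)
  have gli: "integrable m gl" using Bochner_Integration.integrable_add[OF di bi] by simp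
  have glc: "(\<integral>x. gl x \<partial>m) \<le> c" using dle gli bi by simp
  let ?D = "\<lambda>x. gl x - (F (w x) - F (z x))"
  have Fi: "integrable m (\<lambda>x. F (w x) - F (z x))" using F_comp_integrable W_integrable zW w by simp
  have Dpos: "AE x in m. 0 \<le> ?D x \<and> (w x \<noteq> z x \<longrightarrow> 0 < ?D x)"
    using strong_maximum_principle[OF z znn nz]
  proof eventually_elim
    case (elim x)
    show ?case
    proof (cases "x \<in> \<Omega>")
      case True
      then show ?thesis using elim F_picone[of "z x" "w x"] wnn[of x] by (cases "w x = z x") (auto simp: gl_def)
    next
      case False
      then show ?thesis using W_zero[OF zW False] W_zero[OF w False] by (simp add: gl_def)
    qed
  qed
  have Di: "integrable m ?D" using gli Fi by simp
  have "(\<integral>x. ?D x \<partial>m) = (\<integral>x. gl x \<partial>m) - ((\<integral>x. F (w x) \<partial>m) - (\<integral>x. F (z x) \<partial>m))"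
    using gli Fi F_comp_integrable[OF W_integrable[OF zW]] F_comp_integrable[OF W_integrable[OF w]] by simp
  also have "\<dots> \<le> J w - J z" using glc by (simp add: J_def c_def diff_divide_distrib)
  finally have DJ: "(\<integral>x. ?D x \<partial>m) \<le> J w - J z" .
  have D0: "0 \<le> (\<integral>x. ?D x \<partial>m)" by (rule integral_nonneg_AE) (use Dpos in \<open>auto elim: eventually_mono\<close>)
  show "J z \<le> J w" using DJ D0 by simp
  assume "J w \<le> J z"
  then have "(\<integral>x. ?D x \<partial>m) = 0" using DJ D0 by simp
  then have "AE x in m. ?D x = 0"
    using Di Dpos by (subst (asm) integral_nonneg_eq_0_iff_AE) (auto elim: eventually_mono)
  then show "AE x in m. w x = z x" using Dpos by eventually_elim force
qed

end

section \<open>A mountain pass along a discrete descent\<close>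

lemma abs_abs_diff_le: "\<bar>\<bar>a - c\<bar> - \<bar>b - c\<bar>\<bar> \<le> \<bar>a - b\<bar>" for a b c :: real
proof -
  have "\<bar>\<bar>a - c\<bar> - \<bar>b - c\<bar>\<bar> \<le> \<bar>(a - c) - (b - c)\<bar>" by (rule abs_triangle_ineq3)
  also have "(a - c) - (b - c) = a - b" by (simp only: diff_diff_eq2 diff_add_cancel)
  finally show ?thesis .
qed

context sublinear_reaction
begin

text \<open>The end points \<open>t = 1\<close> and \<open>t = - 1\<close> are opposite multiples of \<open>\<phi>1\<close>; the detour through \<open>\<phi>2\<close> avoids the origin.\<close>

definition bump_path :: "real \<Rightarrow> real \<Rightarrow> 'a \<Rightarrow> real" where
  "bump_path r t x = r * (t * \<phi>1 x + (1 - \<bar>t\<bar>) * \<phi>2 x)"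

lemma bump_path_W: "bump_path r t \<in> W"
  unfolding bump_path_def[abs_def] by (intro W_scale W_lincomb phi_W)

lemma bump_path_minus: "bump_path r (- 1) x = - bump_path r 1 x"
  by (simp add: bump_path_def)

lemma phi_powr_integral_pos:
  assumes "\<phi> \<in> W" "\<And>x. 0 \<le> \<phi> x" "\<And>x. \<phi> x \<le> B" "\<not> (AE x in m. \<phi> x = 0)"
  shows "integrable m (\<lambda>x. \<phi> x powr \<rho>)" "0 < (\<integral>x. \<phi> x powr \<rho> \<partial>m)"
proof -
  have [measurable]: "\<phi> \<in> borel_measurable m" using assms(1) by (rule W_measurable)
  show i: "integrable m (\<lambda>x. \<phi> x powr \<rho>)"
    using assms W_zero[OF assms(1)] rho by (intro integrable_bounded_on_Omega[where C="B powr \<rho>"]) (auto intro: powr_mono2)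
  have "(\<integral>x. \<phi> x powr \<rho> \<partial>m) \<noteq> 0"
  proof
    assume "(\<integral>x. \<phi> x powr \<rho> \<partial>m) = 0"
    then have "AE x in m. \<phi> x powr \<rho> = 0" using i by (subst (asm) integral_nonneg_eq_0_iff_AE) auto
    with assms(4) show False by simp
  qed
  moreover have "0 \<le> (\<integral>x. \<phi> x powr \<rho> \<partial>m)" by (rule integral_nonneg_AE) simp
  ultimately show "0 < (\<integral>x. \<phi> x powr \<rho> \<partial>m)" by (simp add: less_le)
qed

text \<open>
  At every \<open>t\<close> one of the two bumps has a coefficient of modulus at least \<open>1 / 2\<close>. So the integral of \<open>F\<close> is at
  least of order \<open>r powr \<rho>\<close>, while the energy is of order \<open>r powr p\<close> with \<open>p > \<rho>\<close>.
\<close>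

lemma ex_negative_path: "\<exists>r. \<forall>t. \<bar>t\<bar> \<le> 1 \<longrightarrow> J (bump_path r t) < 0"
proof -
  note I1 = phi_powr_integral_pos[OF phi_W(1) phi(1,2) phi_nz(1)]
  note I2 = phi_powr_integral_pos[OF phi_W(2) phi(3,4) phi_nz(2)]
  define I where "I = min (\<integral>x. \<phi>1 x powr \<rho> \<partial>m) (\<integral>x. \<phi>2 x powr \<rho> \<partial>m)"
  have I: "0 < I" using I1 I2 by (simp add: I_def)
  define A where "A = 2 powr p * (E \<phi>1 + E \<phi>2) / p + 1"
  have A: "0 < A" using E_nonneg p_pos by (simp add: A_def add_nonneg_pos)
  \<comment> \<open>The path must stay below \<open>\<delta>\<close>, and \<open>r powr (p - \<rho>)\<close> must be small; the factor \<open>2\<close> makes the inequality strict.\<close>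
  define r where "r = min (\<delta> / B) ((a * (1/2) powr \<rho> * I / (2 * A)) powr (1 / (p - \<rho>)))"
  have r: "0 < r" "r * B \<le> \<delta>" using delta_pos B_pos a_pos I A by (auto simp: r_def min_def field_simps)
  have "r powr (p - \<rho>) \<le> ((a * (1/2) powr \<rho> * I / (2 * A)) powr (1 / (p - \<rho>))) powr (p - \<rho>)"
    using r rho by (intro powr_mono2) (auto simp: r_def)
  also have "\<dots> = a * (1/2) powr \<rho> * I / (2 * A)" using rho a_pos I A by (simp add: powr_powr)
  also have "\<dots> < a * (1/2) powr \<rho> * I / A" using a_pos I A by (intro divide_strict_left_mono) auto
  finally have "r powr (p - \<rho>) * A < a * (1/2) powr \<rho> * I" using A by (simp add: pos_less_divide_eq)
  then have "r powr \<rho> * (r powr (p - \<rho>) * A) < r powr \<rho> * (a * (1/2) powr \<rho> * I)"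
    using r by (intro mult_strict_left_mono) auto
  moreover have "r powr \<rho> * r powr (p - \<rho>) = r powr p" using r by (simp flip: powr_add)
  then have "r powr p * A = r powr \<rho> * (r powr (p - \<rho>) * A)" by (simp only: mult.assoc[symmetric])
  moreover have e: "(r * (1/2)) powr \<rho> = r powr \<rho> * (1/2) powr \<rho>" by (rule powr_mult)
  have "a * (r * (1/2)) powr \<rho> * I = r powr \<rho> * (a * (1/2) powr \<rho> * I)" unfolding e by (simp only: mult_ac)
  ultimately have small: "r powr p * A < a * (r * (1/2)) powr \<rho> * I" by (simp only:)
  have "J (bump_path r t) < 0" if t: "\<bar>t\<bar> \<le> 1" for t
  proof -
    have "E (bump_path r t) \<le> r powr p * (2 powr p * (E \<phi>1 + E \<phi>2))"
    proof -
      have "E (bump_path r t) = r powr p * E (\<lambda>x. t * \<phi>1 x + (1 - \<bar>t\<bar>) * \<phi>2 x)"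
        unfolding bump_path_def[abs_def] E_scale using r by simp
      also have "E (\<lambda>x. t * \<phi>1 x + (1 - \<bar>t\<bar>) * \<phi>2 x) \<le> 2 powr p * (E (\<lambda>x. t * \<phi>1 x) + E (\<lambda>x. (1 - \<bar>t\<bar>) * \<phi>2 x))"
        by (intro E_add_le W_scale phi_W)
      also have "\<dots> = 2 powr p * (\<bar>t\<bar> powr p * E \<phi>1 + \<bar>1 - \<bar>t\<bar>\<bar> powr p * E \<phi>2)" by (simp add: E_scale)
      also have "\<dots> \<le> 2 powr p * (1 * E \<phi>1 + 1 * E \<phi>2)"
        using t p_pos E_nonneg powr_mono2[of p "\<bar>t\<bar>" 1] powr_mono2[of p "\<bar>1 - \<bar>t\<bar>\<bar>" 1]
        by (intro mult_left_mono add_mono mult_right_mono) auto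
      finally show ?thesis using r by simp
    qed
    then have "E (bump_path r t) / p \<le> r powr p * (2 powr p * (E \<phi>1 + E \<phi>2)) / p"
      using p_pos by (intro divide_right_mono) auto
    also have "\<dots> = r powr p * (2 powr p * (E \<phi>1 + E \<phi>2) / p)" by simp
    also have "\<dots> \<le> r powr p * A" by (intro mult_left_mono) (auto simp: A_def)
    finally have 1: "E (bump_path r t) / p \<le> r powr p * A" .
    have pb: "\<bar>bump_path r t x\<bar> \<le> \<delta>" and plow: "r * \<bar>t\<bar> * \<phi>1 x \<le> \<bar>bump_path r t x\<bar>" "r * (1 - \<bar>t\<bar>) * \<phi>2 x \<le> \<bar>bump_path r t x\<bar>" for x
    proof -
      have "\<phi>1 x = 0 \<or> \<phi>2 x = 0" using phi(5)[of x] by simp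
      then have *: "\<bar>bump_path r t x\<bar> = r * (\<bar>t\<bar> * \<phi>1 x + (1 - \<bar>t\<bar>) * \<phi>2 x)"
        using r t phi(1)[of x] phi(3)[of x] by (auto simp: bump_path_def abs_mult)
      have "\<bar>t\<bar> * \<phi>1 x + (1 - \<bar>t\<bar>) * \<phi>2 x \<le> \<bar>t\<bar> * B + (1 - \<bar>t\<bar>) * B"
        using t phi by (intro add_mono mult_left_mono) auto
      then have "r * (\<bar>t\<bar> * \<phi>1 x + (1 - \<bar>t\<bar>) * \<phi>2 x) \<le> r * B" using r by (intro mult_left_mono) (auto simp: algebra_simps)
      then show "\<bar>bump_path r t x\<bar> \<le> \<delta>" using r(2) * by linarith
      show "r * \<bar>t\<bar> * \<phi>1 x \<le> \<bar>bump_path r t x\<bar>" "r * (1 - \<bar>t\<bar>) * \<phi>2 x \<le> \<bar>bump_path r t x\<bar>"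
        unfolding * using r t phi(1)[of x] phi(3)[of x] by (auto simp: mult.assoc intro!: mult_left_mono)
    qed
    have int: "a * ((r * (1/2)) powr \<rho> * I) \<le> (\<integral>x. F (bump_path r t x) \<partial>m)"
      if \<phi>: "\<And>x. 0 \<le> \<phi> x" "integrable m (\<lambda>x. \<phi> x powr \<rho>)" "I \<le> (\<integral>x. \<phi> x powr \<rho> \<partial>m)"
        and le: "\<And>x. r * (1/2) * \<phi> x \<le> \<bar>bump_path r t x\<bar>" for \<phi>
    proof -
      have "a * ((r * (1/2)) powr \<rho> * I) \<le> a * ((r * (1/2)) powr \<rho> * (\<integral>x. \<phi> x powr \<rho> \<partial>m))"
        using a_pos \<phi>(3) by (intro mult_left_mono) auto
      also have "\<dots> = (\<integral>x. a * ((r * (1/2)) powr \<rho> * \<phi> x powr \<rho>) \<partial>m)" by simp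
      also have "\<dots> \<le> (\<integral>x. F (bump_path r t x) \<partial>m)"
      proof (rule integral_mono)
        show "integrable m (\<lambda>x. a * ((r * (1/2)) powr \<rho> * \<phi> x powr \<rho>))" using \<phi>(2) by simp
        show "integrable m (\<lambda>x. F (bump_path r t x))" by (intro F_comp_integrable W_integrable bump_path_W)
        fix x
        have "(r * (1/2)) powr \<rho> * \<phi> x powr \<rho> = (r * (1/2) * \<phi> x) powr \<rho>" by (rule powr_mult[symmetric])
        also have "\<dots> \<le> \<bar>bump_path r t x\<bar> powr \<rho>" using r \<phi>(1)[of x] rho by (intro powr_mono2 le) auto
        finally have "a * ((r * (1/2)) powr \<rho> * \<phi> x powr \<rho>) \<le> a * \<bar>bump_path r t x\<bar> powr \<rho>"
          using a_pos by (intro mult_left_mono) auto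
        also have "\<dots> \<le> F (bump_path r t x)" by (rule F_lower[OF pb])
        finally show "a * ((r * (1/2)) powr \<rho> * \<phi> x powr \<rho>) \<le> F (bump_path r t x)" .
      qed
      finally show ?thesis .
    qed
    have "a * ((r * (1/2)) powr \<rho> * I) \<le> (\<integral>x. F (bump_path r t x) \<partial>m)"
    proof (cases "1 / 2 \<le> \<bar>t\<bar>")
      case True
      show ?thesis
      proof (rule int[OF phi(1) I1(1)])
        fix x
        have "r * (1/2) * \<phi>1 x \<le> r * \<bar>t\<bar> * \<phi>1 x" using True r phi(1)[of x] by (intro mult_right_mono mult_left_mono) auto
        then show "r * (1/2) * \<phi>1 x \<le> \<bar>bump_path r t x\<bar>" using plow(1)[of x] by linarith
      qed (simp add: I_def)
    next
      case False
      show ?thesis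
      proof (rule int[OF phi(3) I2(1)])
        fix x
        have "r * (1/2) * \<phi>2 x \<le> r * (1 - \<bar>t\<bar>) * \<phi>2 x" using False r phi(3)[of x] by (intro mult_right_mono mult_left_mono) auto
        then show "r * (1/2) * \<phi>2 x \<le> \<bar>bump_path r t x\<bar>" using plow(2)[of x] by linarith
      qed (simp add: I_def)
    qed
    then have "a * (r * (1/2)) powr \<rho> * I \<le> (\<integral>x. F (bump_path r t x) \<partial>m)" by (simp only: mult.assoc)
    with 1 small show ?thesis unfolding J_def by linarith
  qed
  then show ?thesis by blast
qed

lemma bump_path_diff: "\<bar>bump_path r s x - bump_path r t x\<bar> \<le> \<bar>r\<bar> * \<bar>s - t\<bar> * (\<phi>1 x + \<phi>2 x)"
proof -
  have "bump_path r s x - bump_path r t x = r * ((s - t) * \<phi>1 x + (\<bar>t\<bar> - \<bar>s\<bar>) * \<phi>2 x)" by (simp add: bump_path_def algebra_simps)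
  also have "\<bar>\<dots>\<bar> = \<bar>r\<bar> * \<bar>(s - t) * \<phi>1 x + (\<bar>t\<bar> - \<bar>s\<bar>) * \<phi>2 x\<bar>" by (simp add: abs_mult)
  also have "\<dots> \<le> \<bar>r\<bar> * (\<bar>s - t\<bar> * \<phi>1 x + \<bar>s - t\<bar> * \<phi>2 x)"
  proof (intro mult_left_mono)
    have "\<bar>(\<bar>t\<bar> - \<bar>s\<bar>) * \<phi>2 x\<bar> \<le> \<bar>s - t\<bar> * \<phi>2 x" unfolding abs_mult using phi(3)[of x] by (intro mult_mono) auto
    moreover have "\<bar>(s - t) * \<phi>1 x\<bar> = \<bar>s - t\<bar> * \<phi>1 x" unfolding abs_mult using phi(1)[of x] by simp
    ultimately show "\<bar>(s - t) * \<phi>1 x + (\<bar>t\<bar> - \<bar>s\<bar>) * \<phi>2 x\<bar> \<le> \<bar>s - t\<bar> * \<phi>1 x + \<bar>s - t\<bar> * \<phi>2 x" by linarith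
  qed simp
  finally show ?thesis by (simp add: algebra_simps)
qed

definition flow :: "real \<Rightarrow> nat \<Rightarrow> real \<Rightarrow> 'a \<Rightarrow> real" where
  "flow r n t = (T ^^ n) (bump_path r t)"

lemma flow_0: "flow r 0 t = bump_path r t" and flow_Suc: "flow r (Suc n) t = T (flow r n t)"
  by (simp_all add: flow_def)

lemma flow_W: "flow r n t \<in> W"
  by (induction n) (auto simp: flow_0 flow_Suc bump_path_W intro: T_W W_measurable)

lemma flow_continuous:
  assumes "s \<longlonglongrightarrow> t"
  shows "(\<lambda>k. \<integral>x. \<bar>flow r n (s k) x - flow r n t x\<bar> \<partial>m) \<longlonglongrightarrow> 0"
proof (induction n)
  case 0
  have i: "integrable m \<phi>1" "integrable m \<phi>2" using phi_W W_integrable by auto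
  show ?case
  proof (rule tendsto_sandwich[OF _ _ tendsto_const])
    have "(\<lambda>k. \<bar>r\<bar> * \<bar>s k - t\<bar> * (\<integral>x. \<phi>1 x + \<phi>2 x \<partial>m)) \<longlonglongrightarrow> \<bar>r\<bar> * \<bar>t - t\<bar> * (\<integral>x. \<phi>1 x + \<phi>2 x \<partial>m)"
      by (intro tendsto_intros assms)
    then show "(\<lambda>k. \<bar>r\<bar> * \<bar>s k - t\<bar> * (\<integral>x. \<phi>1 x + \<phi>2 x \<partial>m)) \<longlonglongrightarrow> 0" by simp
    show "\<forall>\<^sub>F k in sequentially. (\<integral>x. \<bar>flow r 0 (s k) x - flow r 0 t x\<bar> \<partial>m) \<le> \<bar>r\<bar> * \<bar>s k - t\<bar> * (\<integral>x. \<phi>1 x + \<phi>2 x \<partial>m)"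
    proof (rule always_eventually, rule allI)
      fix k
      have "(\<integral>x. \<bar>bump_path r (s k) x - bump_path r t x\<bar> \<partial>m) \<le> (\<integral>x. \<bar>r\<bar> * \<bar>s k - t\<bar> * (\<phi>1 x + \<phi>2 x) \<partial>m)"
        using i W_integrable[OF bump_path_W] by (intro integral_mono bump_path_diff) auto
      then show "(\<integral>x. \<bar>flow r 0 (s k) x - flow r 0 t x\<bar> \<partial>m) \<le> \<bar>r\<bar> * \<bar>s k - t\<bar> * (\<integral>x. \<phi>1 x + \<phi>2 x \<partial>m)"
        by (simp add: flow_0)
    qed
  qed (simp add: always_eventually)
next
  case (Suc n)
  then show ?case unfolding flow_Suc by (intro T_continuous W_integrable flow_W)
qed

lemma flow_odd: "AE x in m. flow r n (- 1) x = - flow r n 1 x"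
proof (induction n)
  case 0
  show ?case by (simp add: flow_0 bump_path_minus)
next
  case (Suc n)
  note w = W_measurable[OF flow_W]
  have "T (flow r n (- 1)) = T (\<lambda>x. - flow r n 1 x)"
    using Suc w by (intro T_cong) auto
  moreover have "AE x in m. T (\<lambda>x. - flow r n 1 x) x = - T (flow r n 1) x" by (rule T_odd[OF w])
  ultimately show ?case by (simp add: flow_Suc)
qed

lemma J_flow_antimono: "k \<le> n \<Longrightarrow> J (flow r n t) \<le> J (flow r k t)"
proof (induction n rule: dec_induct)
  case (step n)
  then show ?case using J_T_le[OF flow_W[of r n t]] by (simp add: flow_Suc)
qed simp

text \<open>
  Along the trajectory \<open>J\<close> decreases to a limit \<open>l\<close>. If a subsequence tends to \<open>v\<close>, then \<open>J (T v)\<close> and \<open>J (T (T v))\<close>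
  are both limits of values along the trajectory, hence equal to \<open>l\<close>, so \<open>T v\<close> is a fixed point.
\<close>

lemma flow_limit_critical:
  assumes c: "\<And>n. 1 \<le> n \<Longrightarrow> c \<le> J (flow r n t)"
  shows "\<exists>z. critical z \<and> c \<le> J z \<and> J z \<le> J (bump_path r t)"
proof -
  let ?x = "\<lambda>n. flow r (Suc n) t"
  have dec: "decseq (\<lambda>n. J (?x n))" unfolding decseq_def by (auto intro: J_flow_antimono)
  obtain l where l: "(\<lambda>n. J (?x n)) \<longlonglongrightarrow> l"
    by (rule decseq_convergent[OF dec, of c]) (use c in auto)
  have cl: "c \<le> l" by (rule LIMSEQ_le_const[OF l]) (use c in auto)
  have lu: "l \<le> J (bump_path r t)"
    by (rule LIMSEQ_le_const2[OF l]) (use J_flow_antimono[of 0] in \<open>auto simp: flow_0\<close>)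
  obtain s v where s: "strict_mono (s :: nat \<Rightarrow> nat)" and v: "v \<in> W" "J v \<le> l"
    and L1: "(\<lambda>n. \<integral>x. \<bar>?x (s n) x - v x\<bar> \<partial>m) \<longlonglongrightarrow> 0"
    by (rule J_sublevel_compact[of ?x, OF flow_W order_refl l]) (rule that)
  note iv = W_integrable[OF v(1)]
  have vm: "v \<in> borel_measurable m" by (rule W_measurable[OF v(1)])
  have ix: "integrable m (flow r n t)" for n by (rule W_integrable[OF flow_W])
  have sub: "(\<lambda>n. J (?x (s n + j))) \<longlonglongrightarrow> l" for j
  proof -
    have "(\<lambda>n. J (?x (n + j))) \<longlonglongrightarrow> l" using LIMSEQ_ignore_initial_segment[OF l, of j] .
    from LIMSEQ_subseq_LIMSEQ[OF this s] show ?thesis by (simp add: o_def)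
  qed
  have T1: "(\<lambda>n. J (T (?x (s n)))) \<longlonglongrightarrow> J (T v)" by (rule J_T_continuous[OF ix iv L1])
  have L2: "(\<lambda>n. \<integral>x. \<bar>T (?x (s n)) x - T v x\<bar> \<partial>m) \<longlonglongrightarrow> 0" by (rule T_continuous[OF ix iv L1])
  have T2: "(\<lambda>n. J (T (T (?x (s n))))) \<longlonglongrightarrow> J (T (T v))"
    by (rule J_T_continuous[OF _ _ L2]) (auto intro!: W_integrable T_W vm W_measurable[OF flow_W])
  have "J (T v) = l" using LIMSEQ_unique[OF T1] sub[of 1] by (simp add: flow_Suc)
  moreover have "J (T (T v)) = l" using LIMSEQ_unique[OF T2] sub[of 2] by (simp add: flow_Suc numeral_2_eq_2)
  ultimately have "critical (T v)" "J (T v) = l" by (auto intro!: critical_of_no_descent T_W vm)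
  with cl lu show ?thesis by auto
qed

text \<open>
  By contradiction, as outlined at the beginning: without sign-changing critical points the low sublevel
  sets split into two opposite pieces, which no iterate of the path with opposite end points can avoid
  leaving.
\<close>

lemma ex_sign_changing_critical:
  "\<exists>z. critical z \<and> \<not> (AE x in m. 0 \<le> z x) \<and> \<not> (AE x in m. z x \<le> 0)"
proof (rule ccontr)
  assume "\<not> ?thesis"
  then have one_sign: "(AE x in m. 0 \<le> z x) \<or> (AE x in m. z x \<le> 0)" if "critical z" for z
    using that by blast
  obtain r where r: "\<And>t. \<bar>t\<bar> \<le> 1 \<Longrightarrow> J (bump_path r t) < 0" using ex_negative_path by blast
  obtain w0 where w0: "w0 \<in> W" "\<And>u. u \<in> W \<Longrightarrow> J w0 \<le> J u" using ex_J_minimizer by blast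
  define w where "w x = \<bar>w0 x\<bar>" for x
  have wW: "w \<in> W" unfolding w_def[abs_def] by (intro W_abs w0)
  have wmin: "J w \<le> J u" if "u \<in> W" for u
    using J_abs[OF w0(1)] w0(2)[OF that] unfolding w_def[abs_def] by linarith
  have wnn: "0 \<le> w x" for x by (simp add: w_def)
  have Jw: "J w < 0" using le_less_trans[OF wmin[OF bump_path_W[of r 0]] r[of 0]] by simp
  have nz: "\<not> (AE x in m. u x = 0)" if "u \<in> W" "J u < 0" for u
    using J_cong_AE[of u "\<lambda>x. 0"] W_measurable[OF that(1)] that(2) J_zero by auto
  have wcrit: "critical w" by (rule critical_of_minimizer[OF wW wmin])
  note wnz = nz[OF wW Jw]
  \<comment> \<open>Negative energy excludes the zero function, so \<open>nonneg_critical_minimal\<close> applies to \<open>z\<close> or to \<open>- z\<close>.\<close>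
  have crit_min: "J z \<le> J w" if z: "critical z" and neg: "J z < 0" for z
  proof -
    have *: "J z \<le> J w" if z: "critical z" and neg: "J z < 0" and pos: "AE x in m. 0 \<le> z x" for z
    proof -
      have zW: "z \<in> W" by (rule criticalD(1)[OF z])
      have aW: "(\<lambda>x. \<bar>z x\<bar>) \<in> W" by (rule W_abs(1)[OF zW])
      have ae: "AE x in m. \<bar>z x\<bar> = z x" using pos by eventually_elim simp
      have Ja: "J (\<lambda>x. \<bar>z x\<bar>) = J z" by (rule J_cong_AE[OF W_measurable[OF aW] W_measurable[OF zW] ae])
      have "J (\<lambda>x. \<bar>z x\<bar>) \<le> J w"
        by (rule nonneg_critical_minimal(1)[OF critical_cong_AE[OF z aW ae] _ nz[OF aW] wW wnn]) (use Ja neg in auto)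
      then show ?thesis using Ja by simp
    qed
    from one_sign[OF z] show ?thesis
    proof
      assume "AE x in m. z x \<le> 0"
      then show ?thesis using *[OF critical_minus[OF z]] neg J_minus[of z] by simp
    qed (rule *[OF z neg])
  qed
  have min_pm: "(AE x in m. u x = w x) \<or> (AE x in m. u x = - w x)" if u: "u \<in> W" "J u \<le> J w" for u
  proof -
    have "critical u" by (rule critical_of_minimizer[OF u(1)]) (use u(2) wmin in \<open>auto intro: order_trans\<close>)
    have "J (\<lambda>x. \<bar>u x\<bar>) \<le> J w" using J_abs[OF u(1)] u(2) by simp
    then have ae: "AE x in m. \<bar>u x\<bar> = w x"
      by (intro nonneg_critical_minimal(2)[OF wcrit wnn wnz W_abs(1)[OF u(1)]]) auto
    from one_sign[OF \<open>critical u\<close>] show ?thesis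
    proof
      assume "AE x in m. 0 \<le> u x"
      with ae have "AE x in m. u x = w x" by eventually_elim simp
      then show ?thesis ..
    next
      assume "AE x in m. u x \<le> 0"
      with ae have "AE x in m. u x = - w x" by eventually_elim simp
      then show ?thesis ..
    qed
  qed
  define r0 where "r0 = (\<integral>x. \<bar>w x\<bar> \<partial>m)"
  define dp where "dp u = (\<integral>x. \<bar>u x - w x\<bar> \<partial>m)" for u
  define dm where "dm u = (\<integral>x. \<bar>u x + w x\<bar> \<partial>m)" for u
  have iw: "integrable m w" by (rule W_integrable[OF wW])
  have r0: "0 < r0"
  proof -
    have "r0 \<noteq> 0" using wnz iw unfolding r0_def by (subst integral_nonneg_eq_0_iff_AE) auto
    moreover have "0 \<le> r0" unfolding r0_def by (rule integral_nonneg_AE) simp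
    ultimately show ?thesis by simp
  qed
  have dsum: "2 * r0 \<le> dp u + dm u" if "u \<in> W" for u
  proof -
    have iu: "integrable m u" by (rule W_integrable[OF that])
    have "2 * r0 = (\<integral>x. 2 * \<bar>w x\<bar> \<partial>m)" by (simp add: r0_def)
    also have "\<dots> \<le> (\<integral>x. \<bar>u x - w x\<bar> + \<bar>u x + w x\<bar> \<partial>m)" using iu iw by (intro integral_mono) auto
    also have "\<dots> = dp u + dm u" using iu iw by (simp add: dp_def dm_def)
    finally show ?thesis .
  qed
  \<comment> \<open>Otherwise a sequence with \<open>J u \<rightarrow> J w\<close> would converge to a minimiser other than \<open>w\<close> and \<open>- w\<close>.\<close>
  have "\<exists>n. \<forall>u\<in>W. J u < J w + 1 / real (Suc n) \<longrightarrow> dp u < r0 \<or> dm u < r0"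
  proof (rule ccontr)
    assume "\<not> ?thesis"
    then obtain u where u: "\<And>n. u n \<in> W" "\<And>n. J (u n) < J w + 1 / real (Suc n)" "\<And>n. r0 \<le> dp (u n)" "\<And>n. r0 \<le> dm (u n)"
      by (metis linorder_not_less)
    have "(\<lambda>n. J w + 1 / real (Suc n)) \<longlonglongrightarrow> J w + 0" by (intro tendsto_intros LIMSEQ_Suc[OF lim_1_over_n])
    then have cl: "(\<lambda>n. J w + 1 / real (Suc n)) \<longlonglongrightarrow> J w" by simp
    obtain s v where v: "v \<in> W" "J v \<le> J w" and L1: "(\<lambda>n. \<integral>x. \<bar>u (s n) x - v x\<bar> \<partial>m) \<longlonglongrightarrow> 0"
      by (rule J_sublevel_compact[of u, OF u(1) less_imp_le[OF u(2)] cl]) (rule that)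
    have um: "u n \<in> borel_measurable m" "v \<in> borel_measurable m" "w \<in> borel_measurable m" for n
      using u(1) v(1) wW W_measurable by auto
    have "r0 \<le> (\<integral>x. \<bar>u (s n) x - v x\<bar> \<partial>m)" for n
      using min_pm[OF v]
    proof
      assume ae: "AE x in m. v x = w x"
      have "(\<integral>x. \<bar>u (s n) x - v x\<bar> \<partial>m) = dp (u (s n))"
        unfolding dp_def by (rule integral_cong_AE) (use ae um in \<open>auto elim: eventually_mono\<close>)
      then show ?thesis using u(3) by simp
    next
      assume ae: "AE x in m. v x = - w x"
      have "(\<integral>x. \<bar>u (s n) x - v x\<bar> \<partial>m) = dm (u (s n))"
        unfolding dm_def by (rule integral_cong_AE) (use ae um in \<open>auto elim: eventually_mono\<close>)
      then show ?thesis using u(4) by simp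
    qed
    then have "r0 \<le> 0" by (intro LIMSEQ_le_const[OF L1]) auto
    with r0 show False by simp
  qed
  then obtain n0 where n0: "\<And>u. u \<in> W \<Longrightarrow> J u < J w + 1 / real (Suc n0) \<Longrightarrow> dp u < r0 \<or> dm u < r0" by blast
  define c where "c = J w + 1 / real (Suc n0)"
  have c: "J w < c" by (simp add: c_def)
  \<comment> \<open>The continuous function \<open>D\<close> cannot take the value \<open>r0\<close> below the level \<open>c\<close>, but its values at the two opposite ends
    lie on different sides of \<open>r0\<close>.\<close>
  have barrier: "\<exists>t. \<bar>t\<bar> \<le> 1 \<and> c \<le> J (flow r n t)" for n
  proof (rule ccontr)
    assume "\<not> ?thesis"
    then have below: "dp (flow r n t) < r0 \<or> dm (flow r n t) < r0" if "\<bar>t\<bar> \<le> 1" for t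
      using n0[OF flow_W] that unfolding c_def by (meson linorder_not_less)
    have fi: "integrable m (flow r n t)" for t by (rule W_integrable[OF flow_W])
    have fm: "flow r n t \<in> borel_measurable m" for t using fi by auto
    define D where "D t = dp (flow r n t)" for t
    have Dcont: "continuous_on {-1..1} D"
    proof (rule continuous_on_sequentiallyI)
      fix s t assume s: "s \<longlonglongrightarrow> (t :: real)"
      have "(\<lambda>k. D (s k) - D t) \<longlonglongrightarrow> 0"
      proof (rule tendsto_rabs_zero_cancel, rule tendsto_sandwich[OF _ _ tendsto_const flow_continuous[OF s, of r n]])
        show "\<forall>\<^sub>F k in sequentially. \<bar>D (s k) - D t\<bar> \<le> (\<integral>x. \<bar>flow r n (s k) x - flow r n t x\<bar> \<partial>m)"
        proof (rule always_eventually, rule allI)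
          fix k
          have eq: "D (s k) - D t = (\<integral>x. \<bar>flow r n (s k) x - w x\<bar> - \<bar>flow r n t x - w x\<bar> \<partial>m)"
            using fi iw by (simp add: D_def dp_def)
          have "\<bar>D (s k) - D t\<bar> \<le> (\<integral>x. \<bar>\<bar>flow r n (s k) x - w x\<bar> - \<bar>flow r n t x - w x\<bar>\<bar> \<partial>m)"
            unfolding eq by (rule integral_abs_bound)
          also have "\<dots> \<le> (\<integral>x. \<bar>flow r n (s k) x - flow r n t x\<bar> \<partial>m)"
          proof (rule integral_mono)
            show "\<bar>\<bar>flow r n (s k) x - w x\<bar> - \<bar>flow r n t x - w x\<bar>\<bar> \<le> \<bar>flow r n (s k) x - flow r n t x\<bar>" for x
              by (rule abs_abs_diff_le)
          qed (intro integrable_abs Bochner_Integration.integrable_diff fi iw)+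
          finally show "\<bar>D (s k) - D t\<bar> \<le> (\<integral>x. \<bar>flow r n (s k) x - flow r n t x\<bar> \<partial>m)" .
        qed
      qed (simp add: always_eventually)
      then show "(\<lambda>k. D (s k)) \<longlonglongrightarrow> D t" by (simp add: LIM_zero_iff)
    qed
    have Dne: "D t \<noteq> r0" if "\<bar>t\<bar> \<le> 1" for t
      using below[OF that] dsum[OF flow_W, of r n t] by (auto simp: D_def)
    have sym: "D (- 1) = dm (flow r n 1)"
      unfolding D_def dp_def dm_def
    proof (rule integral_cong_AE)
      show "AE x in m. \<bar>flow r n (- 1) x - w x\<bar> = \<bar>flow r n 1 x + w x\<bar>"
        using flow_odd[of r n] by eventually_elim simp
    qed (use fm iw in auto)
    have ends: "(D 1 < r0 \<and> r0 < D (- 1)) \<or> (r0 < D 1 \<and> D (- 1) < r0)"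
      using below[of 1] dsum[OF flow_W, of r n 1] unfolding sym by (auto simp: D_def)
    have "\<exists>t. - 1 \<le> t \<and> t \<le> 1 \<and> D t = r0"
      using ends IVT'[of D "- 1" r0 1] IVT2'[of D 1 r0 "- 1"] Dcont by (auto intro: less_imp_le)
    then show False using Dne by (auto simp: abs_le_iff)
  qed
  then obtain \<tau> where \<tau>: "\<And>n. \<bar>\<tau> n\<bar> \<le> 1" "\<And>n. c \<le> J (flow r n (\<tau> n))" by metis
  have "compact {- 1..1 :: real}" by simp
  moreover have "\<forall>n. \<tau> n \<in> {- 1..1}" using \<tau>(1) by (auto simp: abs_le_iff minus_le_iff)
  ultimately obtain t s where t: "t \<in> {- 1..1}" and s: "strict_mono (s :: nat \<Rightarrow> nat)" and lim: "(\<tau> \<circ> s) \<longlonglongrightarrow> t"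
    unfolding compact_def by blast
  have "c \<le> J (flow r n t)" if n: "1 \<le> n" for n
  proof -
    obtain k where k: "n = Suc k" using n by (cases n) auto
    have L: "(\<lambda>j. \<integral>x. \<bar>flow r k (\<tau> (s j)) x - flow r k t x\<bar> \<partial>m) \<longlonglongrightarrow> 0"
      using flow_continuous[OF lim, of r k] by simp
    have "(\<lambda>j. J (flow r n (\<tau> (s j)))) \<longlonglongrightarrow> J (flow r n t)"
      unfolding k flow_Suc by (rule J_T_continuous[OF _ _ L]) (auto intro: W_integrable flow_W)
    then show ?thesis
    proof (rule LIMSEQ_le_const, intro exI allI impI)
      fix j assume "n \<le> j"
      then have "n \<le> s j" using seq_suble[OF s, of j] by linarith
      then show "c \<le> J (flow r n (\<tau> (s j)))" using \<tau>(2)[of "s j"] J_flow_antimono[of n "s j" r "\<tau> (s j)"] by linarith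
    qed
  qed
  from flow_limit_critical[OF this] obtain z where z: "critical z" "c \<le> J z" "J z \<le> J (bump_path r t)" by blast
  have "J z < 0" using z(3) r[of t] t by (auto simp: abs_le_iff)
  from crit_min[OF z(1) this] z(2) c show False by simp
qed

end

section \<open>The fractional kernel\<close>

text \<open>
  The half-open cube of side \<open>h\<close> of the grid \<open>h \<int>\<^sup>N\<close> that contains \<open>x\<close>. Two points lie in the same cube iff each lies
  in the cube of the other.
\<close>

definition cell :: "real \<Rightarrow> 'a::euclidean_space \<Rightarrow> 'a set" where
  "cell h x = {y. \<forall>b\<in>Basis. \<lfloor>(y \<bullet> b) / h\<rfloor> = \<lfloor>(x \<bullet> b) / h\<rfloor>}"

lemma cell_sym: "y \<in> cell h x \<longleftrightarrow> x \<in> cell h y"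
  by (auto simp: cell_def)

lemma cell_eq: "y \<in> cell h x \<Longrightarrow> cell h y = cell h x"
  by (auto simp: cell_def)

lemma cell_measurable_pair:
  "{z. snd z \<in> cell h (fst z)} \<in> sets (lborel \<Otimes>\<^sub>M (lborel :: 'a::euclidean_space measure))"
proof -
  have "{z \<in> space (lborel \<Otimes>\<^sub>M (lborel :: 'a measure)). \<forall>b\<in>Basis. \<lfloor>(snd z \<bullet> b) / h\<rfloor> = \<lfloor>(fst z \<bullet> b) / h\<rfloor>}
      \<in> sets (lborel \<Otimes>\<^sub>M lborel)"
    by measurable
  then show ?thesis by (simp add: cell_def space_pair_measure)
qed

lemma cell_sets [measurable]: "cell h x \<in> sets (borel :: 'a::euclidean_space measure)"
proof -
  have "{y \<in> space (borel :: 'a measure). \<forall>b\<in>Basis. \<lfloor>(y \<bullet> b) / h\<rfloor> = \<lfloor>(x \<bullet> b) / h\<rfloor>} \<in> sets borel"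
    by measurable
  then show ?thesis by (simp add: cell_def)
qed

lemma cell_diameter:
  fixes x y :: "'a::euclidean_space"
  assumes h: "0 < h" and y: "y \<in> cell h x"
  shows "norm (x - y) \<le> h * real DIM('a)"
proof -
  have "\<bar>(x - y) \<bullet> b\<bar> \<le> h" if b: "b \<in> Basis" for b
  proof -
    have "\<lfloor>(y \<bullet> b) / h\<rfloor> = \<lfloor>(x \<bullet> b) / h\<rfloor>" using y b by (simp add: cell_def)
    then have "\<bar>(x \<bullet> b) / h - (y \<bullet> b) / h\<bar> \<le> 1" by linarith
    then have "\<bar>(x \<bullet> b - y \<bullet> b) / h\<bar> \<le> 1" by (simp add: diff_divide_distrib)
    then show ?thesis using h by (simp add: inner_diff_left abs_divide)
  qed
  then have "(\<Sum>b\<in>Basis. \<bar>(x - y) \<bullet> b\<bar>) \<le> (\<Sum>b\<in>(Basis :: 'a set). h)" by (rule sum_mono)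
  with norm_le_l1[of "x - y"] show ?thesis by (simp add: mult.commute)
qed

lemma cell_between:
  fixes x :: "'a::euclidean_space"
  assumes h: "0 < h"
  obtains l where "box l (l + h *\<^sub>R One) \<subseteq> cell h x" "cell h x \<subseteq> cbox l (l + h *\<^sub>R One)"
proof -
  define l where "l = (\<Sum>b\<in>Basis. (h * of_int \<lfloor>(x \<bullet> b) / h\<rfloor>) *\<^sub>R b)"
  have l: "l \<bullet> b = h * of_int \<lfloor>(x \<bullet> b) / h\<rfloor>" if "b \<in> Basis" for b
    using that by (simp add: l_def)
  show thesis
  proof
    show "box l (l + h *\<^sub>R One) \<subseteq> cell h x"
    proof
      fix y assume y: "y \<in> box l (l + h *\<^sub>R One)"
      show "y \<in> cell h x" unfolding cell_def
      proof (intro CollectI ballI)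
        fix b :: 'a assume b: "b \<in> Basis"
        have "l \<bullet> b < y \<bullet> b" "y \<bullet> b < l \<bullet> b + h" using y b by (auto simp: mem_box inner_add_left)
        then have "of_int \<lfloor>(x \<bullet> b) / h\<rfloor> < (y \<bullet> b) / h" "(y \<bullet> b) / h < of_int \<lfloor>(x \<bullet> b) / h\<rfloor> + 1"
          using h unfolding l[OF b] by (auto simp: field_simps)
        then show "\<lfloor>(y \<bullet> b) / h\<rfloor> = \<lfloor>(x \<bullet> b) / h\<rfloor>" by (intro floor_unique) auto
      qed
    qed
    show "cell h x \<subseteq> cbox l (l + h *\<^sub>R One)"
    proof
      fix y assume y: "y \<in> cell h x"
      have "l \<bullet> b \<le> y \<bullet> b \<and> y \<bullet> b \<le> (l + h *\<^sub>R One) \<bullet> b" if b: "b \<in> Basis" for b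
      proof -
        have "of_int \<lfloor>(x \<bullet> b) / h\<rfloor> \<le> (y \<bullet> b) / h" "(y \<bullet> b) / h \<le> of_int \<lfloor>(x \<bullet> b) / h\<rfloor> + 1"
        proof -
          have e: "\<lfloor>(y \<bullet> b) / h\<rfloor> = \<lfloor>(x \<bullet> b) / h\<rfloor>" using y b by (simp add: cell_def)
          show "of_int \<lfloor>(x \<bullet> b) / h\<rfloor> \<le> (y \<bullet> b) / h" "(y \<bullet> b) / h \<le> of_int \<lfloor>(x \<bullet> b) / h\<rfloor> + 1"
            unfolding e[symmetric] by linarith+
        qed
        then have "h * of_int \<lfloor>(x \<bullet> b) / h\<rfloor> \<le> y \<bullet> b" "y \<bullet> b \<le> h * of_int \<lfloor>(x \<bullet> b) / h\<rfloor> + h"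
          using h by (auto simp: field_simps)
        then show ?thesis using b by (simp add: l inner_add_left)
      qed
      then show "y \<in> cbox l (l + h *\<^sub>R One)" by (simp add: mem_box)
    qed
  qed
qed

lemma emeasure_cell:
  fixes x :: "'a::euclidean_space"
  assumes h: "0 < h"
  shows "emeasure lborel (cell h x) = ennreal (h ^ DIM('a))"
proof -
  obtain l where l: "box l (l + h *\<^sub>R One) \<subseteq> cell h x" "cell h x \<subseteq> cbox l (l + h *\<^sub>R One)"
    by (rule cell_between[OF h])
  have b: "emeasure lborel (box l (l + h *\<^sub>R One)) = ennreal (h ^ DIM('a))"
    "emeasure lborel (cbox l (l + h *\<^sub>R One)) = ennreal (h ^ DIM('a))"
    using h by (subst emeasure_lborel_box emeasure_lborel_cbox; simp add: inner_add_left)+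
  show ?thesis
    using emeasure_mono[OF l(1), of lborel] emeasure_mono[OF l(2), of lborel] unfolding b by (simp add: antisym)
qed

text \<open>Each cube has interior points, so it is the cube of some point of a countable dense set.\<close>

lemma countable_cells: "countable (range (cell h :: 'a::euclidean_space \<Rightarrow> 'a set))" if h: "0 < h"
proof -
  obtain D :: "'a set" where D: "countable D" "\<And>X. open X \<Longrightarrow> X \<noteq> {} \<Longrightarrow> \<exists>d\<in>D. d \<in> X"
    by (rule countable_dense_setE) (rule that)
  have "range (cell h) \<subseteq> cell h ` D"
  proof
    fix Q :: "'a set" assume "Q \<in> range (cell h)"
    then obtain x where x: "Q = cell h x" by blast
    obtain l where l: "box l (l + h *\<^sub>R One) \<subseteq> cell h x" by (rule cell_between[OF h])
    have "box l (l + h *\<^sub>R One) \<noteq> {}" using h by (auto simp: box_ne_empty inner_add_left)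
    then obtain d where "d \<in> D" "d \<in> box l (l + h *\<^sub>R One)" using D(2)[OF open_box] by blast
    then show "Q \<in> cell h ` D" using l cell_eq[of d h x] x by auto
  qed
  then show ?thesis using D(1) by (meson countable_image countable_subset)
qed

definition frac_kernel :: "real \<Rightarrow> 'a::euclidean_space \<times> 'a \<Rightarrow> real" where
  "frac_kernel \<sigma> z = 1 / norm (fst z - snd z) powr (real DIM('a) + \<sigma>)"

lemma frac_kernel_measurable [measurable]: "frac_kernel \<sigma> \<in> borel_measurable (lborel \<Otimes>\<^sub>M lborel)"
  unfolding frac_kernel_def by measurable

lemma frac_kernel_nonneg: "0 \<le> frac_kernel \<sigma> z"
  by (simp add: frac_kernel_def)

lemma frac_kernel_pos: "x \<noteq> y \<Longrightarrow> 0 < frac_kernel \<sigma> (x, y)"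
  by (simp add: frac_kernel_def)

lemma frac_kernel_ge:
  fixes x y :: "'a::euclidean_space"
  assumes "x \<noteq> y" "norm (x - y) \<le> r" "0 \<le> \<sigma>"
  shows "1 \<le> r powr (real DIM('a) + \<sigma>) * frac_kernel \<sigma> (x, y)"
proof -
  have "norm (x - y) powr (real DIM('a) + \<sigma>) \<le> r powr (real DIM('a) + \<sigma>)"
    using assms by (intro powr_mono2) auto
  moreover have "0 < norm (x - y) powr (real DIM('a) + \<sigma>)" using assms by simp
  ultimately show ?thesis by (simp add: frac_kernel_def pos_le_divide_eq)
qed

text \<open>
  If \<open>\<Omega>\<close> lies in a ball of radius \<open>R\<close> around the origin, then for \<open>x\<close> in \<open>\<Omega>\<close> a ball of radius \<open>R\<close> whose centre is
  at distance \<open>3 R\<close> from \<open>x\<close> misses \<open>\<Omega>\<close> and lies within distance \<open>4 R\<close> of \<open>x\<close>.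
\<close>

lemma frac_killing:
  fixes \<Omega> :: "'a::euclidean_space set"
  assumes "bounded \<Omega>" and \<sigma>: "0 \<le> \<sigma>"
  shows "\<exists>c>0. \<forall>x\<in>\<Omega>. ennreal c \<le> (\<integral>\<^sup>+ y. ennreal (frac_kernel \<sigma> (x, y)) * indicator (- \<Omega>) y \<partial>lborel)"
proof -
  obtain R where R: "0 < R" "\<Omega> \<subseteq> ball 0 R"
    using bounded_subset_ballD[OF assms(1), of 0] by blast
  obtain b :: 'a where b: "b \<in> Basis" using nonempty_Basis by blast
  define k where "k = 1 / (4 * R) powr (real DIM('a) + \<sigma>)"
  define V where "V = unit_ball_vol (real DIM('a)) * R ^ DIM('a)"
  have k: "0 < k" and V: "0 < V" using R by (auto simp: k_def V_def)
  show ?thesis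
  proof (intro exI conjI ballI)
    show "0 < k * V" using k V by simp
    fix x assume x: "x \<in> \<Omega>"
    define c where "c = x + (3 * R) *\<^sub>R b"
    have far: "y \<notin> \<Omega> \<and> x \<noteq> y \<and> norm (x - y) \<le> 4 * R" if y: "y \<in> ball c R" for y
    proof -
      have "norm (c - y) < R" using y by (simp add: dist_norm)
      moreover have "norm (c - x) = 3 * R" using R b by (simp add: c_def)
      moreover have "norm (c - x) \<le> norm (c - y) + norm (x - y)"
        using norm_triangle_ineq4[of "c - y" "x - y"] by simp
      moreover have "norm (x - y) \<le> norm (c - x) + norm (c - y)"
        using norm_triangle_ineq4[of "c - y" "c - x"] by (simp add: norm_minus_commute add.commute)
      ultimately have n: "2 * R < norm (x - y)" "norm (x - y) \<le> 4 * R" by linarith+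
      have "norm x < R" using x R by auto
      moreover have "norm y < R" if "y \<in> \<Omega>" using that R by auto
      ultimately have "y \<notin> \<Omega>" using n(1) norm_triangle_ineq4[of x y] by force
      then show ?thesis using n R by auto
    qed
    have "ennreal (k * V) = ennreal k * emeasure lborel (ball c R)"
      using k V R by (simp add: emeasure_ball V_def ennreal_mult)
    also have "\<dots> = (\<integral>\<^sup>+ y. ennreal k * indicator (ball c R) y \<partial>lborel)"
      by (rule nn_integral_cmult_indicator[symmetric]) simp
    also have "\<dots> \<le> (\<integral>\<^sup>+ y. ennreal (frac_kernel \<sigma> (x, y)) * indicator (- \<Omega>) y \<partial>lborel)"
    proof (rule nn_integral_mono)
      fix y
      show "ennreal k * indicator (ball c R) y \<le> ennreal (frac_kernel \<sigma> (x, y)) * indicator (- \<Omega>) y"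
      proof (cases "y \<in> ball c R")
        case True
        note f = far[OF True]
        have "1 \<le> (4 * R) powr (real DIM('a) + \<sigma>) * frac_kernel \<sigma> (x, y)"
          using f \<sigma> by (intro frac_kernel_ge) auto
        then have "k \<le> frac_kernel \<sigma> (x, y)" using R by (simp add: k_def pos_divide_le_eq mult.commute)
        then show ?thesis using True f by (simp add: ennreal_leI)
      qed simp
    qed
    finally show "ennreal (k * V) \<le> (\<integral>\<^sup>+ y. ennreal (frac_kernel \<sigma> (x, y)) * indicator (- \<Omega>) y \<partial>lborel)" .
  qed
qed

locale fractional_form = nonlocal_form "lborel :: 'v::euclidean_space measure" "frac_kernel \<sigma>" \<Omega> p c0
  for \<sigma> :: real and \<Omega> :: "'v::euclidean_space set" and p c0 :: real +
  assumes sigma_pos: "0 < \<sigma>" and sigma_less: "\<sigma> < p"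
    and Omega_bounded: "bounded \<Omega>" and Omega_open: "open \<Omega>"
begin

definition avg :: "real \<Rightarrow> ('v \<Rightarrow> real) \<Rightarrow> 'v \<Rightarrow> real" where
  "avg h v x = (\<integral>y. indicator (cell h x) y * v y \<partial>lborel) / h ^ DIM('v)"

lemma avg_measurable [measurable]:
  assumes [measurable]: "v \<in> borel_measurable lborel"
  shows "avg h v \<in> borel_measurable lborel"
proof -
  note cell_measurable_pair[measurable]
  have "(\<lambda>z. indicator {z. snd z \<in> cell h (fst z)} z * v (snd z)) \<in> borel_measurable (lborel \<Otimes>\<^sub>M lborel)"
    by measurable
  also have "(\<lambda>z. indicator {z. snd z \<in> cell h (fst z)} z * v (snd z)) = (\<lambda>(x, y). indicator (cell h x) y * v y)"
    by (auto simp: fun_eq_iff indicator_def)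
  finally have "(\<lambda>x. \<integral>y. indicator (cell h x) y * v y \<partial>lborel) \<in> borel_measurable lborel"
    by (rule lborel.borel_measurable_lebesgue_integral)
  then show ?thesis unfolding avg_def[abs_def] by measurable
qed

text \<open>
  The difference between \<open>v x\<close> and the mean of \<open>v\<close> over the cube of \<open>x\<close> is a mean of increments of \<open>v\<close> within the
  cube, where the kernel is bounded below by a negative power of the diameter. The factor \<open>D\<close> is of order
  \<open>h powr \<sigma>\<close>, so the error tends to zero with \<open>h\<close>, uniformly for bounded energy.
\<close>

lemma avg_error:
  assumes v: "v \<in> W" and h: "0 < h" and e: "0 < \<epsilon>"
  defines "D \<equiv> (h * real DIM('v)) powr (real DIM('v) + \<sigma>) / h ^ DIM('v)"
  shows "integrable lborel (\<lambda>x. v x - avg h v x)"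
    "(\<integral>x. \<bar>v x - avg h v x\<bar> \<partial>lborel) \<le> 2 * \<epsilon> * measure lborel \<Omega> + \<epsilon> powr (1 - p) * D * E v"
proof -
  have [measurable]: "v \<in> borel_measurable lborel" by (rule W_measurable[OF v])
  note cell_measurable_pair[measurable]
  have iv: "integrable lborel v" by (rule W_integrable[OF v])
  let ?N = "h ^ DIM('v)"
  have N: "0 < ?N" using h by simp
  have D: "0 \<le> D" using h by (simp add: D_def)
  define k where "k z = indicator {z. snd z \<in> cell h (fst z)} z / ?N" for z :: "'v \<times> 'v"
  have [measurable]: "k \<in> borel_measurable (lborel \<Otimes>\<^sub>M lborel)" unfolding k_def by measurable
  have k_nn: "0 \<le> k z" for z using N by (simp add: k_def)
  have k_sym: "k (x, y) = k (y, x)" for x y using cell_sym[of y h x] by (simp add: k_def indicator_def)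
  have k_eq: "k (x, y) = indicator (cell h x) y / ?N" for x y by (simp add: k_def indicator_def)
  have k_int: "(\<integral>\<^sup>+ y. ennreal (k (x, y)) \<partial>lborel) = 1" for x
  proof -
    have "(\<integral>\<^sup>+ y. ennreal (k (x, y)) \<partial>lborel) = (\<integral>\<^sup>+ y. ennreal (1 / ?N) * indicator (cell h x) y \<partial>lborel)"
      by (intro nn_integral_cong) (simp add: k_eq indicator_def)
    also have "\<dots> = ennreal (1 / ?N) * ennreal ?N" by (subst nn_integral_cmult_indicator) (auto simp: emeasure_cell[OF h])
    also have "\<dots> = ennreal (1 / ?N * ?N)" using N by (intro ennreal_mult[symmetric]) auto
    also have "\<dots> = 1" using h by simp
    finally show ?thesis .
  qed
  define G1 where "G1 z = \<epsilon> * (k z * indicator \<Omega> (fst z))" for z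
  define G2 where "G2 z = \<epsilon> * (k z * indicator \<Omega> (snd z))" for z
  define G3 where "G3 z = \<epsilon> powr (1 - p) * D * gag v z" for z
  have G_nn: "0 \<le> G1 z" "0 \<le> G2 z" "0 \<le> G3 z" for z using e k_nn D gag_nonneg by (auto simp: G1_def G2_def G3_def)
  have [measurable]: "G1 \<in> borel_measurable (lborel \<Otimes>\<^sub>M lborel)" "G2 \<in> borel_measurable (lborel \<Otimes>\<^sub>M lborel)" "G3 \<in> borel_measurable (lborel \<Otimes>\<^sub>M lborel)"
    unfolding G1_def G2_def G3_def by measurable
  have pt: "k (x, y) * \<bar>v x - v y\<bar> \<le> G1 (x, y) + G2 (x, y) + G3 (x, y)" for x y
  proof (cases "y \<in> cell h x \<and> x \<noteq> y \<and> (x \<in> \<Omega> \<or> y \<in> \<Omega>)")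
    case True
    then have kN: "k (x, y) = 1 / ?N" by (simp add: k_eq)
    have "1 \<le> (h * real DIM('v)) powr (real DIM('v) + \<sigma>) * frac_kernel \<sigma> (x, y)"
      using True cell_diameter[OF h, of y x] sigma_pos by (intro frac_kernel_ge) auto
    then have "1 * \<bar>v x - v y\<bar> powr p \<le> ((h * real DIM('v)) powr (real DIM('v) + \<sigma>) * frac_kernel \<sigma> (x, y)) * \<bar>v x - v y\<bar> powr p"
      by (intro mult_right_mono) auto
    then have "\<bar>v x - v y\<bar> powr p / ?N \<le> ((h * real DIM('v)) powr (real DIM('v) + \<sigma>) * frac_kernel \<sigma> (x, y)) * \<bar>v x - v y\<bar> powr p / ?N"
      using N by (intro divide_right_mono) auto
    also have "\<dots> = D * gag v (x, y)" by (simp add: D_def gag_def)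
    finally have 1: "\<bar>v x - v y\<bar> powr p / ?N \<le> D * gag v (x, y)" .
    have "k (x, y) * \<bar>v x - v y\<bar> \<le> k (x, y) * (\<epsilon> + \<epsilon> powr (1 - p) * \<bar>v x - v y\<bar> powr p)"
      by (intro mult_left_mono abs_le_eps_powr p_ge_1 e k_nn)
    also have "\<dots> = \<epsilon> * k (x, y) + \<epsilon> powr (1 - p) * (\<bar>v x - v y\<bar> powr p / ?N)" by (simp add: kN distrib_left mult.commute)
    also have "\<dots> \<le> \<epsilon> * k (x, y) + \<epsilon> powr (1 - p) * (D * gag v (x, y))" using 1 by (intro add_left_mono mult_left_mono) auto
    also have "\<epsilon> * k (x, y) \<le> G1 (x, y) + G2 (x, y)" using True e k_nn[of "(x, y)"] by (auto simp: G1_def G2_def indicator_def)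
    finally show ?thesis by (simp add: G3_def mult.assoc)
  next
    case False
    then have "k (x, y) * \<bar>v x - v y\<bar> = 0" using W_zero[OF v] by (auto simp: k_eq indicator_def)
    then show ?thesis using G_nn[of "(x, y)"] by linarith
  qed
  have rep: "v x - avg h v x = (\<integral>y. k (x, y) * (v x - v y) \<partial>lborel)" "integrable lborel (\<lambda>y. k (x, y) * (v x - v y))" for x
  proof -
    have i1: "integrable lborel (\<lambda>y. indicator (cell h x) y * v x)"
      by (intro integrable_mult_left integrable_real_indicator) (auto simp: emeasure_cell[OF h])
    have i2: "integrable lborel (\<lambda>y. indicator (cell h x) y * v y)"
      by (rule Bochner_Integration.integrable_bound[OF iv]) (auto simp: indicator_def)
    have e: "k (x, y) * (v x - v y) = (indicator (cell h x) y * v x - indicator (cell h x) y * v y) / ?N" for y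
      by (simp add: k_eq right_diff_distrib diff_divide_distrib)
    show "integrable lborel (\<lambda>y. k (x, y) * (v x - v y))" unfolding e using i1 i2 by simp
    have m: "(\<integral>y. indicator (cell h x) y * v x \<partial>lborel) = ?N * v x"
      using h by (simp add: measure_def emeasure_cell)
    show "v x - avg h v x = (\<integral>y. k (x, y) * (v x - v y) \<partial>lborel)"
      unfolding e avg_def integral_divide_zero Bochner_Integration.integral_diff[OF i1 i2] m
      using h by (simp add: diff_divide_distrib)
  qed
  have "(\<integral>\<^sup>+ x. ennreal \<bar>v x - avg h v x\<bar> \<partial>lborel) \<le> (\<integral>\<^sup>+ x. (\<integral>\<^sup>+ y. ennreal (G1 (x, y) + G2 (x, y) + G3 (x, y)) \<partial>lborel) \<partial>lborel)"
  proof (rule nn_integral_mono)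
    fix x
    have "ennreal \<bar>v x - avg h v x\<bar> \<le> (\<integral>\<^sup>+ y. ennreal \<bar>k (x, y) * (v x - v y)\<bar> \<partial>lborel)"
      unfolding rep(1) using integral_norm_bound_ennreal[OF rep(2)[of x]] by simp
    also have "\<dots> \<le> (\<integral>\<^sup>+ y. ennreal (G1 (x, y) + G2 (x, y) + G3 (x, y)) \<partial>lborel)"
      using pt k_nn by (intro nn_integral_mono ennreal_leI) (simp add: abs_mult)
    finally show "ennreal \<bar>v x - avg h v x\<bar> \<le> (\<integral>\<^sup>+ y. ennreal (G1 (x, y) + G2 (x, y) + G3 (x, y)) \<partial>lborel)" .
  qed
  also have "\<dots> = (\<integral>\<^sup>+ z. ennreal (G1 z + G2 z + G3 z) \<partial>(lborel \<Otimes>\<^sub>M lborel))"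
    by (rule lborel.nn_integral_fst) measurable
  also have "\<dots> = (\<integral>\<^sup>+ z. ennreal (G1 z) \<partial>(lborel \<Otimes>\<^sub>M lborel)) + (\<integral>\<^sup>+ z. ennreal (G2 z) \<partial>(lborel \<Otimes>\<^sub>M lborel))
      + (\<integral>\<^sup>+ z. ennreal (G3 z) \<partial>(lborel \<Otimes>\<^sub>M lborel))"
    using G_nn by (simp add: ennreal_plus nn_integral_add)
  also have "(\<integral>\<^sup>+ z. ennreal (G1 z) \<partial>(lborel \<Otimes>\<^sub>M lborel)) = ennreal (\<epsilon> * measure lborel \<Omega>)"
  proof -
    have "(\<integral>\<^sup>+ z. ennreal (G1 z) \<partial>(lborel \<Otimes>\<^sub>M lborel)) = (\<integral>\<^sup>+ x. (\<integral>\<^sup>+ y. ennreal (G1 (x, y)) \<partial>lborel) \<partial>lborel)"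
      by (rule lborel.nn_integral_fst[symmetric]) measurable
    also have "\<dots> = (\<integral>\<^sup>+ x. ennreal \<epsilon> * indicator \<Omega> x \<partial>lborel)"
    proof (rule nn_integral_cong)
      fix x
      have "(\<integral>\<^sup>+ y. ennreal (G1 (x, y)) \<partial>lborel) = (\<integral>\<^sup>+ y. (ennreal \<epsilon> * indicator \<Omega> x) * ennreal (k (x, y)) \<partial>lborel)"
        using e k_nn by (intro nn_integral_cong) (simp add: G1_def ennreal_mult indicator_def)
      also have "\<dots> = ennreal \<epsilon> * indicator \<Omega> x" by (subst nn_integral_cmult) (auto simp: k_int)
      finally show "(\<integral>\<^sup>+ y. ennreal (G1 (x, y)) \<partial>lborel) = ennreal \<epsilon> * indicator \<Omega> x" .
    qed
    also have "\<dots> = ennreal (\<epsilon> * measure lborel \<Omega>)"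
      using Omega_finite Omega_sets e by (subst nn_integral_cmult_indicator) (auto simp: emeasure_eq_ennreal_measure ennreal_mult)
    finally show ?thesis .
  qed
  also have "(\<integral>\<^sup>+ z. ennreal (G2 z) \<partial>(lborel \<Otimes>\<^sub>M lborel)) = ennreal (\<epsilon> * measure lborel \<Omega>)"
  proof -
    have "(\<integral>\<^sup>+ z. ennreal (G2 z) \<partial>(lborel \<Otimes>\<^sub>M lborel)) = (\<integral>\<^sup>+ y. (\<integral>\<^sup>+ x. ennreal (G2 (x, y)) \<partial>lborel) \<partial>lborel)"
      by (rule lborel_pair.nn_integral_snd[symmetric]) measurable
    also have "\<dots> = (\<integral>\<^sup>+ x. ennreal \<epsilon> * indicator \<Omega> x \<partial>lborel)"
    proof (rule nn_integral_cong)
      fix y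
      have "(\<integral>\<^sup>+ x. ennreal (G2 (x, y)) \<partial>lborel) = (\<integral>\<^sup>+ x. (ennreal \<epsilon> * indicator \<Omega> y) * ennreal (k (y, x)) \<partial>lborel)"
        using e k_nn by (intro nn_integral_cong) (simp add: G2_def ennreal_mult indicator_def k_sym)
      also have "\<dots> = ennreal \<epsilon> * indicator \<Omega> y" by (subst nn_integral_cmult) (auto simp: k_int)
      finally show "(\<integral>\<^sup>+ x. ennreal (G2 (x, y)) \<partial>lborel) = ennreal \<epsilon> * indicator \<Omega> y" .
    qed
    also have "\<dots> = ennreal (\<epsilon> * measure lborel \<Omega>)"
      using Omega_finite Omega_sets e by (subst nn_integral_cmult_indicator) (auto simp: emeasure_eq_ennreal_measure ennreal_mult)
    finally show ?thesis .
  qed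
  also have "(\<integral>\<^sup>+ z. ennreal (G3 z) \<partial>(lborel \<Otimes>\<^sub>M lborel)) = ennreal (\<epsilon> powr (1 - p) * D * E v)"
  proof -
    have "integrable (lborel \<Otimes>\<^sub>M lborel) G3" unfolding G3_def using W_integrable_gag[OF v] by simp
    then have "(\<integral>\<^sup>+ z. ennreal (G3 z) \<partial>(lborel \<Otimes>\<^sub>M lborel)) = ennreal (\<integral>z. G3 z \<partial>(lborel \<Otimes>\<^sub>M lborel))"
      using G_nn by (intro nn_integral_eq_integral) auto
    then show ?thesis using W_integrable_gag[OF v] by (simp add: G3_def[abs_def] E_def)
  qed
  also have "ennreal (\<epsilon> * measure lborel \<Omega>) + ennreal (\<epsilon> * measure lborel \<Omega>) + ennreal (\<epsilon> powr (1 - p) * D * E v)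
     = ennreal (2 * \<epsilon> * measure lborel \<Omega> + \<epsilon> powr (1 - p) * D * E v)"
    using e D E_nonneg[of v] by (simp flip: ennreal_plus)
  finally have *: "(\<integral>\<^sup>+ x. ennreal \<bar>v x - avg h v x\<bar> \<partial>lborel) \<le> ennreal (2 * \<epsilon> * measure lborel \<Omega> + \<epsilon> powr (1 - p) * D * E v)" .
  show i: "integrable lborel (\<lambda>x. v x - avg h v x)"
    using * by (intro integrableI_bounded) (auto intro: le_less_trans)
  have "ennreal (\<integral>x. \<bar>v x - avg h v x\<bar> \<partial>lborel) \<le> ennreal (2 * \<epsilon> * measure lborel \<Omega> + \<epsilon> powr (1 - p) * D * E v)"
    using * i by (subst (asm) nn_integral_eq_integral) auto
  then show "(\<integral>x. \<bar>v x - avg h v x\<bar> \<partial>lborel) \<le> 2 * \<epsilon> * measure lborel \<Omega> + \<epsilon> powr (1 - p) * D * E v"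
    using e D E_nonneg[of v] by (subst (asm) ennreal_le_iff) auto
qed

end

section \<open>Compactness of the fractional energy\<close>

context fractional_form
begin

lemma avg_zero_far:
  assumes h: "0 < h" and v: "\<And>x. x \<notin> \<Omega> \<Longrightarrow> v x = 0" and R: "\<Omega> \<subseteq> ball 0 R" and x: "x \<notin> ball 0 (R + h * real DIM('v))"
  shows "avg h v x = 0"
proof -
  have "indicator (cell h x) y * v y = 0" for y
  proof (cases "y \<in> cell h x")
    case True
    have "norm (x - y) \<le> h * real DIM('v)" by (rule cell_diameter[OF h True])
    moreover have "R + h * real DIM('v) \<le> norm x" using x by simp
    ultimately have "R \<le> norm y" using norm_triangle_ineq2[of x y] by linarith
    then have "y \<notin> \<Omega>" using R by auto
    then show ?thesis by (simp add: v)
  qed simp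
  then have "(\<lambda>y. indicator (cell h x) y * v y) = (\<lambda>_. 0)" by (rule ext)
  then show ?thesis unfolding avg_def by (simp only:) simp
qed

text \<open>
  A diagonal subsequence makes the averages over all cubes of the grids with mesh \<open>1 / (k + 1)\<close> converge. For
  each mesh the averaged functions then converge in \<open>L\<^sup>1\<close>, and they are uniformly close to the original ones;
  so the subsequence is Cauchy in \<open>L\<^sup>1\<close>.
\<close>

lemma fractional_rellich:
  assumes u: "\<And>n. u n \<in> W" and C: "\<And>n. E (u n) \<le> C"
  shows "\<exists>r v. strict_mono (r :: nat \<Rightarrow> nat) \<and> integrable lborel v \<and> (\<forall>x. x \<notin> \<Omega> \<longrightarrow> v x = 0) \<and>
      (AE x in lborel. (\<lambda>n. u (r n) x) \<longlonglongrightarrow> v x) \<and> (\<lambda>n. \<integral>x. \<bar>u (r n) x - v x\<bar> \<partial>lborel) \<longlonglongrightarrow> 0"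
proof -
  have [measurable]: "u n \<in> borel_measurable lborel" for n by (rule W_measurable[OF u])
  have iu: "integrable lborel (u n)" for n by (rule W_integrable[OF u])
  have C0: "0 \<le> C" using C[of 0] E_nonneg[of "u 0"] by linarith
  define B where "B = 1 * measure lborel \<Omega> + 1 powr (1 - p) / c0 * C"
  have B: "(\<integral>x. \<bar>u n x\<bar> \<partial>lborel) \<le> B" for n
  proof -
    have "1 powr (1 - p) / c0 * E (u n) \<le> 1 powr (1 - p) / c0 * C" using c0_pos by (intro mult_left_mono C) auto
    then show ?thesis using L1_le_E[OF u, of 1 n] unfolding B_def by linarith
  qed
  define h where "h k = 1 / real (Suc k)" for k
  have h: "0 < h k" for k by (simp add: h_def)
  define S where "S = (\<Union>k. range (cell (h k) :: 'v \<Rightarrow> 'v set))"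
  have S: "countable S" unfolding S_def using countable_cells[OF h] by auto
  define I where "I n Q = (\<integral>y. indicator Q y * u n y \<partial>lborel)" for n and Q :: "'v set"
  have SB: "Q \<in> sets borel" if "Q \<in> S" for Q using that by (auto simp: S_def)
  have Ib: "norm (I n Q) \<le> B" if "Q \<in> S" for n Q
  proof -
    have [measurable]: "Q \<in> sets borel" by (rule SB[OF that])
    have "norm (I n Q) \<le> (\<integral>y. norm (indicator Q y * u n y) \<partial>lborel)" unfolding I_def by (rule integral_norm_bound)
    also have "\<dots> \<le> (\<integral>y. \<bar>u n y\<bar> \<partial>lborel)"
    proof (rule integral_mono)
      show "integrable lborel (\<lambda>y. norm (indicator Q y * u n y))"
        using iu[of n] by (intro Bochner_Integration.integrable_bound[OF iu[of n]] AE_I2) (auto simp: indicator_def)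
    qed (use iu in \<open>auto simp: indicator_def\<close>)
    finally show ?thesis using B[of n] by linarith
  qed
  obtain r where r: "strict_mono (r :: nat \<Rightarrow> nat)" and conv: "\<And>Q. Q \<in> S \<Longrightarrow> \<exists>l. (\<lambda>n. I (r n) Q) \<longlonglongrightarrow> l"
    by (rule function_convergent_subsequence[of S I B, OF S Ib]) (assumption, rule that)
  define U where "U n = u (r n)" for n
  have U: "U n \<in> W" "E (U n) \<le> C" and iU: "integrable lborel (U n)" for n using u C iu by (auto simp: U_def)
  have [measurable]: "U n \<in> borel_measurable lborel" for n by (rule W_measurable[OF U(1)])
  define g where "g k x = lim (\<lambda>n. avg (h k) (U n) x)" for k x
  have [measurable]: "g k \<in> borel_measurable lborel" for k unfolding g_def[abs_def] by measurable
  have glim: "(\<lambda>n. avg (h k) (U n) x) \<longlonglongrightarrow> g k x" for k x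
  proof -
    obtain l where "(\<lambda>n. I (r n) (cell (h k) x)) \<longlonglongrightarrow> l" using conv[of "cell (h k) x"] by (auto simp: S_def)
    then have "(\<lambda>n. I (r n) (cell (h k) x) / h k ^ DIM('v)) \<longlonglongrightarrow> l / h k ^ DIM('v)"
      by (intro tendsto_divide tendsto_const) (use h[of k] in auto)
    then have "(\<lambda>n. avg (h k) (U n) x) \<longlonglongrightarrow> l / h k ^ DIM('v)" by (simp add: avg_def I_def U_def)
    then show ?thesis unfolding g_def by (simp add: limI)
  qed
  have avgb: "\<bar>avg (h k) (U n) x\<bar> \<le> B / h k ^ DIM('v)" for k n x
  proof -
    have "\<bar>I (r n) (cell (h k) x)\<bar> \<le> B" using Ib[of "cell (h k) x" "r n"] by (auto simp: S_def)
    then have "\<bar>I (r n) (cell (h k) x)\<bar> / h k ^ DIM('v) \<le> B / h k ^ DIM('v)" using h[of k] by (intro divide_right_mono) auto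
    then show ?thesis using h[of k] by (simp add: avg_def I_def U_def abs_divide)
  qed
  have gb: "\<bar>g k x\<bar> \<le> B / h k ^ DIM('v)" for k x
    by (rule LIMSEQ_le_const2[OF tendsto_rabs[OF glim]]) (use avgb in auto)
  obtain R where R: "\<Omega> \<subseteq> ball 0 R" using bounded_subset_ballD[OF Omega_bounded, of 0] by blast
  define A where "A k = ball (0 :: 'v) (R + h k * real DIM('v))" for k
  have avg0: "avg (h k) (U n) x = 0" if "x \<notin> A k" for k n x
    using that by (intro avg_zero_far[OF h _ R] W_zero[OF U(1)]) (simp_all add: A_def)
  have g0: "g k x = 0" if "x \<notin> A k" for k x
    using avg0[OF that] by (simp add: g_def lim_const)
  have diffb: "\<bar>avg (h k) (U n) x - g k x\<bar> \<le> 2 * (B / h k ^ DIM('v)) * indicator (A k) x" for k n x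
    using avgb[of k n x] gb[of k x] avg0[of x k n] g0[of x k] by (cases "x \<in> A k") auto
  have domi: "integrable lborel (\<lambda>x. 2 * (B / h k ^ DIM('v)) * indicator (A k) x :: real)" for k
    by (intro integrable_mult_right integrable_real_indicator) (auto simp: A_def intro!: emeasure_bounded_finite[unfolded infinity_ennreal_def])
  have avgi: "integrable lborel (\<lambda>x. avg (h k) (U n) x - g k x)" for k n
  proof (rule Bochner_Integration.integrable_bound[OF domi[of k]])
    show "AE x in lborel. norm (avg (h k) (U n) x - g k x) \<le> norm (2 * (B / h k ^ DIM('v)) * indicator (A k) x)"
      unfolding real_norm_def by (intro AE_I2 order_trans[OF diffb abs_ge_self])
  qed measurable
  have avgL1: "(\<lambda>n. \<integral>x. \<bar>avg (h k) (U n) x - g k x\<bar> \<partial>lborel) \<longlonglongrightarrow> 0" for k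
  proof -
    have "(\<lambda>n. \<integral>x. \<bar>avg (h k) (U n) x - g k x\<bar> \<partial>lborel) \<longlonglongrightarrow> (\<integral>x. 0 \<partial>(lborel :: 'v measure))"
    proof (rule integral_dominated_convergence[OF _ _ domi[of k]])
      show "AE x in lborel. (\<lambda>n. \<bar>avg (h k) (U n) x - g k x\<bar>) \<longlonglongrightarrow> 0"
        using glim by (intro AE_I2 tendsto_rabs_zero LIM_zero) auto
      show "AE x in lborel. norm \<bar>avg (h k) (U n) x - g k x\<bar> \<le> 2 * (B / h k ^ DIM('v)) * indicator (A k) x" for n
        unfolding real_norm_def abs_idempotent by (intro AE_I2 diffb)
    qed measurable
    then show ?thesis by simp
  qed
  define D where "D k = (h k * real DIM('v)) powr (real DIM('v) + \<sigma>) / h k ^ DIM('v)" for k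
  have "D = (\<lambda>k. real DIM('v) powr (real DIM('v) + \<sigma>) * h k powr \<sigma>)"
  proof
    fix k show "D k = real DIM('v) powr (real DIM('v) + \<sigma>) * h k powr \<sigma>"
      using h[of k] by (simp add: D_def powr_mult powr_add powr_realpow)
  qed
  moreover have "(\<lambda>k. real DIM('v) powr (real DIM('v) + \<sigma>) * h k powr \<sigma>) \<longlonglongrightarrow> real DIM('v) powr (real DIM('v) + \<sigma>) * 0 powr \<sigma>"
    unfolding h_def using sigma_pos by (intro tendsto_mult tendsto_const tendsto_powr2 LIMSEQ_Suc[OF lim_1_over_n]) auto
  ultimately have D0: "D \<longlonglongrightarrow> 0" by simp
  have cauchy: "\<exists>N. \<forall>i\<ge>N. \<forall>j\<ge>N. (\<integral>x. norm (U i x - U j x) \<partial>lborel) < e" if e: "0 < e" for e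
  proof -
    define \<epsilon> where "\<epsilon> = e / (24 * (measure lborel \<Omega> + 1))"
    have mpos: "0 < measure lborel \<Omega> + 1" by (simp add: add_nonneg_pos)
    have ep: "0 < \<epsilon>" using e mpos by (simp add: \<epsilon>_def)
    have e1: "2 * \<epsilon> * measure lborel \<Omega> \<le> e / 12" using e mpos by (simp add: \<epsilon>_def field_simps)
    have "(\<lambda>k. \<epsilon> powr (1 - p) * D k * C) \<longlonglongrightarrow> \<epsilon> powr (1 - p) * 0 * C" by (intro tendsto_intros D0)
    then have "(\<lambda>k. \<epsilon> powr (1 - p) * D k * C) \<longlonglongrightarrow> 0" by simp
    then have "\<forall>\<^sub>F k in sequentially. \<epsilon> powr (1 - p) * D k * C < e / 12" using e by (intro order_tendstoD(2)) auto
    then obtain k where k: "\<epsilon> powr (1 - p) * D k * C < e / 12" by (auto simp: eventually_sequentially)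
    have Dk: "0 \<le> D k" using h[of k] by (simp add: D_def)
    have err: "(\<integral>x. \<bar>U i x - avg (h k) (U i) x\<bar> \<partial>lborel) \<le> e / 6" for i
    proof -
      have "\<epsilon> powr (1 - p) * D k * E (U i) \<le> \<epsilon> powr (1 - p) * D k * C" using Dk U(2) by (intro mult_left_mono) auto
      then show ?thesis using avg_error(2)[OF U(1) h ep, of i k] k e1 unfolding D_def by linarith
    qed
    have "\<forall>\<^sub>F n in sequentially. (\<integral>x. \<bar>avg (h k) (U n) x - g k x\<bar> \<partial>lborel) < e / 6"
      using e by (intro order_tendstoD(2)[OF avgL1]) auto
    then obtain N where N: "\<And>n. N \<le> n \<Longrightarrow> (\<integral>x. \<bar>avg (h k) (U n) x - g k x\<bar> \<partial>lborel) < e / 6"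
      by (auto simp: eventually_sequentially)
    show ?thesis
    proof (intro exI allI impI)
      fix i j assume ij: "N \<le> i" "N \<le> j"
      have ie: "integrable lborel (\<lambda>x. \<bar>U n x - avg (h k) (U n) x\<bar>)" for n
        by (intro integrable_abs avg_error(1)[OF U(1) h ep])
      have ia: "integrable lborel (\<lambda>x. \<bar>avg (h k) (U n) x - g k x\<bar>)" for n by (intro integrable_abs avgi)
      have "(\<integral>x. norm (U i x - U j x) \<partial>lborel) \<le> (\<integral>x. (\<bar>U i x - avg (h k) (U i) x\<bar> + \<bar>avg (h k) (U i) x - g k x\<bar>)
          + (\<bar>U j x - avg (h k) (U j) x\<bar> + \<bar>avg (h k) (U j) x - g k x\<bar>) \<partial>lborel)"
      proof (rule integral_mono)
        show "integrable lborel (\<lambda>x. norm (U i x - U j x))" using iU by simp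
        fix x
        have tri: "\<bar>a - d\<bar> \<le> (\<bar>a - b\<bar> + \<bar>b - c\<bar>) + (\<bar>d - b'\<bar> + \<bar>b' - c\<bar>)" for a b c d b' :: real by linarith
        show "norm (U i x - U j x) \<le> (\<bar>U i x - avg (h k) (U i) x\<bar> + \<bar>avg (h k) (U i) x - g k x\<bar>)
          + (\<bar>U j x - avg (h k) (U j) x\<bar> + \<bar>avg (h k) (U j) x - g k x\<bar>)"
          unfolding real_norm_def by (rule tri)
      qed (intro Bochner_Integration.integrable_add ie ia)
      also have "\<dots> = ((\<integral>x. \<bar>U i x - avg (h k) (U i) x\<bar> \<partial>lborel) + (\<integral>x. \<bar>avg (h k) (U i) x - g k x\<bar> \<partial>lborel))
          + ((\<integral>x. \<bar>U j x - avg (h k) (U j) x\<bar> \<partial>lborel) + (\<integral>x. \<bar>avg (h k) (U j) x - g k x\<bar> \<partial>lborel))"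
        using ie[of i] ie[of j] ia[of i] ia[of j] by simp
      also have "\<dots> < e" using err[of i] err[of j] N[OF ij(1)] N[OF ij(2)] e by linarith
      finally show "(\<integral>x. norm (U i x - U j x) \<partial>lborel) < e" .
    qed
  qed
  obtain r2 where r2: "strict_mono (r2 :: nat \<Rightarrow> nat)" and ae: "AE x in lborel. Cauchy (\<lambda>i. U (r2 i) x)"
    by (rule cauchy_L1_AE_cauchy_subseq[of lborel U, OF iU cauchy]) (assumption, rule that)
  define v where "v x = lim (\<lambda>i. U (r2 i) x)" for x
  have [measurable]: "v \<in> borel_measurable lborel" unfolding v_def[abs_def] by measurable
  have v0: "v x = 0" if "x \<notin> \<Omega>" for x using W_zero[OF U(1) that] by (simp add: v_def lim_const)
  have vlim: "AE x in lborel. (\<lambda>i. U (r2 i) x) \<longlonglongrightarrow> v x"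
    using ae by eventually_elim (simp add: v_def Cauchy_convergent_iff convergent_LIMSEQ_iff)
  have close: "\<exists>N. \<forall>i\<ge>N. (\<integral>\<^sup>+x. ennreal \<bar>U (r2 i) x - v x\<bar> \<partial>lborel) \<le> ennreal e" if e: "0 < e" for e
  proof -
    obtain N where N: "\<And>i j. N \<le> i \<Longrightarrow> N \<le> j \<Longrightarrow> (\<integral>x. norm (U i x - U j x) \<partial>lborel) < e" using cauchy[OF e] by blast
    have "(\<integral>\<^sup>+x. ennreal \<bar>U (r2 i) x - v x\<bar> \<partial>lborel) \<le> ennreal e" if i: "N \<le> i" for i
    proof -
      have "(\<integral>\<^sup>+x. ennreal \<bar>U (r2 i) x - v x\<bar> \<partial>lborel) \<le> (\<integral>\<^sup>+x. liminf (\<lambda>j. ennreal \<bar>U (r2 i) x - U (r2 j) x\<bar>) \<partial>lborel)"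
      proof (rule nn_integral_mono_AE)
        show "AE x in lborel. ennreal \<bar>U (r2 i) x - v x\<bar> \<le> liminf (\<lambda>j. ennreal \<bar>U (r2 i) x - U (r2 j) x\<bar>)"
          using vlim
        proof eventually_elim
          case (elim x)
          then have "liminf (\<lambda>j. ennreal \<bar>U (r2 i) x - U (r2 j) x\<bar>) = ennreal \<bar>U (r2 i) x - v x\<bar>"
            by (intro lim_imp_Liminf tendsto_ennrealI tendsto_rabs tendsto_diff tendsto_const) auto
          then show ?case by simp
        qed
      qed
      also have "\<dots> \<le> liminf (\<lambda>j. \<integral>\<^sup>+x. ennreal \<bar>U (r2 i) x - U (r2 j) x\<bar> \<partial>lborel)"
        by (rule nn_integral_liminf) measurable
      also have "\<dots> \<le> liminf (\<lambda>j. ennreal e)"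
      proof (rule Liminf_mono)
        show "\<forall>\<^sub>F j in sequentially. (\<integral>\<^sup>+x. ennreal \<bar>U (r2 i) x - U (r2 j) x\<bar> \<partial>lborel) \<le> ennreal e"
        proof (rule eventually_sequentiallyI[of N])
          fix j assume j: "N \<le> j"
          have "(\<integral>\<^sup>+x. ennreal \<bar>U (r2 i) x - U (r2 j) x\<bar> \<partial>lborel) = ennreal (\<integral>x. \<bar>U (r2 i) x - U (r2 j) x\<bar> \<partial>lborel)"
            using iU by (intro nn_integral_eq_integral) auto
          also have "\<dots> \<le> ennreal e"
            using N[of "r2 i" "r2 j"] i j seq_suble[OF r2, of i] seq_suble[OF r2, of j] by (intro ennreal_leI) auto
          finally show "(\<integral>\<^sup>+x. ennreal \<bar>U (r2 i) x - U (r2 j) x\<bar> \<partial>lborel) \<le> ennreal e" .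
        qed
      qed
      also have "\<dots> = ennreal e" by (intro lim_imp_Liminf tendsto_const) auto
      finally show ?thesis .
    qed
    then show ?thesis by blast
  qed
  have iv: "integrable lborel v"
  proof -
    obtain N where N: "(\<integral>\<^sup>+x. ennreal \<bar>U (r2 N) x - v x\<bar> \<partial>lborel) \<le> ennreal 1" using close[of 1] by auto
    then have "(\<integral>\<^sup>+x. ennreal (norm (U (r2 N) x - v x)) \<partial>lborel) < \<infinity>"
      unfolding real_norm_def by (rule le_less_trans) simp
    then have "integrable lborel (\<lambda>x. U (r2 N) x - v x)" by (intro integrableI_bounded) auto
    from Bochner_Integration.integrable_diff[OF iU[of "r2 N"] this] show ?thesis by simp
  qed
  have L1: "(\<lambda>i. \<integral>x. \<bar>U (r2 i) x - v x\<bar> \<partial>lborel) \<longlonglongrightarrow> 0"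
  proof (rule LIMSEQ_I)
    fix e :: real assume e: "0 < e"
    obtain N where N: "\<And>i. N \<le> i \<Longrightarrow> (\<integral>\<^sup>+x. ennreal \<bar>U (r2 i) x - v x\<bar> \<partial>lborel) \<le> ennreal (e / 2)"
      using close[of "e / 2"] e by auto
    show "\<exists>N. \<forall>i\<ge>N. norm ((\<integral>x. \<bar>U (r2 i) x - v x\<bar> \<partial>lborel) - 0) < e"
    proof (intro exI allI impI)
      fix i assume "N \<le> i"
      then have "ennreal (\<integral>x. \<bar>U (r2 i) x - v x\<bar> \<partial>lborel) \<le> ennreal (e / 2)"
        using N[of i] iU iv by (subst (asm) nn_integral_eq_integral) auto
      then have "(\<integral>x. \<bar>U (r2 i) x - v x\<bar> \<partial>lborel) \<le> e / 2" using e by (subst (asm) ennreal_le_iff) auto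
      moreover have "0 \<le> (\<integral>x. \<bar>U (r2 i) x - v x\<bar> \<partial>lborel)" by (rule integral_nonneg_AE) simp
      ultimately show "norm ((\<integral>x. \<bar>U (r2 i) x - v x\<bar> \<partial>lborel) - 0) < e" using e by simp
    qed
  qed
  show ?thesis
  proof (intro exI conjI allI impI)
    show "strict_mono (\<lambda>n. r (r2 n))" using r r2 by (simp add: strict_mono_def)
    show "integrable lborel v" by (rule iv)
    show "v x = 0" if "x \<notin> \<Omega>" for x using that by (rule v0)
    show "AE x in lborel. (\<lambda>n. u (r (r2 n)) x) \<longlonglongrightarrow> v x" using vlim by (simp add: U_def)
    show "(\<lambda>n. \<integral>x. \<bar>u (r (r2 n)) x - v x\<bar> \<partial>lborel) \<longlonglongrightarrow> 0" using L1 by (simp add: U_def)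
  qed
qed

end

sublocale fractional_form \<subseteq> compact_nonlocal_form "lborel :: 'v::euclidean_space measure" "frac_kernel \<sigma>" \<Omega> p c0
  by unfold_locales (rule fractional_rellich)

section \<open>Functions of finite fractional energy\<close>

text \<open>
  A function bounded by \<open>c j\<close> on the ball of radius \<open>\<rho> j\<close> contributes at most \<open>c j\<close> times the volume of that ball;
  the contributions form a geometric series.
\<close>

lemma nn_integral_geometric_cover:
  fixes x :: "'a::euclidean_space" and F :: "'a \<Rightarrow> ennreal"
  assumes q: "0 \<le> q" "q < 1" and A: "0 \<le> A" and c: "\<And>j. 0 \<le> c j" and \<rho>: "\<And>j. 0 \<le> \<rho> j"
    and geo: "\<And>j. c j * \<rho> j ^ DIM('a) \<le> A * q ^ j"
    and F: "\<And>y. F y = 0 \<or> (\<exists>j. F y \<le> ennreal (c j) \<and> y \<in> ball x (\<rho> j))"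
  shows "(\<integral>\<^sup>+ y. F y \<partial>lborel) \<le> ennreal (unit_ball_vol (real DIM('a)) * A / (1 - q))"
proof -
  have "(\<integral>\<^sup>+ y. F y \<partial>lborel) \<le> (\<integral>\<^sup>+ y. (\<Sum>j. ennreal (c j) * indicator (ball x (\<rho> j)) y) \<partial>lborel)"
  proof (rule nn_integral_mono)
    fix y
    show "F y \<le> (\<Sum>j. ennreal (c j) * indicator (ball x (\<rho> j)) y)"
      using F[of y]
    proof
      assume "\<exists>j. F y \<le> ennreal (c j) \<and> y \<in> ball x (\<rho> j)"
      then obtain j where j: "F y \<le> ennreal (c j)" "y \<in> ball x (\<rho> j)" by blast
      have "F y \<le> (\<Sum>i\<in>{j}. ennreal (c i) * indicator (ball x (\<rho> i)) y)" using j by simp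
      also have "\<dots> \<le> (\<Sum>i. ennreal (c i) * indicator (ball x (\<rho> i)) y)" by (rule sum_le_suminf) auto
      finally show ?thesis .
    qed simp
  qed
  also have "\<dots> = (\<Sum>j. \<integral>\<^sup>+ y. ennreal (c j) * indicator (ball x (\<rho> j)) y \<partial>lborel)"
    by (intro nn_integral_suminf borel_measurable_times_ennreal borel_measurable_const borel_measurable_indicator) auto
  also have "\<dots> \<le> (\<Sum>j. ennreal (unit_ball_vol (real DIM('a)) * A * q ^ j))"
  proof (rule suminf_le)
    fix j
    have "(\<integral>\<^sup>+ y. ennreal (c j) * indicator (ball x (\<rho> j)) y \<partial>lborel) = ennreal (c j) * emeasure lborel (ball x (\<rho> j))"
      by (rule nn_integral_cmult_indicator) simp
    also have "\<dots> = ennreal (unit_ball_vol (real DIM('a)) * (c j * \<rho> j ^ DIM('a)))"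
      using c \<rho> by (simp add: emeasure_ball mult_ac flip: ennreal_mult)
    also have "\<dots> \<le> ennreal (unit_ball_vol (real DIM('a)) * (A * q ^ j))"
      by (intro ennreal_leI mult_left_mono geo) simp
    finally show "(\<integral>\<^sup>+ y. ennreal (c j) * indicator (ball x (\<rho> j)) y \<partial>lborel) \<le> ennreal (unit_ball_vol (real DIM('a)) * A * q ^ j)"
      by (simp add: mult.assoc)
  qed auto
  also have "\<dots> = ennreal (unit_ball_vol (real DIM('a)) * A / (1 - q))"
  proof (rule suminf_ennreal_eq)
    have "(\<lambda>j. unit_ball_vol (real DIM('a)) * A * q ^ j) sums (unit_ball_vol (real DIM('a)) * A * (1 / (1 - q)))"
      using q by (intro sums_mult geometric_sums) simp
    then show "(\<lambda>j. unit_ball_vol (real DIM('a)) * A * q ^ j) sums (unit_ball_vol (real DIM('a)) * A / (1 - q))" by simp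
  qed (use q A in auto)
  finally show ?thesis .
qed

text \<open>The unit ball is divided into dyadic annuli.\<close>

lemma nn_integral_radial_near:
  fixes x :: "'a::euclidean_space"
  assumes \<alpha>: "0 < \<alpha>"
  shows "(\<integral>\<^sup>+ y. ennreal (norm (x - y) powr (\<alpha> - real DIM('a))) * indicator (ball x 1) y \<partial>lborel)
    \<le> ennreal (unit_ball_vol (real DIM('a)) * (2 powr (\<bar>\<alpha> - real DIM('a)\<bar> + real DIM('a))) / (1 - 2 powr (- \<alpha>)))"
proof (rule nn_integral_geometric_cover)
  let ?a = "\<alpha> - real DIM('a)"
  let ?c = "\<lambda>j. 2 powr (\<bar>?a\<bar> - real j * ?a)" and ?\<rho> = "\<lambda>j. 2 powr (1 - real j)"
  show "?c j * ?\<rho> j ^ DIM('a) \<le> 2 powr (\<bar>?a\<bar> + real DIM('a)) * (2 powr (- \<alpha>)) ^ j" for j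
  proof -
    have "?c j * ?\<rho> j ^ DIM('a) = 2 powr (\<bar>?a\<bar> - real j * ?a + (1 - real j) * real DIM('a))"
      by (simp add: powr_add powr_powr flip: powr_realpow)
    also have "\<bar>?a\<bar> - real j * ?a + (1 - real j) * real DIM('a) = (\<bar>?a\<bar> + real DIM('a)) + (- \<alpha>) * real j"
      by (simp add: algebra_simps)
    also have "2 powr \<dots> = 2 powr (\<bar>?a\<bar> + real DIM('a)) * (2 powr (- \<alpha>)) ^ j"
      by (simp only: powr_add) (simp add: powr_powr flip: powr_realpow)
    finally show ?thesis by simp
  qed
  fix y
  show "ennreal (norm (x - y) powr ?a) * indicator (ball x 1) y = 0 \<or>
    (\<exists>j. ennreal (norm (x - y) powr ?a) * indicator (ball x 1) y \<le> ennreal (?c j) \<and> y \<in> ball x (?\<rho> j))"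
  proof (cases "y \<in> ball x 1 \<and> x \<noteq> y")
    case True
    define r where "r = norm (x - y)"
    have r: "0 < r" "r < 1" using True by (auto simp: r_def dist_norm)
    define \<tau> where "\<tau> = - log 2 r"
    have \<tau>: "0 < \<tau>" using r by (simp add: \<tau>_def)
    have r\<tau>: "r = 2 powr (- \<tau>)" using r by (simp add: \<tau>_def)
    define j where "j = nat \<lfloor>\<tau>\<rfloor>"
    have j: "real j \<le> \<tau>" "\<tau> < real j + 1" using \<tau> by (auto simp: j_def)
    have "- \<tau> * ?a \<le> \<bar>?a\<bar> - real j * ?a"
    proof -
      have "(real j - \<tau>) * ?a \<le> \<bar>real j - \<tau>\<bar> * \<bar>?a\<bar>" by (metis abs_ge_self abs_mult)
      also have "\<dots> \<le> 1 * \<bar>?a\<bar>" using j by (intro mult_right_mono) auto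
      finally show ?thesis by (simp add: algebra_simps)
    qed
    then have "r powr ?a \<le> ?c j" unfolding r\<tau> powr_powr by (intro powr_mono) auto
    moreover have "r < ?\<rho> j" unfolding r\<tau> using j by (intro powr_less_mono) auto
    ultimately show ?thesis using True
      by (intro disjI2 exI[of _ j]) (auto simp: r_def dist_norm intro: ennreal_leI)
  qed auto
qed (use \<alpha> in \<open>auto simp: powr_less_one\<close>)

lemma nn_integral_radial_far:
  fixes x :: "'a::euclidean_space"
  assumes \<beta>: "0 < \<beta>"
  shows "(\<integral>\<^sup>+ y. ennreal (norm (x - y) powr (- \<beta> - real DIM('a))) * indicator (- ball x 1) y \<partial>lborel)
    \<le> ennreal (unit_ball_vol (real DIM('a)) * (2 powr real DIM('a)) / (1 - 2 powr (- \<beta>)))"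
proof (rule nn_integral_geometric_cover)
  let ?a = "- \<beta> - real DIM('a)"
  let ?c = "\<lambda>j. 2 powr (real j * ?a)" and ?\<rho> = "\<lambda>j. 2 powr (1 + real j)"
  show "?c j * ?\<rho> j ^ DIM('a) \<le> 2 powr real DIM('a) * (2 powr (- \<beta>)) ^ j" for j
  proof -
    have "?c j * ?\<rho> j ^ DIM('a) = 2 powr (real j * ?a + (1 + real j) * real DIM('a))"
      by (simp add: powr_add powr_powr distrib_right flip: powr_realpow)
    also have "real j * ?a + (1 + real j) * real DIM('a) = real DIM('a) + (- \<beta>) * real j"
      by (simp add: algebra_simps)
    also have "2 powr \<dots> = 2 powr real DIM('a) * (2 powr (- \<beta>)) ^ j"
      by (simp only: powr_add) (simp add: powr_powr flip: powr_realpow)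
    finally show ?thesis by simp
  qed
  fix y
  show "ennreal (norm (x - y) powr ?a) * indicator (- ball x 1) y = 0 \<or>
    (\<exists>j. ennreal (norm (x - y) powr ?a) * indicator (- ball x 1) y \<le> ennreal (?c j) \<and> y \<in> ball x (?\<rho> j))"
  proof (cases "y \<in> ball x 1")
    case False
    define r where "r = norm (x - y)"
    have r: "1 \<le> r" using False by (auto simp: r_def dist_norm)
    define \<tau> where "\<tau> = log 2 r"
    have \<tau>: "0 \<le> \<tau>" using r by (simp add: \<tau>_def)
    have r\<tau>: "r = 2 powr \<tau>" using r by (simp add: \<tau>_def)
    define j where "j = nat \<lfloor>\<tau>\<rfloor>"
    have j: "real j \<le> \<tau>" "\<tau> < real j + 1" using \<tau> by (auto simp: j_def)
    have "\<tau> * ?a \<le> real j * ?a" using j \<beta> by (intro mult_right_mono_neg) auto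
    then have "r powr ?a \<le> ?c j" unfolding r\<tau> powr_powr by (intro powr_mono) auto
    moreover have "r < ?\<rho> j" unfolding r\<tau> using j by (intro powr_less_mono) auto
    ultimately show ?thesis using False
      by (intro disjI2 exI[of _ j]) (auto simp: r_def dist_norm intro: ennreal_leI)
  qed auto
qed (use \<beta> in \<open>auto simp: powr_less_one\<close>)

context fractional_form
begin

text \<open>
  Near the diagonal the increments are at most \<open>|x - y|\<close>, and \<open>|x - y| powr (p - \<sigma> - N)\<close> is integrable since
  \<open>\<sigma> < p\<close>; far from it they are bounded, and \<open>|x - y| powr (- \<sigma> - N)\<close> is integrable at infinity. An
  increment vanishes unless one of the two points lies in \<open>\<Omega>\<close>, which has finite measure.
\<close>

lemma lipschitz_in_W:
  fixes \<phi> :: "'v \<Rightarrow> real"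
  assumes [measurable]: "\<phi> \<in> borel_measurable lborel" and zero: "\<And>x. x \<notin> \<Omega> \<Longrightarrow> \<phi> x = 0"
    and lip: "\<And>x y. \<bar>\<phi> x - \<phi> y\<bar> \<le> norm (x - y)" and bound: "\<And>x. \<bar>\<phi> x\<bar> \<le> B"
  shows "\<phi> \<in> W"
proof -
  have B: "0 \<le> B" using bound[of 0] by linarith
  let ?N = "real DIM('v)"
  define H :: "'v \<Rightarrow> 'v \<Rightarrow> ennreal" where "H x y = ennreal (norm (x - y) powr ((p - \<sigma>) - ?N)) * indicator (ball x 1) y
     + ennreal ((2 * B) powr p) * (ennreal (norm (x - y) powr (- \<sigma> - ?N)) * indicator (- ball x 1) y)" for x y
  have H_sym: "H x y = H y x" for x y by (simp add: H_def norm_minus_commute indicator_def dist_commute)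
  define C1 where "C1 = unit_ball_vol ?N * (2 powr (\<bar>(p - \<sigma>) - ?N\<bar> + ?N)) / (1 - 2 powr (- (p - \<sigma>)))"
  define C2 where "C2 = unit_ball_vol ?N * (2 powr ?N) / (1 - 2 powr (- \<sigma>))"
  define C where "C = ennreal C1 + ennreal ((2 * B) powr p) * ennreal C2"
  have C: "C < \<infinity>" by (simp add: C_def ennreal_mult_less_top)
  have HC: "(\<integral>\<^sup>+ y. H x y \<partial>lborel) \<le> C" for x
  proof -
    have "(\<integral>\<^sup>+ y. H x y \<partial>lborel) = (\<integral>\<^sup>+ y. ennreal (norm (x - y) powr ((p - \<sigma>) - ?N)) * indicator (ball x 1) y \<partial>lborel)
      + ennreal ((2 * B) powr p) * (\<integral>\<^sup>+ y. ennreal (norm (x - y) powr (- \<sigma> - ?N)) * indicator (- ball x 1) y \<partial>lborel)"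
    proof -
      have [measurable]: "ball x 1 \<in> sets borel" by simp
      have m: "(\<lambda>y. ennreal (norm (x - y) powr ((p - \<sigma>) - ?N)) * indicator (ball x 1) y) \<in> borel_measurable lborel"
        "(\<lambda>y. ennreal (norm (x - y) powr (- \<sigma> - ?N)) * indicator (- ball x 1) y) \<in> borel_measurable lborel"
        by measurable
      show ?thesis unfolding H_def
        by (subst nn_integral_add[OF m(1) borel_measurable_times_ennreal[OF borel_measurable_const m(2)]],
            subst nn_integral_cmult[OF m(2)]) (rule refl)
    qed
    also have "\<dots> \<le> C" unfolding C_def C1_def C2_def using sigma_pos sigma_less
      by (intro add_mono mult_left_mono nn_integral_radial_near nn_integral_radial_far) auto
    finally show ?thesis .
  qed
  have pt: "ennreal (gag \<phi> (x, y)) \<le> indicator \<Omega> x * H x y + indicator \<Omega> y * H x y" for x y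
  proof (cases "(x \<in> \<Omega> \<or> y \<in> \<Omega>) \<and> x \<noteq> y")
    case True
    define r where "r = norm (x - y)"
    have r: "0 < r" using True by (simp add: r_def)
    have k: "frac_kernel \<sigma> (x, y) = r powr (- \<sigma> - ?N)"
    proof -
      have e: "- \<sigma> - ?N = - (?N + \<sigma>)" by simp
      show ?thesis unfolding e powr_minus_divide by (simp add: frac_kernel_def r_def)
    qed
    have "ennreal (gag \<phi> (x, y)) \<le> H x y"
    proof (cases "y \<in> ball x 1")
      case near: True
      have "\<bar>\<phi> x - \<phi> y\<bar> powr p \<le> r powr p" using lip[of x y] p_pos by (intro powr_mono2) (auto simp: r_def)
      then have "gag \<phi> (x, y) \<le> r powr p * r powr (- \<sigma> - ?N)" unfolding gag_def k by (simp add: k mult_right_mono)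
      also have "\<dots> = r powr (p + (- \<sigma> - ?N))" by (simp only: powr_add)
      also have "p + (- \<sigma> - ?N) = (p - \<sigma>) - ?N" by simp
      finally show ?thesis using near by (simp add: H_def r_def ennreal_leI)
    next
      case far: False
      have "\<bar>\<phi> x - \<phi> y\<bar> \<le> 2 * B" using bound[of x] bound[of y] by linarith
      then have "\<bar>\<phi> x - \<phi> y\<bar> powr p \<le> (2 * B) powr p" using p_pos by (intro powr_mono2) auto
      then have "gag \<phi> (x, y) \<le> (2 * B) powr p * r powr (- \<sigma> - ?N)" unfolding gag_def k by (simp add: k mult_right_mono)
      then show ?thesis using far by (simp add: H_def r_def ennreal_leI flip: ennreal_mult)
    qed
    moreover have "H x y \<le> indicator \<Omega> x * H x y + indicator \<Omega> y * H x y"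
      using True by (auto simp: indicator_def)
    ultimately show ?thesis by (rule order_trans)
  next
    case False
    then have "gag \<phi> (x, y) = 0" using zero by (auto simp: gag_def)
    then show ?thesis by simp
  qed
  have Hm: "(\<lambda>z. H (fst z) (snd z)) \<in> borel_measurable (lborel \<Otimes>\<^sub>M lborel)"
  proof -
    have "{z \<in> space (lborel \<Otimes>\<^sub>M (lborel :: 'v measure)). norm (fst z - snd z) < 1} \<in> sets (lborel \<Otimes>\<^sub>M lborel)" by measurable
    then have [measurable]: "{z. norm (fst z - snd z :: 'v) < 1} \<in> sets (lborel \<Otimes>\<^sub>M lborel)" by (simp add: space_pair_measure)
    have "(\<lambda>z. H (fst z) (snd z)) = (\<lambda>z. ennreal (norm (fst z - snd z) powr ((p - \<sigma>) - ?N)) * indicator {z. norm (fst z - snd z) < 1} z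
     + ennreal ((2 * B) powr p) * (ennreal (norm (fst z - snd z) powr (- \<sigma> - ?N)) * indicator (- {z. norm (fst z - snd z) < 1}) z))"
      by (auto simp: H_def indicator_def dist_norm fun_eq_iff)
    then show ?thesis by simp
  qed
  have Hm': "(\<lambda>(x, y). H x y) \<in> borel_measurable (lborel \<Otimes>\<^sub>M lborel)" using Hm by (simp add: case_prod_beta)
  have Hm1: "(\<lambda>z. indicator \<Omega> (fst z) * H (fst z) (snd z)) \<in> borel_measurable (lborel \<Otimes>\<^sub>M lborel)"
    "(\<lambda>z. indicator \<Omega> (snd z) * H (fst z) (snd z)) \<in> borel_measurable (lborel \<Otimes>\<^sub>M lborel)"
    using Hm Omega_sets by auto
  have fst_int: "(\<integral>\<^sup>+ x. (\<integral>\<^sup>+ y. indicator \<Omega> x * H x y \<partial>lborel) \<partial>lborel) \<le> C * emeasure lborel \<Omega>"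
  proof -
    have m: "(\<lambda>y. H x y) \<in> borel_measurable lborel" for x
      using measurable_compose[OF measurable_Pair1' Hm, of x] by (simp add: space_pair_measure)
    have "(\<integral>\<^sup>+ x. (\<integral>\<^sup>+ y. indicator \<Omega> x * H x y \<partial>lborel) \<partial>lborel) \<le> (\<integral>\<^sup>+ x. C * indicator \<Omega> x \<partial>lborel)"
    proof (rule nn_integral_mono)
      fix x show "(\<integral>\<^sup>+ y. indicator \<Omega> x * H x y \<partial>lborel) \<le> C * indicator \<Omega> x"
        using HC[of x] m[of x] by (simp add: nn_integral_cmult indicator_def)
    qed
    also have "\<dots> = C * emeasure lborel \<Omega>" using Omega_sets by (intro nn_integral_cmult_indicator) auto
    finally show ?thesis .
  qed
  have "(\<integral>\<^sup>+ z. ennreal (gag \<phi> z) \<partial>(lborel \<Otimes>\<^sub>M lborel)) \<le>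
     (\<integral>\<^sup>+ z. indicator \<Omega> (fst z) * H (fst z) (snd z) + indicator \<Omega> (snd z) * H (fst z) (snd z) \<partial>(lborel \<Otimes>\<^sub>M lborel))"
    by (rule nn_integral_mono) (use pt in auto)
  also have "\<dots> = (\<integral>\<^sup>+ z. indicator \<Omega> (fst z) * H (fst z) (snd z) \<partial>(lborel \<Otimes>\<^sub>M lborel))
      + (\<integral>\<^sup>+ z. indicator \<Omega> (snd z) * H (fst z) (snd z) \<partial>(lborel \<Otimes>\<^sub>M lborel))"
    by (rule nn_integral_add[OF Hm1])
  also have "(\<integral>\<^sup>+ z. indicator \<Omega> (fst z) * H (fst z) (snd z) \<partial>(lborel \<Otimes>\<^sub>M lborel))
    = (\<integral>\<^sup>+ x. (\<integral>\<^sup>+ y. indicator \<Omega> x * H x y \<partial>lborel) \<partial>lborel)"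
    using lborel.nn_integral_fst[OF Hm1(1)] by simp
  also have "(\<integral>\<^sup>+ z. indicator \<Omega> (snd z) * H (fst z) (snd z) \<partial>(lborel \<Otimes>\<^sub>M lborel))
    = (\<integral>\<^sup>+ y. (\<integral>\<^sup>+ x. indicator \<Omega> y * H y x \<partial>lborel) \<partial>lborel)"
  proof -
    have mm: "(\<lambda>(x, y). indicator \<Omega> y * H x y) \<in> borel_measurable (lborel \<Otimes>\<^sub>M lborel)"
      using Hm1(2) by (simp add: case_prod_beta)
    have "(\<integral>\<^sup>+ z. indicator \<Omega> (snd z) * H (fst z) (snd z) \<partial>(lborel \<Otimes>\<^sub>M lborel))
      = (\<integral>\<^sup>+ (x, y). indicator \<Omega> y * H x y \<partial>(lborel \<Otimes>\<^sub>M lborel))"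
      by (intro nn_integral_cong) auto
    also have "\<dots> = (\<integral>\<^sup>+ y. (\<integral>\<^sup>+ x. indicator \<Omega> y * H x y \<partial>lborel) \<partial>lborel)"
      using lborel_pair.nn_integral_snd[OF mm] by simp
    also have "\<dots> = (\<integral>\<^sup>+ y. (\<integral>\<^sup>+ x. indicator \<Omega> y * H y x \<partial>lborel) \<partial>lborel)"
      by (intro nn_integral_cong arg_cong2[where f="(*)"] refl H_sym)
    finally show ?thesis .
  qed
  finally have "(\<integral>\<^sup>+ z. ennreal (gag \<phi> z) \<partial>(lborel \<Otimes>\<^sub>M lborel)) \<le> C * emeasure lborel \<Omega> + C * emeasure lborel \<Omega>"
    using fst_int by (meson add_mono order_trans)
  also have "\<dots> < \<infinity>" using C Omega_finite by (simp add: ennreal_mult_less_top)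
  finally have "integrable (lborel \<Otimes>\<^sub>M lborel) (gag \<phi>)"
    by (intro integrableI_nonneg) (auto simp: gag_nonneg)
  then show ?thesis using assms by (simp add: W_def)
qed

text \<open>The distance to the complement of \<open>A\<close>.\<close>

lemma bump_exists:
  assumes A: "open A" "A \<subseteq> \<Omega>"
  shows "\<exists>\<phi> B. \<phi> \<in> W \<and> (\<forall>x. 0 \<le> \<phi> x \<and> \<phi> x \<le> B) \<and> (\<forall>x. 0 < \<phi> x \<longleftrightarrow> x \<in> A)"
proof -
  have bA: "bounded A" using Omega_bounded A by (meson bounded_subset)
  then have "A \<noteq> UNIV" using not_bounded_UNIV by auto
  then obtain z where z: "z \<notin> A" by blast
  obtain R where R: "A \<subseteq> ball z R" using bounded_subset_ballD[OF bA, of z] by blast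
  define \<phi> where "\<phi> x = infdist x (- A)" for x
  have pos: "0 < \<phi> x \<longleftrightarrow> x \<in> A" for x
    using infdist_pos_not_in_closed[of "- A" x] A(1) z infdist_zero[of x "- A"]
    by (cases "x \<in> A") (auto simp: \<phi>_def closed_def)
  have nn: "0 \<le> \<phi> x" for x by (simp add: \<phi>_def infdist_nonneg)
  have ub: "\<phi> x \<le> \<bar>R\<bar>" for x
  proof (cases "x \<in> A")
    case True
    have "\<phi> x \<le> dist x z" unfolding \<phi>_def using z by (intro infdist_le) auto
    also have "\<dots> \<le> \<bar>R\<bar>" using True R by (force simp: dist_commute)
    finally show ?thesis .
  next
    case False
    then show ?thesis using pos[of x] nn[of x] by linarith
  qed
  have "continuous_on UNIV \<phi>" unfolding \<phi>_def by (intro continuous_intros)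
  then have m: "\<phi> \<in> borel_measurable lborel" by (simp add: borel_measurable_continuous_onI)
  have "\<phi> \<in> W"
  proof (rule lipschitz_in_W[OF m])
    show "\<phi> x = 0" if "x \<notin> \<Omega>" for x using pos[of x] nn[of x] that A(2) by force
    show "\<bar>\<phi> x - \<phi> y\<bar> \<le> norm (x - y)" for x y
      using infdist_triangle_abs[of x "- A" y] by (simp add: \<phi>_def dist_norm)
    show "\<bar>\<phi> x\<bar> \<le> \<bar>R\<bar>" for x using nn[of x] ub[of x] by simp
  qed
  then show ?thesis using nn ub pos by blast
qed

lemma bump_not_null:
  fixes A :: "'v set"
  assumes A: "open A" "A \<noteq> {}" and \<phi>: "\<And>x. x \<in> A \<Longrightarrow> 0 < (\<phi> x :: real)"
  shows "\<not> (AE x in lborel. \<phi> x = 0)"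
proof
  assume "AE x in lborel. \<phi> x = 0"
  then have ae: "AE x in lborel. x \<notin> A" by eventually_elim (use \<phi> in force)
  obtain x e where e: "0 < e" "ball x e \<subseteq> A" using A open_contains_ball by blast
  from ae have "AE y in lborel. y \<notin> ball x e" by eventually_elim (use e in blast)
  then have "emeasure lborel (ball x e) = 0"
    by (subst (asm) AE_iff_measurable[of "ball x e"]) (simp_all add: set_eq_iff)
  then show False using e unit_ball_vol_pos[of "real DIM('v)"] by (simp add: emeasure_ball)
qed

end

section \<open>The truncated nonlinearity\<close>

text \<open>
  The odd power function \<open>sgn t * |t| powr a\<close>, written so that monotonicity and continuity are those of \<open>powr\<close>
  on the half line.
\<close>

definition spow :: "real \<Rightarrow> real \<Rightarrow> real" where
  "spow a t = max 0 t powr a - max 0 (- t) powr a"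

lemma spow_eq: "\<bar>t\<bar> powr (a - 1) * t = spow a t"
proof (cases "0 \<le> t")
  case True
  then show ?thesis by (simp add: spow_def powr_mult_base mult.commute max_def)
next
  case False
  then have "(- t) * (- t) powr (a - 1) = (- t) powr (1 + (a - 1))" by (intro powr_mult_base) simp
  moreover have "1 + (a - 1) = a" by simp
  ultimately have "(- t) * (- t) powr (a - 1) = (- t) powr a" by (simp only:)
  with False show ?thesis by (simp add: spow_def mult.commute max_def)
qed

lemma spow_minus: "spow a (- t) = - spow a t"
  by (simp add: spow_def)

lemma spow_pos: "0 \<le> t \<Longrightarrow> spow a t = t powr a"
  by (simp add: spow_def max_def)

lemma spow_mono: "0 \<le> a \<Longrightarrow> s \<le> t \<Longrightarrow> spow a s \<le> spow a t"
  unfolding spow_def by (intro diff_mono powr_mono2) auto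

lemma abs_spow: "\<bar>spow a t\<bar> = \<bar>t\<bar> powr a"
  by (simp add: spow_def max_def)

lemma continuous_spow: "0 < a \<Longrightarrow> continuous_on S (spow a)"
  unfolding spow_def[abs_def] by (intro continuous_intros continuous_on_powr') auto

lemma spow_borel [measurable]: "spow a \<in> borel_measurable borel"
  unfolding spow_def[abs_def] by measurable

definition clamp1 :: "real \<Rightarrow> real \<Rightarrow> real" where
  "clamp1 \<delta> t = max (- \<delta>) (min \<delta> t)"

definition trunc_power :: "real \<Rightarrow> real \<Rightarrow> real \<Rightarrow> real \<Rightarrow> real \<Rightarrow> real" where
  "trunc_power \<mu> q r \<delta> t = \<mu> * spow q (clamp1 \<delta> t) + spow r (clamp1 \<delta> t)"

lemma clamp1_simps:
  assumes "0 < \<delta>"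
  shows "\<bar>t\<bar> \<le> \<delta> \<Longrightarrow> clamp1 \<delta> t = t" "0 \<le> t \<Longrightarrow> clamp1 \<delta> t = min \<delta> t" "clamp1 \<delta> (- t) = - clamp1 \<delta> t"
    "clamp1 \<delta> t \<in> {- \<delta>..\<delta>}" "\<bar>clamp1 \<delta> a - clamp1 \<delta> b\<bar> \<le> \<bar>a - b\<bar>"
  using assms by (auto simp: clamp1_def)

lemma clamp1_mono: "s \<le> t \<Longrightarrow> clamp1 \<delta> s \<le> clamp1 \<delta> t"
  by (auto simp: clamp1_def)

text \<open>
  The condition \<open>small\<close> says that the derivative of \<open>\<mu> t powr (q - (p - 1)) + t powr (r - (p - 1))\<close> is
  not positive at \<open>t = \<delta>\<close>, and hence negative before.
\<close>

locale trunc_param =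
  fixes \<mu> q r \<delta> p :: real
  assumes mu: "0 < \<mu>" and q: "0 < q" "q < p - 1" and r: "p - 1 < r" and delta: "0 < \<delta>"
    and small: "(r - (p - 1)) * \<delta> powr (r - q) \<le> \<mu> * (p - 1 - q)"
begin

abbreviation "f \<equiv> trunc_power \<mu> q r \<delta>"

lemma r_pos: "0 < r"
  using q r by linarith

lemma f_inside: "\<bar>t\<bar> \<le> \<delta> \<Longrightarrow> f t = \<mu> * spow q t + spow r t"
  by (simp add: trunc_power_def clamp1_simps[OF delta])

lemma f_nonneg_eq: "0 \<le> t \<Longrightarrow> f t = \<mu> * min \<delta> t powr q + min \<delta> t powr r"
  using delta by (simp add: trunc_power_def clamp1_simps(2)[OF delta] spow_pos)

lemma f_odd: "f (- t) = - f t"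
  by (simp add: trunc_power_def clamp1_simps[OF delta] spow_minus)

lemma f_mono: "s \<le> t \<Longrightarrow> f s \<le> f t"
  unfolding trunc_power_def using mu q r_pos
  by (intro add_mono mult_left_mono spow_mono clamp1_mono) auto

lemma f_bound: "\<bar>f t\<bar> \<le> \<mu> * \<delta> powr q + \<delta> powr r"
proof -
  have "\<bar>clamp1 \<delta> t\<bar> \<le> \<delta>" using clamp1_simps(4)[OF delta, of t] by auto
  then have "\<bar>clamp1 \<delta> t\<bar> powr q \<le> \<delta> powr q" "\<bar>clamp1 \<delta> t\<bar> powr r \<le> \<delta> powr r"
    using q r_pos by (auto intro!: powr_mono2)
  then have "\<mu> * \<bar>clamp1 \<delta> t\<bar> powr q + \<bar>clamp1 \<delta> t\<bar> powr r \<le> \<mu> * \<delta> powr q + \<delta> powr r"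
    using mu by (intro add_mono mult_left_mono) auto
  moreover have "\<bar>f t\<bar> \<le> \<bar>\<mu> * spow q (clamp1 \<delta> t)\<bar> + \<bar>spow r (clamp1 \<delta> t)\<bar>"
    unfolding trunc_power_def by (rule abs_triangle_ineq)
  ultimately show ?thesis using mu by (simp add: abs_mult abs_spow)
qed

lemma continuous_inside: "continuous_on S (\<lambda>t. \<mu> * spow q t + spow r t)"
  using q r_pos by (intro continuous_intros continuous_spow) auto

lemma f_continuous: "continuous_on UNIV f"
proof -
  have "continuous_on UNIV (\<lambda>t. (\<lambda>t. \<mu> * spow q t + spow r t) (clamp1 \<delta> t))"
    by (rule continuous_on_compose2[OF continuous_inside[of UNIV]])
       (auto simp: clamp1_def[abs_def] intro!: continuous_intros)
  then show ?thesis by (simp add: trunc_power_def[abs_def])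
qed

lemma f_almost_lipschitz:
  assumes e: "0 < \<epsilon>"
  shows "\<exists>C\<ge>0. \<forall>a b. \<bar>f a - f b\<bar> \<le> \<epsilon> + C * \<bar>a - b\<bar>"
proof -
  let ?g = "\<lambda>t. \<mu> * spow q t + spow r t"
  have "uniformly_continuous_on {- \<delta>..\<delta>} ?g"
    by (intro compact_uniformly_continuous continuous_inside) simp
  then obtain d where d: "0 < d" "\<And>x y. x \<in> {- \<delta>..\<delta>} \<Longrightarrow> y \<in> {- \<delta>..\<delta>} \<Longrightarrow> dist x y < d \<Longrightarrow> dist (?g x) (?g y) < \<epsilon>"
    using e unfolding uniformly_continuous_on_def by metis
  define M where "M = \<mu> * \<delta> powr q + \<delta> powr r"
  have M: "0 \<le> M" using mu by (simp add: M_def)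
  show ?thesis
  proof (intro exI conjI allI)
    show "0 \<le> 2 * M / d" using M d by simp
    fix a b
    show "\<bar>f a - f b\<bar> \<le> \<epsilon> + 2 * M / d * \<bar>a - b\<bar>"
    proof (cases "\<bar>a - b\<bar> < d")
      case True
      then have "dist (clamp1 \<delta> a) (clamp1 \<delta> b) < d"
        using clamp1_simps(5)[OF delta, of a b] by (simp add: dist_real_def)
      then have "dist (?g (clamp1 \<delta> a)) (?g (clamp1 \<delta> b)) < \<epsilon>" by (intro d clamp1_simps(4)[OF delta])
      then have "\<bar>f a - f b\<bar> < \<epsilon>" by (simp add: dist_real_def trunc_power_def)
      moreover have "0 \<le> 2 * M / d * \<bar>a - b\<bar>" using M d by simp
      ultimately show ?thesis by linarith
    next
      case False
      have "\<bar>f a\<bar> \<le> M" "\<bar>f b\<bar> \<le> M" unfolding M_def by (rule f_bound)+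
      then have "\<bar>f a - f b\<bar> \<le> 2 * M" by linarith
      also have "2 * M = 2 * M / d * d" using d by simp
      also have "\<dots> \<le> 2 * M / d * \<bar>a - b\<bar>" using False M d by (intro mult_left_mono) auto
      finally show ?thesis using e by linarith
    qed
  qed
qed

lemma f_pos: "0 < t \<Longrightarrow> 0 < f t"
  using mu delta by (simp add: f_nonneg_eq add_pos_nonneg)

lemma ratio_decreasing:
  assumes st: "0 < s" "s < t" "t \<le> \<delta>"
  shows "\<mu> * t powr (q - (p - 1)) + t powr (r - (p - 1)) < \<mu> * s powr (q - (p - 1)) + s powr (r - (p - 1))"
proof (rule DERIV_neg_imp_decreasing_open[OF st(2)])
  let ?w = "p - 1 - q" and ?b = "r - (p - 1)"
  fix x assume x: "s < x" "x < t"
  have x0: "0 < x" using x st by linarith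
  have D: "((\<lambda>x. \<mu> * x powr (q - (p - 1)) + x powr ?b) has_real_derivative
      \<mu> * ((q - (p - 1)) * x powr (q - (p - 1) - 1)) + ?b * x powr (?b - 1)) (at x)"
    using x0 by (auto intro!: derivative_eq_intros)
  have "?b * x powr (r - q) < ?b * \<delta> powr (r - q)"
    using x x0 st q r by (intro mult_strict_left_mono powr_less_mono2) auto
  then have "?b * x powr (r - q) < \<mu> * ?w" using small by linarith
  then have "?b * x powr (r - q) * x powr (q - (p - 1) - 1) < \<mu> * ?w * x powr (q - (p - 1) - 1)"
    using x0 by (intro mult_strict_right_mono) auto
  moreover have "x powr (r - q) * x powr (q - (p - 1) - 1) = x powr (?b - 1)"
    by (simp add: algebra_simps flip: powr_add)
  ultimately have "?b * x powr (?b - 1) < \<mu> * ?w * x powr (q - (p - 1) - 1)" by (simp only: mult.assoc)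
  then have "\<mu> * ((q - (p - 1)) * x powr (q - (p - 1) - 1)) + ?b * x powr (?b - 1) < 0"
    by (simp add: algebra_simps)
  with D show "\<exists>y. ((\<lambda>x. \<mu> * x powr (q - (p - 1)) + x powr ?b) has_real_derivative y) (at x) \<and> y < 0" by blast
next
  show "continuous_on {s..t} (\<lambda>x. \<mu> * x powr (q - (p - 1)) + x powr (r - (p - 1)))"
    using st by (intro continuous_intros) auto
qed

lemma ratio_inside:
  assumes "0 < x" "x \<le> \<delta>"
  shows "f x / x powr (p - 1) = \<mu> * x powr (q - (p - 1)) + x powr (r - (p - 1))"
proof -
  have "f x = \<mu> * x powr q + x powr r" using assms by (simp add: f_nonneg_eq min_def)
  then show ?thesis by (simp only: powr_diff[of x q "p - 1"] powr_diff[of x r "p - 1"] add_divide_distrib times_divide_eq_right)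
qed

text \<open>Inside the level \<open>\<delta>\<close> this is \<open>ratio_decreasing\<close>; beyond it the numerator is constant.\<close>

lemma f_decr:
  assumes st: "0 < s" "s < t"
  shows "f t / t powr (p - 1) < f s / s powr (p - 1)"
proof -
  have out: "f y / y powr (p - 1) < f x / x powr (p - 1)" if "\<delta> \<le> x" "x < y" for x y
  proof -
    have "f y = f x" using that delta by (simp add: f_nonneg_eq min_def)
    moreover have "x powr (p - 1) < y powr (p - 1)" using that delta q by (intro powr_less_mono2) auto
    moreover have "0 < f x" using that delta by (intro f_pos) auto
    moreover have "0 < x powr (p - 1)" using that delta by simp
    ultimately show ?thesis by (simp only:) (intro divide_strict_left_mono mult_pos_pos; linarith)
  qed
  have ins: "f y / y powr (p - 1) < f x / x powr (p - 1)" if "0 < x" "x < y" "y \<le> \<delta>" for x y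
    using ratio_decreasing[OF that] that by (simp add: ratio_inside)
  consider "t \<le> \<delta>" | "\<delta> \<le> s" | "s < \<delta>" "\<delta> < t" by linarith
  then show ?thesis
  proof cases
    case 3
    then show ?thesis using ins[of s \<delta>] out[of \<delta> t] st by simp
  qed (use ins out st in auto)
qed

lemma ex_primitive: "\<exists>F. (\<forall>t. (F has_real_derivative f t) (at t)) \<and> F 0 = 0"
proof -
  have "\<exists>F. \<forall>x. -\<infinity> < ereal x \<longrightarrow> ereal x < \<infinity> \<longrightarrow> (F has_vector_derivative f x) (at x)"
    by (rule einterval_antiderivative)
       (use f_continuous in \<open>auto simp: continuous_on_eq_continuous_at\<close>)
  then obtain F where "\<And>x. (F has_vector_derivative f x) (at x)" by auto
  then have F: "(F has_real_derivative f x) (at x)" for x by (simp add: has_real_derivative_iff_has_vector_derivative)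
  then have "((\<lambda>x. F x - F 0) has_real_derivative f x) (at x)" for x
    by (auto intro!: derivative_eq_intros)
  then show ?thesis by (intro exI[of _ "\<lambda>x. F x - F 0"]) auto
qed

lemma primitive_lower:
  assumes F: "\<And>t. (F has_real_derivative f t) (at t)" and F0: "F 0 = 0" and t: "0 \<le> t" "t \<le> \<delta>"
  shows "\<mu> / (q + 1) * t powr (q + 1) \<le> F t"
proof -
  let ?H = "\<lambda>t. F t - \<mu> / (q + 1) * t powr (q + 1)"
  have "?H 0 \<le> ?H t"
  proof (rule DERIV_nonneg_imp_increasing_open[OF t(1)])
    fix x assume x: "0 < x" "x < t"
    have "(?H has_real_derivative (f x - \<mu> * x powr q)) (at x)"
      using x q by (auto intro!: derivative_eq_intros F)
    moreover have "0 \<le> f x - \<mu> * x powr q" using x t by (simp add: f_nonneg_eq min_def)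
    ultimately show "\<exists>y. (?H has_real_derivative y) (at x) \<and> 0 \<le> y" by blast
  next
    show "continuous_on {0..t} ?H"
      using q by (intro continuous_intros continuous_on_powr' continuous_at_imp_continuous_on ballI DERIV_isCont[OF F]) auto
  qed
  then show ?thesis using F0 by simp
qed

end

text \<open>
  Let \<open>b\<close> be \<open>p\<^sub>s\<^sup>* - p\<close> and \<open>w\<close> be \<open>p - 1 - q\<close>. Take the largest \<open>\<delta>\<close> allowed by the first inequality. With
  \<open>\<theta> = b / (b + w)\<close>, the left side of the second inequality is then at most
  \<open>2 \<mu> powr \<theta> * (b / w) powr (1 - \<theta>)\<close>. The exponent \<open>1 - \<theta>\<close> is at most \<open>w / b\<close>, and \<open>y powr (1 / y) \<le> exp 1\<close>;
  so the bound is at most \<open>2 exp 1 * sqrt \<mu>\<close>, uniformly in \<open>w\<close>.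
\<close>

lemma truncation_level_exists:
  assumes b: "0 < (b::real)" and k: "0 < (k::real)"
  shows "\<exists>\<mu>0>0. \<exists>w0>0. \<forall>\<mu> w. 0 < \<mu> \<and> \<mu> < \<mu>0 \<and> 0 < w \<and> w < w0 \<longrightarrow>
    (\<exists>\<delta>>0. b * \<delta> powr (b + w) \<le> \<mu> * w \<and> \<mu> * \<delta> powr (- w) + \<delta> powr b \<le> k)"
proof -
  define \<mu>0 where "\<mu>0 = min 1 ((k / (2 * exp 1))\<^sup>2)"
  have "0 < \<mu>0" using k by (simp add: \<mu>0_def)
  moreover have "\<exists>\<delta>>0. b * \<delta> powr (b + w) \<le> \<mu> * w \<and> \<mu> * \<delta> powr (- w) + \<delta> powr b \<le> k"
    if \<mu>: "0 < \<mu>" "\<mu> < \<mu>0" and w: "0 < w" "w < b" for \<mu> w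
  proof -
    define \<delta> where "\<delta> = (\<mu> * w / b) powr (1 / (b + w))"
    define \<theta> where "\<theta> = b / (b + w)"
    have d: "0 < \<delta>" using \<mu> w b by (simp add: \<delta>_def)
    have th: "1 / 2 \<le> \<theta>" "1 - \<theta> \<le> w / b" "0 \<le> 1 - \<theta>"
    proof -
      show "1 / 2 \<le> \<theta>" "0 \<le> 1 - \<theta>" using w b by (auto simp: \<theta>_def field_simps)
      have "1 - \<theta> = w / (b + w)" using w b by (simp add: \<theta>_def field_simps)
      also have "\<dots> \<le> w / b" using w b by (intro divide_left_mono) auto
      finally show "1 - \<theta> \<le> w / b" .
    qed
    have dbw: "\<delta> powr (b + w) = \<mu> * w / b" using \<mu> w b by (simp add: \<delta>_def powr_powr)
    have "\<delta> powr b = \<delta> powr (b + w) * \<delta> powr (- w)" by (simp flip: powr_add)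
    then have "\<mu> * \<delta> powr (- w) = b / w * \<delta> powr b" using dbw \<mu> w b by (simp add: field_simps)
    then have "\<mu> * \<delta> powr (- w) + \<delta> powr b = (b / w + 1) * \<delta> powr b" by (simp add: distrib_right)
    also have "\<dots> \<le> (2 * (b / w)) * \<delta> powr b" using w b by (intro mult_right_mono) (auto simp: field_simps)
    also have "(2 * (b / w)) * \<delta> powr b = 2 * \<mu> powr \<theta> * (b / w) powr (1 - \<theta>)"
    proof -
      have "\<delta> powr b = (\<mu> * (w / b)) powr \<theta>" by (simp add: \<delta>_def \<theta>_def powr_powr)
      also have "\<dots> = \<mu> powr \<theta> * (w / b) powr \<theta>" by (rule powr_mult)
      finally have db: "\<delta> powr b = \<mu> powr \<theta> * (w / b) powr \<theta>" .
      have "(w / b) powr \<theta> = (b / w) powr (- \<theta>)"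
        using powr_minus_divide[of "b / w" \<theta>] w b by (simp add: powr_divide)
      moreover have "b / w * (b / w) powr (- \<theta>) = (b / w) powr (1 + (- \<theta>))"
        using w b by (intro powr_mult_base) auto
      ultimately have "2 * (b / w) * (\<mu> powr \<theta> * (w / b) powr \<theta>) = 2 * \<mu> powr \<theta> * (b / w) powr (1 + (- \<theta>))"
        by (simp only: mult_ac)
      then show ?thesis unfolding db by simp
    qed
    also have "\<dots> \<le> 2 * \<mu> powr (1 / 2) * exp 1"
    proof (intro mult_mono)
      show "\<mu> powr \<theta> \<le> \<mu> powr (1 / 2)" using th \<mu> by (intro powr_mono') (auto simp: \<mu>0_def)
      have bw: "1 \<le> b / w" using w by (simp add: field_simps)
      have "(b / w) powr (1 - \<theta>) \<le> (b / w) powr (w / b)" using th bw by (intro powr_mono) auto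
      also have "\<dots> = exp (w / b * ln (b / w))" using w b by (simp add: powr_def)
      also have "\<dots> \<le> exp 1"
      proof -
        have "ln (b / w) \<le> b / w" using ln_le_minus_one[of "b / w"] bw by linarith
        then have "w / b * ln (b / w) \<le> w / b * (b / w)" using w b by (intro mult_left_mono) auto
        then show ?thesis using w b by simp
      qed
      finally show "(b / w) powr (1 - \<theta>) \<le> exp 1" .
    qed auto
    also have "\<mu> powr (1 / 2) \<le> k / (2 * exp 1)"
    proof -
      have "\<mu> powr (1 / 2) = sqrt \<mu>" using \<mu> by (simp add: powr_half_sqrt)
      also have "\<dots> \<le> sqrt ((k / (2 * exp 1))\<^sup>2)" using \<mu> by (intro real_sqrt_le_mono) (auto simp: \<mu>0_def)
      also have "\<dots> = k / (2 * exp 1)" using k by simp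
      finally show ?thesis .
    qed
    finally have "\<mu> * \<delta> powr (- w) + \<delta> powr b \<le> 2 * (k / (2 * exp 1)) * exp 1" by simp
    then have "\<mu> * \<delta> powr (- w) + \<delta> powr b \<le> k" by simp
    moreover have "b * \<delta> powr (b + w) \<le> \<mu> * w" using dbw b by simp
    ultimately show ?thesis using d by blast
  qed
  ultimately show ?thesis using b by blast
qed

section \<open>Sign-changing weak solutions\<close>

lemma completion_measurable_cong_AE:
  fixes f g :: "'a \<Rightarrow> real"
  assumes g: "g \<in> borel_measurable M" and ae: "AE x in M. f x = g x"
  shows "f \<in> borel_measurable (completion M)"
proof (rule measurableI)
  fix A :: "real set" assume A: "A \<in> sets borel"
  show "f -` A \<inter> space (completion M) \<in> sets (completion M)"
  proof (rule completion.in_sets_AE)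
    show "AE x in completion M. (x \<in> g -` A \<inter> space M) = (x \<in> f -` A \<inter> space (completion M))"
      using AE_completion[OF ae] by eventually_elim simp
    show "g -` A \<inter> space M \<in> sets (completion M)"
      using measurable_sets[OF g A] by (rule sets_completionI_sets)
  qed simp
qed simp

lemma completion_integral_cong_AE:
  fixes f g :: "'a \<Rightarrow> real"
  assumes g: "integrable M g" and ae: "AE x in M. f x = g x"
  shows "integrable (completion M) f" "integral\<^sup>L (completion M) f = integral\<^sup>L M g"
proof -
  have gm: "g \<in> borel_measurable M" using g by auto
  note fm = completion_measurable_cong_AE[OF gm ae]
  have gc: "g \<in> borel_measurable (completion M)" using gm by (rule measurable_completion)
  have aec: "AE x in completion M. f x = g x" by (rule AE_completion[OF ae])
  show "integrable (completion M) f"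
    using g gm integrable_cong_AE[OF fm gc aec] by (simp add: integrable_completion)
  show "integral\<^sup>L (completion M) f = integral\<^sup>L M g"
    using integral_cong_AE[OF fm gc aec] gm by (simp add: integral_completion)
qed

context fractional_form
begin

text \<open>
  Test functions are only Lebesgue measurable and vanish outside \<open>\<Omega>\<close> almost everywhere; the energy space used
  above consists of Borel functions that vanish there everywhere.
\<close>

lemma lebesgue_function_in_W:
  fixes \<phi> :: "'v \<Rightarrow> real"
  assumes m: "\<phi> \<in> borel_measurable lebesgue" and zero: "AE x in lebesgue. x \<notin> \<Omega> \<longrightarrow> \<phi> x = 0"
    and fin: "(\<integral>\<^sup>+ (x, y). ennreal (\<bar>\<phi> x - \<phi> y\<bar> powr p / norm (x - y) powr (real DIM('v) + \<sigma>)) \<partial>lebesgue) < \<infinity>"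
  obtains \<psi> where "\<psi> \<in> W" "AE x in lborel. \<phi> x = \<psi> x"
proof -
  obtain \<phi>' where \<phi>': "\<phi>' \<in> borel_measurable lborel" "AE x in lborel. \<phi> x = \<phi>' x"
    using completion_ex_borel_measurable_real[OF m] by blast
  define \<psi> where "\<psi> x = indicator \<Omega> x * \<phi>' x" for x
  have [measurable]: "\<psi> \<in> borel_measurable lborel"
    unfolding \<psi>_def[abs_def] using \<phi>'(1) Omega_sets by (intro borel_measurable_times borel_measurable_indicator)
  have ae: "AE x in lborel. \<phi> x = \<psi> x"
    using \<phi>'(2) zero[unfolded AE_completion_iff] by eventually_elim (auto simp: \<psi>_def indicator_def)
  have sf: "sigma_finite_measure (lborel :: 'v measure)" ..
  have ae2: "AE z in lborel \<Otimes>\<^sub>M lborel. (case z of (x, y) \<Rightarrow> ennreal (\<bar>\<phi> x - \<phi> y\<bar> powr p / norm (x - y) powr (real DIM('v) + \<sigma>))) = ennreal (gag \<psi> z)"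
    using AE_pair_fst[OF sf ae] AE_pair_snd[OF sf sf ae]
    by eventually_elim (auto simp: gag_def frac_kernel_def)
  have "(\<integral>\<^sup>+ z. ennreal (gag \<psi> z) \<partial>(lborel \<Otimes>\<^sub>M lborel)) = (\<integral>\<^sup>+ (x, y). ennreal (\<bar>\<phi> x - \<phi> y\<bar> powr p / norm (x - y) powr (real DIM('v) + \<sigma>)) \<partial>(lborel \<Otimes>\<^sub>M lborel))"
    by (rule nn_integral_cong_AE) (use ae2 in \<open>auto elim: eventually_mono\<close>)
  also have "\<dots> < \<infinity>" using fin by (simp add: nn_integral_completion lborel_prod)
  finally have "integrable (lborel \<Otimes>\<^sub>M lborel) (gag \<psi>)" by (intro integrableI_nonneg) (auto simp: gag_nonneg)
  then have "\<psi> \<in> W" by (auto simp: W_def \<psi>_def)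
  with ae show thesis by (rule that[rotated])
qed

end

lemma W_subset_X0:
  fixes \<Omega> :: "(real ^ 'n) set"
  assumes "fractional_form (s * p) \<Omega> p c0" and z: "z \<in> nonlocal_form.W lborel (frac_kernel (s * p)) \<Omega> p"
  shows "z \<in> X0 s p \<Omega>"
proof -
  interpret fractional_form "s * p" \<Omega> p c0 by fact
  have zm: "z \<in> borel_measurable lborel" by (rule W_measurable[OF z])
  have "integrable lborel (\<lambda>x. indicator \<Omega> x *\<^sub>R \<bar>z x\<bar> powr p)"
    using W_integrable_powr[OF z] Omega_sets by (intro integrable_mult_indicator)
  then have "integrable lebesgue (\<lambda>x. indicator \<Omega> x *\<^sub>R \<bar>z x\<bar> powr p)"
    by (subst integrable_completion) auto
  moreover have "(\<integral>\<^sup>+ (x, y). ennreal (\<bar>z x - z y\<bar> powr p / norm (x - y) powr (real CARD('n) + s * p)) \<partial>lebesgue)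
      = (\<integral>\<^sup>+ w. ennreal (gag z w) \<partial>(lborel \<Otimes>\<^sub>M lborel))"
    unfolding nn_integral_completion lborel_prod[symmetric]
    by (intro nn_integral_cong) (auto simp: gag_def frac_kernel_def)
  moreover have "(\<integral>\<^sup>+ w. ennreal (gag z w) \<partial>(lborel \<Otimes>\<^sub>M lborel)) < \<infinity>"
    using W_integrable_gag[OF z] by (subst nn_integral_eq_integral) (auto simp: gag_nonneg)
  ultimately show ?thesis
    using zm W_zero[OF z] unfolding X0_def set_integrable_def by (auto intro: measurable_completion)
qed

text \<open>
  The weak form is unchanged if the test function is replaced by its Borel representative. The bound on \<open>z\<close>
  makes both power terms integrable against every test function.
\<close>

lemma weak_solution_of_critical:
  fixes \<Omega> :: "(real ^ 'n) set"
  assumes form: "fractional_form (s * p) \<Omega> p c0" and q: "0 < q" and P: "0 < critical_exponent CARD('n) s p - 1"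
    and z: "z \<in> nonlocal_form.W lborel (frac_kernel (s * p)) \<Omega> p" and zb: "AE x in lborel. \<bar>z x\<bar> \<le> \<delta>"
    and EL: "\<And>\<phi>. \<phi> \<in> nonlocal_form.W lborel (frac_kernel (s * p)) \<Omega> p \<Longrightarrow>
      integrable (lborel \<Otimes>\<^sub>M lborel) (\<lambda>w. \<bar>z (fst w) - z (snd w)\<bar> powr (p - 2) * (z (fst w) - z (snd w)) * (\<phi> (fst w) - \<phi> (snd w)) * frac_kernel (s * p) w) \<and>
      (\<integral>w. \<bar>z (fst w) - z (snd w)\<bar> powr (p - 2) * (z (fst w) - z (snd w)) * (\<phi> (fst w) - \<phi> (snd w)) * frac_kernel (s * p) w \<partial>(lborel \<Otimes>\<^sub>M lborel))
       = (\<integral>x. (\<mu> * spow q (z x) + spow (critical_exponent CARD('n) s p - 1) (z x)) * \<phi> x \<partial>lborel)"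
  shows "weak_solution s p \<mu> q \<Omega> z"
  unfolding weak_solution_def
proof (intro conjI ballI)
  interpret fractional_form "s * p" \<Omega> p c0 by fact
  show "z \<in> X0 s p \<Omega>" by (rule W_subset_X0[OF form z])
  let ?r = "critical_exponent CARD('n) s p - 1"
  have zm [measurable]: "z \<in> borel_measurable lborel" by (rule W_measurable[OF z])
  fix \<phi> assume "\<phi> \<in> X0 s p \<Omega>"
  then have \<phi>: "\<phi> \<in> borel_measurable lebesgue" "AE x in lebesgue. x \<notin> \<Omega> \<longrightarrow> \<phi> x = 0"
    "(\<integral>\<^sup>+ (x, y). ennreal (\<bar>\<phi> x - \<phi> y\<bar> powr p / norm (x - y) powr (real DIM(real ^ 'n) + s * p)) \<partial>lebesgue) < \<infinity>"
    by (auto simp: X0_def)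
  obtain \<psi> where \<psi>: "\<psi> \<in> W" and ae: "AE x in lborel. \<phi> x = \<psi> x" by (rule lebesgue_function_in_W[OF \<phi>])
  have [measurable]: "\<psi> \<in> borel_measurable lborel" by (rule W_measurable[OF \<psi>])
  let ?G = "\<lambda>w. \<bar>z (fst w) - z (snd w)\<bar> powr (p - 2) * (z (fst w) - z (snd w)) * (\<psi> (fst w) - \<psi> (snd w)) * frac_kernel (s * p) w"
  note G = EL[OF \<psi>]
  have sf: "sigma_finite_measure (lborel :: (real ^ 'n) measure)" ..
  have aeG: "AE w in lborel \<Otimes>\<^sub>M lborel. energy_integrand s p z \<phi> w = ?G w"
    using AE_pair_fst[OF sf ae] AE_pair_snd[OF sf sf ae]
    by eventually_elim (auto simp: energy_integrand_def frac_kernel_def mult.commute[of s p])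
  note GC = completion_integral_cong_AE[OF conjunct1[OF G] aeG, unfolded lborel_prod]
  show "integrable lebesgue (energy_integrand s p z \<phi>)" by (rule GC(1))
  have power: "integrable lborel (\<lambda>x. spow a (z x) * \<psi> x)"
     "set_integrable lebesgue \<Omega> (\<lambda>x. \<bar>z x\<bar> powr (a - 1) * z x * \<phi> x)"
     "(LINT x:\<Omega>|lebesgue. \<bar>z x\<bar> powr (a - 1) * z x * \<phi> x) = (\<integral>x. spow a (z x) * \<psi> x \<partial>lborel)" if a: "0 < a" for a
  proof -
    show i: "integrable lborel (\<lambda>x. spow a (z x) * \<psi> x)"
    proof (rule Bochner_Integration.integrable_bound[of _ "\<lambda>x. \<delta> powr a * \<psi> x"])
      show "integrable lborel (\<lambda>x. \<delta> powr a * \<psi> x)" using W_integrable[OF \<psi>] by simp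
      show "AE x in lborel. norm (spow a (z x) * \<psi> x) \<le> norm (\<delta> powr a * \<psi> x)"
        using zb by eventually_elim (use a in \<open>auto simp: abs_mult abs_spow intro!: mult_right_mono powr_mono2\<close>)
    qed measurable
    have "AE x in lborel. indicator \<Omega> x *\<^sub>R (\<bar>z x\<bar> powr (a - 1) * z x * \<phi> x) = spow a (z x) * \<psi> x"
      using ae
    proof eventually_elim
      case (elim x)
      then show ?case using W_zero[OF \<psi>, of x] by (cases "x \<in> \<Omega>") (auto simp: spow_eq)
    qed
    from completion_integral_cong_AE[OF i this]
    show "set_integrable lebesgue \<Omega> (\<lambda>x. \<bar>z x\<bar> powr (a - 1) * z x * \<phi> x)"
      "(LINT x:\<Omega>|lebesgue. \<bar>z x\<bar> powr (a - 1) * z x * \<phi> x) = (\<integral>x. spow a (z x) * \<psi> x \<partial>lborel)"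
      by (simp_all add: set_integrable_def set_lebesgue_integral_def)
  qed
  have e: "?r - 1 = critical_exponent CARD('n) s p - 2" by simp
  show "set_integrable lebesgue \<Omega> (\<lambda>x. \<bar>z x\<bar> powr (q - 1) * z x * \<phi> x)" by (rule power(2)[OF q])
  show "set_integrable lebesgue \<Omega> (\<lambda>x. \<bar>z x\<bar> powr (critical_exponent CARD('n) s p - 2) * z x * \<phi> x)"
    using power(2)[OF P] unfolding e .
  have "(\<integral>x. (\<mu> * spow q (z x) + spow ?r (z x)) * \<psi> x \<partial>lborel) = (\<integral>x. \<mu> * (spow q (z x) * \<psi> x) + spow ?r (z x) * \<psi> x \<partial>lborel)"
    by (simp add: distrib_right mult.assoc)
  also have "\<dots> = \<mu> * (\<integral>x. spow q (z x) * \<psi> x \<partial>lborel) + (\<integral>x. spow ?r (z x) * \<psi> x \<partial>lborel)"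
    using power(1)[OF q] power(1)[OF P] by simp
  finally show "integral\<^sup>L lebesgue (energy_integrand s p z \<phi>) =
      \<mu> * (LINT x:\<Omega>|lebesgue. \<bar>z x\<bar> powr (q - 1) * z x * \<phi> x) +
      (LINT x:\<Omega>|lebesgue. \<bar>z x\<bar> powr (critical_exponent CARD('n) s p - 2) * z x * \<phi> x)"
    using GC(2) conjunct2[OF G, unfolded lborel_prod] power(3)[OF q] power(3)[OF P] unfolding e by simp
qed

lemma critical_exponent_gt:
  assumes "0 < s" "0 < p" "p * s < real N"
  shows "p < critical_exponent N s p"
proof -
  have "p * (real N - p * s) < real N * p" using assms by (simp add: algebra_simps)
  then show ?thesis using assms by (simp add: critical_exponent_def pos_less_divide_eq)
qed

lemma N0_ge:
  assumes "0 < s" "2 \<le> p"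
  shows "p * s \<le> N0 s p"
proof -
  have "1 \<le> p\<^sup>2 - p + 1"
  proof -
    have "p * 1 \<le> p * p" using assms by (intro mult_left_mono) auto
    then show ?thesis by (simp add: power2_eq_square)
  qed
  then have "s * p * 1 \<le> s * p * (p\<^sup>2 - p + 1)" "s * p * 1 \<le> s * p * (p + 1)"
    using assms by (intro mult_left_mono; simp)+
  then show ?thesis by (simp add: N0_def mult.commute)
qed

text \<open>
  The abstract result applies to the truncated reaction, and truncation is invisible to the critical point
  because its modulus is at most \<open>\<delta>\<close>. The bump functions live on \<open>\<Omega>\<close> and on two disjoint balls in \<open>\<Omega>\<close>.
\<close>

lemma sign_changing_solution:
  fixes \<Omega> :: "(real ^ 'n) set"
  assumes form: "fractional_form (s * p) \<Omega> p c0" and ne: "\<Omega> \<noteq> {}"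
  defines "r \<equiv> critical_exponent CARD('n) s p - 1"
  assumes tp: "trunc_param \<mu> q r \<delta> p" and small: "(\<mu> * \<delta> powr q + \<delta> powr r) * p \<le> c0 * \<delta> powr (p - 1)"
  shows "\<exists>u. weak_solution s p \<mu> q \<Omega> u \<and> sign_changing u"
proof -
  interpret fractional_form "s * p" \<Omega> p c0 by fact
  interpret t: trunc_param \<mu> q r \<delta> p by fact
  obtain F where F: "\<And>t. (F has_real_derivative t.f t) (at t)" "F 0 = 0" using t.ex_primitive by blast
  interpret reaction "lborel :: (real ^ 'n) measure" "frac_kernel (s * p)" \<Omega> p c0 t.f F "\<mu> * \<delta> powr q + \<delta> powr r" \<delta>
  proof unfold_locales
    show "t.f \<in> borel_measurable borel" by (rule borel_measurable_continuous_onI[OF t.f_continuous])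
  qed (use t.f_odd t.f_mono t.f_bound t.f_almost_lipschitz F t.delta small in auto)
  obtain x0 e where e: "0 < e" "ball x0 e \<subseteq> \<Omega>" using ne Omega_open open_contains_ball by blast
  obtain b :: "real ^ 'n" where b: "b \<in> Basis" using nonempty_Basis by blast
  define A1 where "A1 = ball (x0 + (e / 2) *\<^sub>R b) (e / 2)"
  define A2 where "A2 = ball (x0 - (e / 2) *\<^sub>R b) (e / 2)"
  have nb: "norm b = 1" using b by simp
  have A: "open A1" "open A2" "A1 \<noteq> {}" "A2 \<noteq> {}" using e by (auto simp: A1_def A2_def)
  have A1: "A1 \<subseteq> \<Omega>"
  proof -
    have "A1 \<subseteq> ball x0 e" unfolding A1_def using e nb by (subst ball_subset_ball_iff) (simp add: dist_norm)
    with e show ?thesis by blast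
  qed
  have A2: "A2 \<subseteq> \<Omega>"
  proof -
    have "A2 \<subseteq> ball x0 e" unfolding A2_def using e nb by (subst ball_subset_ball_iff) (simp add: dist_norm)
    with e show ?thesis by blast
  qed
  have disj: "x \<notin> A1 \<or> x \<notin> A2" for x
  proof (rule ccontr)
    assume "\<not> ?thesis"
    then have "dist (x0 + (e / 2) *\<^sub>R b) x < e / 2" "dist (x0 - (e / 2) *\<^sub>R b) x < e / 2" by (auto simp: A1_def A2_def)
    then have "dist (x0 + (e / 2) *\<^sub>R b) (x0 - (e / 2) *\<^sub>R b) < e"
      using dist_triangle2[of "x0 + (e / 2) *\<^sub>R b" "x0 - (e / 2) *\<^sub>R b" x] by linarith
    moreover have "dist (x0 + (e / 2) *\<^sub>R b) (x0 - (e / 2) *\<^sub>R b) = norm (e *\<^sub>R b)"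
      by (simp add: dist_norm flip: scaleR_add_left)
    ultimately show False using e nb by simp
  qed
  obtain \<eta> B0 where \<eta>: "\<eta> \<in> W" "\<And>x. 0 \<le> \<eta> x" "\<And>x. \<eta> x \<le> B0" "\<And>x. 0 < \<eta> x \<longleftrightarrow> x \<in> \<Omega>"
    using bump_exists[OF Omega_open order_refl] by blast
  obtain \<phi>1 B1 where \<phi>1: "\<phi>1 \<in> W" "\<And>x. 0 \<le> \<phi>1 x" "\<And>x. \<phi>1 x \<le> B1" "\<And>x. 0 < \<phi>1 x \<longleftrightarrow> x \<in> A1"
    using bump_exists[OF A(1) A1] by blast
  obtain \<phi>2 B2 where \<phi>2: "\<phi>2 \<in> W" "\<And>x. 0 \<le> \<phi>2 x" "\<And>x. \<phi>2 x \<le> B2" "\<And>x. 0 < \<phi>2 x \<longleftrightarrow> x \<in> A2"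
    using bump_exists[OF A(2) A2] by blast
  define B where "B = \<bar>B0\<bar> + \<bar>B1\<bar> + \<bar>B2\<bar> + 1"
  interpret sublinear_reaction "lborel :: (real ^ 'n) measure" "frac_kernel (s * p)" \<Omega> p c0 t.f F
    "\<mu> * \<delta> powr q + \<delta> powr r" \<delta> \<eta> \<phi>1 \<phi>2 "q + 1" "\<mu> / (q + 1)" B
  proof unfold_locales
    fix x
    show "\<mu> / (q + 1) * \<bar>t\<bar> powr (q + 1) \<le> F t" if "\<bar>t\<bar> \<le> \<delta>" for t
      using t.primitive_lower[OF F, of "\<bar>t\<bar>"] that F_abs[of t] by simp
    show "\<eta> x \<le> B" "\<phi>1 x \<le> B" "\<phi>2 x \<le> B" using \<eta>(3)[of x] \<phi>1(3)[of x] \<phi>2(3)[of x] by (auto simp: B_def)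
    show "\<phi>1 x * \<phi>2 x = 0" using disj[of x] \<phi>1(2,4)[of x] \<phi>2(2,4)[of x] by (auto simp: less_le)
    show "\<not> (AE x in lborel. \<phi>1 x = 0)" by (rule bump_not_null[OF A(1,3)]) (simp add: \<phi>1)
    show "\<not> (AE x in lborel. \<phi>2 x = 0)" by (rule bump_not_null[OF A(2,4)]) (simp add: \<phi>2)
    show "0 < B" by (simp add: B_def)
  qed (use t.f_pos t.f_decr t.mu t.q \<eta> \<phi>1 \<phi>2 in auto)
  obtain z where z: "critical z" and sign: "\<not> (AE x in lborel. 0 \<le> z x)" "\<not> (AE x in lborel. z x \<le> 0)"
    using ex_sign_changing_critical by blast
  have zW: "z \<in> W" by (rule criticalD(1)[OF z])
  have [measurable]: "z \<in> borel_measurable lborel" by (rule W_measurable[OF zW])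
  have zb: "AE x in lborel. \<bar>z x\<bar> \<le> \<delta>" by (rule critical_bound[OF z])
  have "weak_solution s p \<mu> q \<Omega> z"
  proof (rule weak_solution_of_critical[OF form t.q(1) _ zW zb])
    show "0 < critical_exponent CARD('n) s p - 1" using t.r_pos by (simp add: r_def)
    fix \<phi> assume \<phi>: "\<phi> \<in> W"
    have [measurable]: "\<phi> \<in> borel_measurable lborel" by (rule W_measurable[OF \<phi>])
    have [measurable]: "t.f \<in> borel_measurable borel" by (rule borel_measurable_continuous_onI[OF t.f_continuous])
    have "(\<integral>x. t.f (z x) * \<phi> x \<partial>lborel) = (\<integral>x. (\<mu> * spow q (z x) + spow r (z x)) * \<phi> x \<partial>lborel)"
    proof (rule integral_cong_AE)
      show "AE x in lborel. t.f (z x) * \<phi> x = (\<mu> * spow q (z x) + spow r (z x)) * \<phi> x"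
        using zb by eventually_elim (simp add: t.f_inside)
    qed measurable
    then show "integrable (lborel \<Otimes>\<^sub>M lborel) (\<lambda>w. \<bar>z (fst w) - z (snd w)\<bar> powr (p - 2) * (z (fst w) - z (snd w)) * (\<phi> (fst w) - \<phi> (snd w)) * frac_kernel (s * p) w) \<and>
      (\<integral>w. \<bar>z (fst w) - z (snd w)\<bar> powr (p - 2) * (z (fst w) - z (snd w)) * (\<phi> (fst w) - \<phi> (snd w)) * frac_kernel (s * p) w \<partial>(lborel \<Otimes>\<^sub>M lborel))
       = (\<integral>x. (\<mu> * spow q (z x) + spow (critical_exponent CARD('n) s p - 1) (z x)) * \<phi> x \<partial>lborel)"
      using critical_euler_lagrange[OF z \<phi>] by (simp add: r_def)
  qed
  moreover have "sign_changing z"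
    unfolding sign_changing_def AE_completion_iff
  proof (intro conjI notI)
    assume "AE x in lborel. max (z x) 0 = 0"
    then have "AE x in lborel. z x \<le> 0" by eventually_elim (simp add: max_def split: if_splits)
    with sign show False by simp
  next
    assume "AE x in lborel. max (- z x) 0 = 0"
    then have "AE x in lborel. 0 \<le> z x" by eventually_elim (simp add: max_def split: if_splits)
    with sign show False by simp
  qed
  ultimately show ?thesis by blast
qed

theorem theorem1p1:
  fixes s p :: real and \<Omega> :: "(real ^ 'n) set"
  assumes "0 < s" and "s < 1" and "2 \<le> p"
    and "N0 s p < real CARD('n)"
    and "bounded_smooth_domain \<Omega>"
  shows "\<exists>\<mu>star > 0. \<exists>q0. 0 < q0 \<and> q0 < p - 1 \<and>
    (\<forall>\<mu> q. 0 < \<mu> \<and> \<mu> < \<mu>star \<and> q0 < q \<and> q < p - 1 \<longrightarrow>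
      (\<exists>u. weak_solution s p \<mu> q \<Omega> u \<and> sign_changing u))"
proof -
  have \<Omega>: "open \<Omega>" "\<Omega> \<noteq> {}" "bounded \<Omega>" using assms(5) by (auto simp: bounded_smooth_domain_def)
  obtain c0 where c0: "0 < c0"
    "\<And>x. x \<in> \<Omega> \<Longrightarrow> ennreal c0 \<le> (\<integral>\<^sup>+ y. ennreal (frac_kernel (s * p) (x, y)) * indicator (- \<Omega>) y \<partial>lborel)"
    using frac_killing[OF \<Omega>(3), of "s * p"] assms by auto
  have form: "fractional_form (s * p) \<Omega> p c0"
  proof unfold_locales
    show "emeasure lborel \<Omega> < \<infinity>" by (rule emeasure_bounded_finite[OF \<Omega>(3)])
    show "s * p < p" using assms by simp
    show "0 < frac_kernel (s * p) (x, y)" if "x \<noteq> y" for x y :: "real ^ 'n" using that by (rule frac_kernel_pos)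
    show "ennreal c0 \<le> (\<integral>\<^sup>+ y. ennreal (frac_kernel (s * p) (x, y)) * indicator (- \<Omega>) y \<partial>lborel)" if "x \<in> \<Omega>" for x
      using that by (rule c0(2))
  qed (use \<Omega> c0(1) assms(1-3) frac_kernel_nonneg in auto)
  define b where "b = critical_exponent CARD('n) s p - p"
  have "p * s < real CARD('n)" using N0_ge[OF assms(1,3)] assms(4) by linarith
  then have b: "0 < b" using critical_exponent_gt[of s p "CARD('n)"] assms by (simp add: b_def)
  have k: "0 < c0 / p" using c0 assms by simp
  obtain \<mu>0 w0 where \<mu>0: "0 < \<mu>0" "0 < w0"
    and lev: "\<And>\<mu> w. 0 < \<mu> \<Longrightarrow> \<mu> < \<mu>0 \<Longrightarrow> 0 < w \<Longrightarrow> w < w0 \<Longrightarrow>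
      \<exists>\<delta>>0. b * \<delta> powr (b + w) \<le> \<mu> * w \<and> \<mu> * \<delta> powr (- w) + \<delta> powr b \<le> c0 / p"
    using truncation_level_exists[OF b k] by blast
  \<comment> \<open>The cap \<open>1 / 2\<close> only serves to keep \<open>q0\<close> positive.\<close>
  define q0 where "q0 = p - 1 - min w0 (1 / 2)"
  have "\<exists>u. weak_solution s p \<mu> q \<Omega> u \<and> sign_changing u"
    if \<mu>: "0 < \<mu>" "\<mu> < \<mu>0" and q: "q0 < q" "q < p - 1" for \<mu> q
  proof -
    define w where "w = p - 1 - q"
    have w: "0 < w" "w < w0" using q by (auto simp: w_def q0_def)
    obtain \<delta> where \<delta>: "0 < \<delta>" "b * \<delta> powr (b + w) \<le> \<mu> * w" "\<mu> * \<delta> powr (- w) + \<delta> powr b \<le> c0 / p"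
      using lev[OF \<mu> w] by blast
    let ?r = "critical_exponent CARD('n) s p - 1"
    have e: "?r - (p - 1) = b" "?r - q = b + w" "p - 1 + (- w) = q" "p - 1 + b = ?r" by (auto simp: b_def w_def)
    have tp: "trunc_param \<mu> q ?r \<delta> p"
    proof
      show "0 < q" using q assms by (auto simp: q0_def)
      show "p - 1 < ?r" using b by (simp add: b_def)
      show "(?r - (p - 1)) * \<delta> powr (?r - q) \<le> \<mu> * (p - 1 - q)" using \<delta>(2) unfolding e by (simp add: w_def)
    qed (use \<mu> q \<delta> in auto)
    have "(\<mu> * \<delta> powr q + \<delta> powr ?r) * p = \<delta> powr (p - 1) * (\<mu> * \<delta> powr (- w) + \<delta> powr b) * p"
    proof -
      have "\<delta> powr q = \<delta> powr (p - 1) * \<delta> powr (- w)" "\<delta> powr ?r = \<delta> powr (p - 1) * \<delta> powr b"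
        unfolding powr_add[symmetric] e by (rule refl)+
      then show ?thesis by (simp only: distrib_left mult_ac)
    qed
    also have "\<dots> \<le> \<delta> powr (p - 1) * (c0 / p) * p"
      using \<delta>(3) assms by (intro mult_right_mono mult_left_mono) auto
    also have "\<dots> = c0 * \<delta> powr (p - 1)" using assms by simp
    finally show ?thesis by (rule sign_changing_solution[OF form \<Omega>(2) tp])
  qed
  moreover have "0 < q0" "q0 < p - 1" using assms \<mu>0 by (auto simp: q0_def)
  ultimately show ?thesis using \<mu>0(1) by blast
qed

end
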